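(* Let $\chi_0\in C_c^\infty(\mathbb{R})$ be such that $\operatorname{supp}\chi_0\subseteq(-1/2,1/2)$ and $\chi_0|_{[-1/4,1/4]}=1$. For all $t\in\mathbb{R}$, let $F_t(\lambda)=e^{it\lambda}\chi_0(\lambda)$. Then, for all $s\ge0$, there is a constant $C_s$ such that $$\|F_t\|_{L^\infty_s}\le C_s(1+|t|)^s\qquad\forall t\in\mathbb{R}.$$ Moreover, there exist $t_0>0$ and, for every integer $q\ge2$, a constant $c_q>0$, such that $$\|F_t(\mathcal{L}_{\mathbb{T}_q})\|_{H^1(m_{\mathbb{T}_q})\to L^1(m_{\mathbb{T}_q})}\ge c_q\,t^{3/2}\qquad\forall t\ge t_0,\ q\ge2.$$
   Context: For a positive integer $q$, $\mathbb{T}_q$ is the homogeneous tree (infinite connected graph without cycles, identified with its vertex set, with graph distance $d$) in which every vertex has $q+1$ neighbours, with a fixed boundary point (end) $\omega_*$. For $x\in\mathbb{T}_q$, the predecessor $\mathfrak{p}(x)$ is the neighbour of $x$ lying on the semi-infinite geodesic from $x$ to $\omega_*$; the other $q$ neighbours form the set $\mathfrak{s}(x)$ of successors. Write $x\le y$ if $y$ belongs to the semi-infinite geodesic from $x$ to $\omega_*$. A level function $\ell:\mathbb{T}_q\to\mathbb{Z}$ with $\ell(\mathfrak{p}(x))=\ell(x)+1$ is fixed, and $m_{\mathbb{T}_q}(x)=q^{\ell(x)}$ is the canonical flow measure (density with respect to counting measure). The flow Laplacian is $\mathcal{L}_{\mathbb{T}_q}=\frac12\nabla^*\nabla$, where $\nabla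 f(x)=f(x)-f(\mathfrak{p}(x))$ and $\nabla^*$ is the adjoint on $L^2(m_{\mathbb{T}_q})$; $F(\mathcal{L}_{\mathbb{T}_q})$ is defined by the spectral theorem. $L^\infty_s(\mathbb{R})$ is the $L^\infty$ Sobolev space of order $s$ on $\mathbb{R}$, i.e. the space of $F=(1-\partial^2)^{-s/2}g$ with $g\in L^\infty(\mathbb{R})$, $\|F\|_{L^\infty_s}=\|g\|_\infty$. Hardy space. Write $m=m_{\mathbb{T}_q}$. For $x\in\mathbb{T}_q$ and integers $1\le h'<h''$ let $R_{h'}^{h''}(x)=\{y\le x:h'\le d(x,y)<h''\}$. An admissible trapezoid is either a singleton or a set $R_{h'}^{h''}(x)$ with $2\le h''/h'\le12$. An atom is a function $a$ supported in an admissible trapezoid $R$ with $\sum_xa(x)m(x)=0$ and $\|a\|_\infty\le1/m(R)$. $H^1(m)$ is the space of all sums $\sum_j\lambda_ja_j$ (convergence in $L^1(m)$) with $a_j$ atoms and $\sum_j|\lambda_j|<\infty$, normed by the infimum of $\sum_j|\lambda_j|$. *)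

theory Defs
  imports "HOL-Probability.Probability" "HOL-Computational_Algebra.Polynomial"
begin

section \<open>Smooth functions and Sobolev spaces on the real line\<close>

definition iter_deriv :: "nat \<Rightarrow> (real \<Rightarrow> complex) \<Rightarrow> real \<Rightarrow> complex" where
  "iter_deriv n f = ((\<lambda>g x. vector_derivative g (at x)) ^^ n) f"

definition smooth :: "(real \<Rightarrow> complex) \<Rightarrow> bool" where
  "smooth f \<longleftrightarrow> (\<forall>n x. iter_deriv n f differentiable (at x))"

definition supp :: "(real \<Rightarrow> complex) \<Rightarrow> real set" where
  "supp f = closure {x. f x \<noteq> 0}"

definition Cc_infinity :: "(real \<Rightarrow> complex) set" where
  "Cc_infinity = {f. smooth f \<and> compact (supp f)}"

definition schwartz :: "(real \<Rightarrow> complex) set" where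
  "schwartz = {f. smooth f \<and>
     (\<forall>k n. bounded (range (\<lambda>x. complex_of_real (x ^ k) * iter_deriv n f x)))}"

definition fourier :: "(real \<Rightarrow> complex) \<Rightarrow> real \<Rightarrow> complex" where
  "fourier f \<xi> = (LINT x|lborel. f x * exp (- (\<i> * complex_of_real (\<xi> * x))))"

text \<open>
  The operator \<open>(1 - \<partial>\<^sup>2) ^ (- s / 2)\<close> on Schwartz functions, that is, the Fourier multiplier
  with symbol \<open>(1 + \<xi>\<^sup>2) ^ (- s / 2)\<close>.
\<close>
definition bessel_schwartz :: "real \<Rightarrow> (real \<Rightarrow> complex) \<Rightarrow> real \<Rightarrow> complex" where
  "bessel_schwartz s f x = complex_of_real (1 / (2 * pi)) *
     (LINT \<xi>|lborel. complex_of_real ((1 + \<xi>\<^sup>2) powr (- s / 2)) * fourier f \<xi>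
                      * exp (\<i> * complex_of_real (\<xi> * x)))"

definition Linf_norm :: "(real \<Rightarrow> complex) \<Rightarrow> ennreal" where
  "Linf_norm g = esssup lborel (\<lambda>x. ennreal (cmod (g x)))"

definition Linf :: "(real \<Rightarrow> complex) set" where
  "Linf = {g \<in> borel_measurable lborel. Linf_norm g < \<infinity>}"

text \<open>
  \<open>is_bessel_potential s g F\<close> says that \<open>F = (1 - \<partial>\<^sup>2) ^ (- s / 2) g\<close> as tempered distributions.
  The symbol of the multiplier is even, so its transpose for the bilinear pairing
  \<open>\<integral> F \<phi>\<close> is again \<open>bessel_schwartz s\<close>, and this is how it acts on distributions.
\<close>
definition is_bessel_potential :: "real \<Rightarrow> (real \<Rightarrow> complex) \<Rightarrow> (real \<Rightarrow> complex) \<Rightarrow> bool" where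
  "is_bessel_potential s g F \<longleftrightarrow>
     F \<in> borel_measurable lborel \<and>
     (\<forall>\<phi>\<in>schwartz. integrable lborel (\<lambda>x. F x * \<phi> x) \<and>
        (LINT x|lborel. F x * \<phi> x) = (LINT x|lborel. g x * bessel_schwartz s \<phi> x))"

definition Linf_sobolev :: "real \<Rightarrow> (real \<Rightarrow> complex) set" where
  "Linf_sobolev s = {F. \<exists>g\<in>Linf. is_bessel_potential s g F}"

text \<open>
  The function \<open>g\<close> is determined by \<open>F\<close> up to null sets, so the infimum below ranges over at most
  one value; it is \<open>\<infinity>\<close> exactly when \<open>F\<close> is not in \<open>Linf_sobolev s\<close>.
\<close>
definition Linf_sobolev_norm :: "real \<Rightarrow> (real \<Rightarrow> complex) \<Rightarrow> ennreal" where
  "Linf_sobolev_norm s F = Inf (Linf_norm ` {g \<in> Linf. is_bessel_potential s g F})"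


section \<open>Operators on an L2 space and functional calculus\<close>

text \<open>
  Below, \<open>M\<close> will be a measure on a discrete space in which every point has positive mass.  Hence
  functions need not be identified almost everywhere, and L2 is a set of functions.
  Operators are maps between functions that are only used on L2.
\<close>

definition L2 :: "'v measure \<Rightarrow> ('v \<Rightarrow> complex) set" where
  "L2 M = {f \<in> borel_measurable M. integrable M (\<lambda>x. (cmod (f x))\<^sup>2)}"

definition L2_inner :: "'v measure \<Rightarrow> ('v \<Rightarrow> complex) \<Rightarrow> ('v \<Rightarrow> complex) \<Rightarrow> complex" where
  "L2_inner M f g = (LINT x|M. f x * cnj (g x))"

definition L2_norm :: "'v measure \<Rightarrow> ('v \<Rightarrow> complex) \<Rightarrow> real" where
  "L2_norm M f = sqrt (LINT x|M. (cmod (f x))\<^sup>2)"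

definition L1_norm :: "'v measure \<Rightarrow> ('v \<Rightarrow> complex) \<Rightarrow> ennreal" where
  "L1_norm M f = (\<integral>\<^sup>+x. ennreal (cmod (f x)) \<partial>M)"

type_synonym 'v operator = "('v \<Rightarrow> complex) \<Rightarrow> 'v \<Rightarrow> complex"

definition L2_adjoint :: "'v measure \<Rightarrow> 'v operator \<Rightarrow> 'v operator" where
  "L2_adjoint M T g =
     (THE h. h \<in> L2 M \<and> (\<forall>f\<in>L2 M. L2_inner M (T f) g = L2_inner M f h))"

definition L2_bounded :: "'v measure \<Rightarrow> 'v operator \<Rightarrow> bool" where
  "L2_bounded M T \<longleftrightarrow>
     (\<forall>f\<in>L2 M. T f \<in> L2 M) \<and> (\<exists>B. \<forall>f\<in>L2 M. L2_norm M (T f) \<le> B * L2_norm M f)"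

text \<open>
  The two-sided inverse \<open>S\<close> is automatically linear on L2 when \<open>A\<close> is.
\<close>
definition L2_spectrum :: "'v measure \<Rightarrow> 'v operator \<Rightarrow> complex set" where
  "L2_spectrum M A = {z. \<not> (\<exists>S. L2_bounded M S \<and>
     (\<forall>f\<in>L2 M. S (\<lambda>x. A f x - z * f x) = f \<and> (\<lambda>x. A (S f) x - z * S f x) = f))}"

definition poly_op :: "complex poly \<Rightarrow> 'v operator \<Rightarrow> 'v operator" where
  "poly_op p A f x = (\<Sum>k\<le>degree p. coeff p k * (A ^^ k) f x)"

text \<open>
  The spectral theorem for a bounded self-adjoint operator \<open>A\<close> and a function \<open>F\<close> that is continuous
  on the spectrum (which is a compact set of reals): \<open>F(A) f\<close> is the L2 limit of \<open>p\<^sub>n(A) f\<close> for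
  every sequence of polynomials \<open>p\<^sub>n\<close> converging to \<open>F\<close> uniformly on the spectrum.
\<close>
definition functional_calculus ::
  "'v measure \<Rightarrow> 'v operator \<Rightarrow> (real \<Rightarrow> complex) \<Rightarrow> 'v operator" where
  "functional_calculus M A F f =
     (THE h. h \<in> L2 M \<and>
        (\<forall>p :: nat \<Rightarrow> complex poly.
           uniform_limit {r. complex_of_real r \<in> L2_spectrum M A}
             (\<lambda>n r. poly (p n) (complex_of_real r)) F sequentially \<longrightarrow>
           (\<lambda>n. L2_norm M (\<lambda>x. poly_op (p n) A f x - h x)) \<longlonglongrightarrow> 0))"


section \<open>Homogeneous trees and the flow Laplacian\<close>

text \<open>
  A tree is given by its adjacency relation; the vertices are all elements of the type.  In
  \<open>homogeneous_tree q adj\<close>, every vertex has \<open>q + 1\<close> neighbours.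
\<close>
definition homogeneous_tree :: "nat \<Rightarrow> ('v \<Rightarrow> 'v \<Rightarrow> bool) \<Rightarrow> bool" where
  "homogeneous_tree q adj \<longleftrightarrow>
     q \<ge> 1 \<and> infinite (UNIV :: 'v set) \<and>
     (\<forall>x. \<not> adj x x) \<and> (\<forall>x y. adj x y \<longrightarrow> adj y x) \<and>
     (\<forall>x y. adj\<^sup>*\<^sup>* x y) \<and>
     \<not> (\<exists>xs. length xs \<ge> 3 \<and> distinct xs \<and> successively adj xs \<and> adj (last xs) (hd xs)) \<and>
     (\<forall>x. card {y. adj x y} = q + 1)"

definition graph_dist :: "('v \<Rightarrow> 'v \<Rightarrow> bool) \<Rightarrow> 'v \<Rightarrow> 'v \<Rightarrow> nat" where
  "graph_dist adj x y = (LEAST n. (adj ^^ n) x y)"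

definition geodesic_ray :: "('v \<Rightarrow> 'v \<Rightarrow> bool) \<Rightarrow> (nat \<Rightarrow> 'v) \<Rightarrow> bool" where
  "geodesic_ray adj r \<longleftrightarrow> (\<forall>i j. graph_dist adj (r i) (r (i + j)) = j)"

text \<open>
  The boundary points (ends) of a tree are the classes of semi-infinite geodesics, two of which are
  equivalent if they eventually coincide up to a shift.  The semi-infinite geodesic from a vertex
  \<open>x\<close> to the end \<open>\<omega>\<close> is the member of the class \<open>\<omega>\<close> starting at \<open>x\<close>.
\<close>
definition ends :: "('v \<Rightarrow> 'v \<Rightarrow> bool) \<Rightarrow> (nat \<Rightarrow> 'v) set set" where
  "ends adj = {r. geodesic_ray adj r} //
     {(r, s). geodesic_ray adj r \<and> geodesic_ray adj s \<and> (\<exists>k l. \<forall>n. r (k + n) = s (l + n))}"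

definition tree_le :: "(nat \<Rightarrow> 'v) set \<Rightarrow> 'v \<Rightarrow> 'v \<Rightarrow> bool" where
  "tree_le \<omega> x y \<longleftrightarrow> (\<exists>r\<in>\<omega>. r 0 = x \<and> y \<in> range r)"

definition predecessor :: "('v \<Rightarrow> 'v \<Rightarrow> bool) \<Rightarrow> (nat \<Rightarrow> 'v) set \<Rightarrow> 'v \<Rightarrow> 'v" where
  "predecessor adj \<omega> x = (THE y. adj x y \<and> tree_le \<omega> x y)"

definition level_function ::
  "('v \<Rightarrow> 'v \<Rightarrow> bool) \<Rightarrow> (nat \<Rightarrow> 'v) set \<Rightarrow> ('v \<Rightarrow> int) \<Rightarrow> bool" where
  "level_function adj \<omega> lev \<longleftrightarrow> (\<forall>x. lev (predecessor adj \<omega> x) = lev x + 1)"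

definition flow_measure :: "nat \<Rightarrow> ('v \<Rightarrow> int) \<Rightarrow> 'v measure" where
  "flow_measure q lev = density (count_space UNIV) (\<lambda>x. ennreal (real q powi lev x))"

definition flow_gradient :: "('v \<Rightarrow> 'v \<Rightarrow> bool) \<Rightarrow> (nat \<Rightarrow> 'v) set \<Rightarrow> 'v operator" where
  "flow_gradient adj \<omega> f x = f x - f (predecessor adj \<omega> x)"

definition flow_laplacian ::
  "nat \<Rightarrow> ('v \<Rightarrow> 'v \<Rightarrow> bool) \<Rightarrow> (nat \<Rightarrow> 'v) set \<Rightarrow> ('v \<Rightarrow> int) \<Rightarrow> 'v operator" where
  "flow_laplacian q adj \<omega> lev f x =
     1 / 2 * L2_adjoint (flow_measure q lev) (flow_gradient adj \<omega>) (flow_gradient adj \<omega> f) x"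


section \<open>The atomic Hardy space\<close>

definition trapezoid ::
  "('v \<Rightarrow> 'v \<Rightarrow> bool) \<Rightarrow> (nat \<Rightarrow> 'v) set \<Rightarrow> nat \<Rightarrow> nat \<Rightarrow> 'v \<Rightarrow> 'v set" where
  "trapezoid adj \<omega> h' h'' x = {y. tree_le \<omega> y x \<and> h' \<le> graph_dist adj x y \<and> graph_dist adj x y < h''}"

definition admissible_trapezoid ::
  "('v \<Rightarrow> 'v \<Rightarrow> bool) \<Rightarrow> (nat \<Rightarrow> 'v) set \<Rightarrow> 'v set \<Rightarrow> bool" where
  "admissible_trapezoid adj \<omega> R \<longleftrightarrow>
     (\<exists>x. R = {x}) \<or>
     (\<exists>x h' h''. 1 \<le> h' \<and> h' < h'' \<and> 2 \<le> real h'' / real h' \<and> real h'' / real h' \<le> 12 \<and>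
        R = trapezoid adj \<omega> h' h'' x)"

definition atom ::
  "nat \<Rightarrow> ('v \<Rightarrow> 'v \<Rightarrow> bool) \<Rightarrow> (nat \<Rightarrow> 'v) set \<Rightarrow> ('v \<Rightarrow> int) \<Rightarrow> ('v \<Rightarrow> complex) \<Rightarrow> bool" where
  "atom q adj \<omega> lev a \<longleftrightarrow>
     (\<exists>R. admissible_trapezoid adj \<omega> R \<and>
        (\<forall>x. x \<notin> R \<longrightarrow> a x = 0) \<and>
        (LINT x|flow_measure q lev. a x) = 0 \<and>
        (\<forall>x. cmod (a x) \<le> 1 / measure (flow_measure q lev) R))"

definition atomic_decomposition ::
  "nat \<Rightarrow> ('v \<Rightarrow> 'v \<Rightarrow> bool) \<Rightarrow> (nat \<Rightarrow> 'v) set \<Rightarrow> ('v \<Rightarrow> int) \<Rightarrow> ('v \<Rightarrow> complex) \<Rightarrow>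
   (nat \<Rightarrow> complex) \<Rightarrow> (nat \<Rightarrow> 'v \<Rightarrow> complex) \<Rightarrow> bool" where
  "atomic_decomposition q adj \<omega> lev f c a \<longleftrightarrow>
     (\<forall>j. atom q adj \<omega> lev (a j)) \<and> summable (\<lambda>j. cmod (c j)) \<and>
     (\<lambda>n. L1_norm (flow_measure q lev) (\<lambda>x. f x - (\<Sum>j<n. c j * a j x))) \<longlonglongrightarrow> 0"

definition H1 ::
  "nat \<Rightarrow> ('v \<Rightarrow> 'v \<Rightarrow> bool) \<Rightarrow> (nat \<Rightarrow> 'v) set \<Rightarrow> ('v \<Rightarrow> int) \<Rightarrow> ('v \<Rightarrow> complex) set" where
  "H1 q adj \<omega> lev = {f. \<exists>c a. atomic_decomposition q adj \<omega> lev f c a}"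

definition H1_norm ::
  "nat \<Rightarrow> ('v \<Rightarrow> 'v \<Rightarrow> bool) \<Rightarrow> (nat \<Rightarrow> 'v) set \<Rightarrow> ('v \<Rightarrow> int) \<Rightarrow> ('v \<Rightarrow> complex) \<Rightarrow> ennreal" where
  "H1_norm q adj \<omega> lev f =
     Inf {ennreal (\<Sum>j. cmod (c j)) | c a. atomic_decomposition q adj \<omega> lev f c a}"

text \<open>
  The norm from \<open>H1\<close> to L1 of an operator that is given on L2.  It is computed on the dense
  subspace \<open>H1 \<inter> L2\<close> (dense since it contains the finite linear combinations of atoms), and is
  \<open>\<infinity>\<close> if the operator has no bounded extension.
\<close>
definition H1_L1_opnorm ::
  "nat \<Rightarrow> ('v \<Rightarrow> 'v \<Rightarrow> bool) \<Rightarrow> (nat \<Rightarrow> 'v) set \<Rightarrow> ('v \<Rightarrow> int) \<Rightarrow> 'v operator \<Rightarrow> ennreal" where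
  "H1_L1_opnorm q adj \<omega> lev T =
     (SUP f\<in>{f \<in> H1 q adj \<omega> lev \<inter> L2 (flow_measure q lev). H1_norm q adj \<omega> lev f \<le> 1}.
        L1_norm (flow_measure q lev) (T f))"

end

theory Submission
  imports Defs
begin

text \<open>
  Sobolev bound: the Fourier transform of \<open>F t\<close> is a translate of that of \<open>chi0\<close>, so
  \<open>(1 - \<partial>\<^sup>2) ^ (s / 2) (F t)\<close> is bounded by the integral of \<open>(1 + \<bar>\<xi> + t\<bar>) powr s\<close>
  against a rapidly decreasing function.

  Lower bound: \<open>up f x = f (par x)\<close> is an isometry of L2 with adjoint \<open>dn\<close>, and the flow Laplacian
  is \<open>lap = 1 - (up + dn) / 2\<close>.  Since \<open>dn\<close> is a left inverse of \<open>up\<close>, the Chebyshev polynomial of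
  the second kind of degree \<open>n\<close> in \<open>1 - lap\<close> is the sum \<open>cheb n\<close> of \<open>up ^ i dn ^ j\<close> over
  \<open>i + j = n\<close>.  Hence \<open>G(lap)\<close> is the sum of \<open>c (i + j) up ^ i dn ^ j\<close>, where \<open>c n\<close> are the sine
  coefficients of \<open>G (1 - cos \<theta>) sin \<theta>\<close>.  Applied to a point mass this has L1 norm at
  least a constant times the sum of \<open>n \<bar>c n\<bar>\<close>, because all pairs with \<open>i + j = n\<close> contribute
  equally.  The atom is a multiple of \<open>lap\<close> applied to a point mass, so that \<open>G \<lambda> = \<lambda> F t \<lambda>\<close>.
  By van der Corput \<open>\<bar>c n\<bar> \<le> C t ^ (-1/2)\<close>, while by Parseval the sum of \<open>\<bar>c n\<bar>\<^sup>2\<close> does not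
  depend on \<open>t\<close>.  So a fixed portion of that sum comes from \<open>n \<ge> \<epsilon> t\<close>, which forces the sum of
  \<open>n \<bar>c n\<bar>\<close> to be at least of order \<open>t \<cdot> t ^ (1/2)\<close>.
\<close>

text \<open>The lower bound is explicit because the geometry of the tree factors out. The mass of
  \<open>meet z i j\<close> is proportional to q^j, the coefficient read off there is divided by
  q^j, and what remains of the tree is a factor depending on q alone. The oscillatory estimate
  involves no tree, so \<open>t0\<close> can serve all q. The support of \<open>chi0\<close> keeps
  \<theta> below pi/3, away from \<theta> = pi/2, where the second derivative of the phase t (1 -
  cos \<theta>) vanishes and the bound t^(-1/2) breaks down. The functional calculus is specified by
  polynomial approximation on the spectrum, so its existence must be shown. Two facts suffice: the
  norm of p(\<open>lap\<close>) is at most the supremum of |p| on [0,2], which follows from the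
  Chebyshev expansion, and the spectrum contains (0,2), so that convergence on the spectrum controls
  this supremum. From above, the crude inclusion in [-2,2] is enough to choose approximating
  polynomials. The Bessel potential acts by duality on Schwartz functions; exhibiting the potential
  of \<open>F t\<close> therefore rests on Fourier inversion.\<close>

section \<open>Oscillatory integrals and sine coefficients\<close>

text \<open>
  Integrating by parts with the amplitude \<open>w / (w\<^sup>2 + l)\<close> instead of \<open>1 / w\<close> avoids splitting the
  interval around a zero of the phase derivative \<open>w\<close>.
\<close>
lemma van_der_corput_second:
  fixes psi psi' :: "real \<Rightarrow> complex" and phi w w' :: "real \<Rightarrow> real"
  assumes ab: "a \<le> b" and l: "l > 0"
    and psi: "\<And>x. x \<in> {a..b} \<Longrightarrow> (psi has_vector_derivative psi' x) (at x within {a..b})"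
    and phi: "\<And>x. x \<in> {a..b} \<Longrightarrow> (phi has_real_derivative w x) (at x within {a..b})"
    and w: "\<And>x. x \<in> {a..b} \<Longrightarrow> (w has_real_derivative w' x) (at x within {a..b})"
    and w': "\<And>x. x \<in> {a..b} \<Longrightarrow> w' x \<ge> l"
    and bnd: "psi a = 0" "psi b = 0"
    and K0: "\<And>x. x \<in> {a..b} \<Longrightarrow> cmod (psi x) \<le> K0"
    and K1: "\<And>x. x \<in> {a..b} \<Longrightarrow> cmod (psi' x) \<le> K1"
  shows "cmod (integral {a..b} (\<lambda>x. iexp (phi x) * psi x))
           \<le> (K1 * (b - a) / 2 + 2 * pi * K0) / sqrt l"
proof -
  define f where "f x = iexp (phi x) * psi x" for x
  define Phi where "Phi x = psi x * of_real (w x / ((w x)\<^sup>2 + l)) * iexp (phi x)" for x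
  define amp' where "amp' x = w' x * (l - (w x)\<^sup>2) / ((w x)\<^sup>2 + l)\<^sup>2" for x
  \<comment> \<open>The oscillating factor contributes i psi w^2 / (w^2 + l), written here as i psi
    (1 - l / (w^2 + l)): the 1 reproduces the integrand, the rest is an error.\<close>
  define Phi' where "Phi' x = (psi' x * of_real (w x / ((w x)\<^sup>2 + l)) + psi x * of_real (amp' x)
       + \<i> * psi x * of_real (1 - l / ((w x)\<^sup>2 + l))) * iexp (phi x)" for x
  have pos: "(w x)\<^sup>2 + l > 0" for x using l by (simp add: add_nonneg_pos)
  have dPhi: "(Phi has_vector_derivative Phi' x) (at x within {a..b})" if x: "x \<in> {a..b}" for x
  proof -
    have "((\<lambda>x. w x / ((w x)\<^sup>2 + l)) has_real_derivative amp' x) (at x within {a..b})"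
      unfolding amp'_def using pos[of x] l
      by (auto intro!: derivative_eq_intros w[OF x] simp: power2_eq_square field_simps)
    then have 1: "((\<lambda>x. complex_of_real (w x / ((w x)\<^sup>2 + l))) has_vector_derivative of_real (amp' x))
       (at x within {a..b})"
      by (intro has_vector_derivative_of_real) (simp add: has_real_derivative_iff_has_vector_derivative)
    have "((\<lambda>x. complex_of_real (phi x)) has_vector_derivative of_real (w x)) (at x within {a..b})"
      using phi[OF x]
      by (intro has_vector_derivative_of_real) (simp add: has_real_derivative_iff_has_vector_derivative)
    then have "((\<lambda>x. \<i> * complex_of_real (phi x)) has_vector_derivative \<i> * of_real (w x)) (at x within {a..b})"
      by (rule has_vector_derivative_mult_right)
    then have "(exp \<circ> (\<lambda>x. \<i> * complex_of_real (phi x)) has_vector_derivative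
        (\<i> * of_real (w x)) * iexp (phi x)) (at x within {a..b})"
      by (rule field_vector_diff_chain_within) (auto intro!: derivative_eq_intros)
    then have 2: "((\<lambda>x. iexp (phi x)) has_vector_derivative
        (\<i> * of_real (w x)) * iexp (phi x)) (at x within {a..b})"
      by (simp add: o_def)
    have e: "1 - l / ((w x)\<^sup>2 + l) = w x / ((w x)\<^sup>2 + l) * w x"
      using pos[of x] by (simp add: field_simps power2_eq_square)
    have "(Phi has_vector_derivative (psi x * of_real (w x / ((w x)\<^sup>2 + l))) * ((\<i> * of_real (w x)) * iexp (phi x))
      + (psi x * of_real (amp' x) + psi' x * of_real (w x / ((w x)\<^sup>2 + l))) * iexp (phi x)) (at x within {a..b})"
      unfolding Phi_def
      by (intro has_vector_derivative_mult psi[OF x] 1 2)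
    moreover have "(psi x * of_real (w x / ((w x)\<^sup>2 + l))) * ((\<i> * of_real (w x)) * iexp (phi x))
      + (psi x * of_real (amp' x) + psi' x * of_real (w x / ((w x)\<^sup>2 + l))) * iexp (phi x) = Phi' x"
      unfolding Phi'_def e of_real_mult by (simp add: algebra_simps)
    ultimately show ?thesis by simp
  qed
  have I1: "(Phi' has_integral 0) {a..b}"
    using fundamental_theorem_of_calculus[OF ab dPhi] by (simp add: Phi_def bnd)
  have contpsi: "continuous_on {a..b} psi"
    by (meson continuous_on_eq_continuous_within has_vector_derivative_continuous psi)
  have contphi: "continuous_on {a..b} phi"
    by (meson DERIV_continuous_on phi)
  have "f integrable_on {a..b}" unfolding f_def
    by (intro integrable_continuous_interval continuous_intros contpsi contphi)
  define g where "g x = - \<i> * Phi' x - f x" for x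
  have I2: "(g has_integral (0 - integral {a..b} f)) {a..b}"
    unfolding g_def
    using has_integral_diff[OF has_integral_mult_right[OF I1, of "-\<i>"] integrable_integral[OF \<open>f integrable_on _\<close>]]
    by simp
  \<comment> \<open>w' / (w^2 + l) is the derivative of arctan (w / sqrt l) / sqrt l, so its
    integral is at most pi / sqrt l whatever the size of w. Two error terms are bounded by it,
    whence 2 * pi * K0.\<close>
  define B where "B x = K1 / (2 * sqrt l) + 2 * K0 * (w' x / ((w x)\<^sup>2 + l))" for x
  have dB: "((\<lambda>x. K1 / (2 * sqrt l) * x + 2 * K0 * (arctan (w x / sqrt l) / sqrt l)) has_real_derivative B x)
      (at x within {a..b})" if x: "x \<in> {a..b}" for x
  proof -
    have "(w x)\<^sup>2 / l + 1 = ((w x)\<^sup>2 + l) / l" using l by (simp add: field_simps)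
    then have "1 / (1 + (w x / sqrt l)\<^sup>2) * (w' x / sqrt l) / sqrt l = w' x / ((w x)\<^sup>2 + l)"
    proof -
      have "1 / (1 + (w x / sqrt l)\<^sup>2) = l / ((w x)\<^sup>2 + l)"
        using \<open>(w x)\<^sup>2 / l + 1 = _\<close> l by (simp add: power_divide add.commute)
      moreover have "w' x / sqrt l / sqrt l = w' x / l" using l by simp
      ultimately have "1 / (1 + (w x / sqrt l)\<^sup>2) * (w' x / sqrt l) / sqrt l = l / ((w x)\<^sup>2 + l) * (w' x / l)"
        by (metis times_divide_eq_right)
      then show ?thesis using l by simp
    qed
    moreover have "((\<lambda>x. K1 / (2 * sqrt l) * x + 2 * K0 * (arctan (w x / sqrt l) / sqrt l)) has_real_derivative
        (K1 / (2 * sqrt l) + 2 * K0 * (inverse (1 + (w x / sqrt l)\<^sup>2) * (w' x / sqrt l) / sqrt l))) (at x within {a..b})"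
      by (intro DERIV_add DERIV_cmult_Id DERIV_cmult DERIV_cdivide DERIV_chain2[OF DERIV_arctan] w[OF x])
    ultimately show ?thesis unfolding B_def inverse_eq_divide by (simp only:)
  qed
  let ?b = "K1 / (2 * sqrt l) * (b - a) + 2 * K0 * ((arctan (w b / sqrt l) - arctan (w a / sqrt l)) / sqrt l)"
  have I3: "(B has_integral ?b) {a..b}"
    using fundamental_theorem_of_calculus[OF ab, of "\<lambda>x. K1 / (2 * sqrt l) * x + 2 * K0 * (arctan (w x / sqrt l) / sqrt l)" B] dB
    by (simp add: has_real_derivative_iff_has_vector_derivative algebra_simps diff_divide_distrib)
  have le: "cmod (g x) \<le> B x" if x: "x \<in> {a..b}" for x
  proof -
    have g: "g x = - \<i> * iexp (phi x) * (psi' x * of_real (w x / ((w x)\<^sup>2 + l)) + psi x * of_real (amp' x)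
        - \<i> * psi x * of_real (l / ((w x)\<^sup>2 + l)))"
      unfolding g_def Phi'_def f_def by (simp add: algebra_simps)
    have K1': "K1 \<ge> 0" and K0': "K0 \<ge> 0" using K1[OF x] K0[OF x] norm_ge_zero order_trans by blast+
    have wp: "w' x > 0" using w'[OF x] l by linarith
    have amgm: "2 * sqrt l * \<bar>w x\<bar> \<le> (w x)\<^sup>2 + l"
      using zero_le_power2[of "sqrt l - \<bar>w x\<bar>"] l by (simp add: power2_diff algebra_simps)
    have a1: "\<bar>w x / ((w x)\<^sup>2 + l)\<bar> \<le> 1 / (2 * sqrt l)"
      using amgm pos[of x] l by (simp add: field_simps)
    have "\<bar>l - (w x)\<^sup>2\<bar> \<le> (w x)\<^sup>2 + l" using l by (simp add: abs_le_iff)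
    then have a2: "\<bar>amp' x\<bar> \<le> w' x / ((w x)\<^sup>2 + l)"
      unfolding amp'_def using pos[of x] wp
      by (simp add: abs_mult divide_simps power2_eq_square mult_left_mono)
    have a3: "\<bar>l / ((w x)\<^sup>2 + l)\<bar> \<le> w' x / ((w x)\<^sup>2 + l)"
      using l w'[OF x] pos[of x] by (simp add: divide_right_mono)
    have "cmod (g x) \<le> cmod (psi' x) * \<bar>w x / ((w x)\<^sup>2 + l)\<bar> + cmod (psi x) * \<bar>amp' x\<bar> + cmod (psi x) * \<bar>l / ((w x)\<^sup>2 + l)\<bar>"
      unfolding g norm_mult norm_minus_cancel norm_exp_i_times norm_ii mult_1
      by (rule order_trans[OF norm_triangle_ineq4], rule add_mono[OF order_trans[OF norm_triangle_ineq]])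
        (simp_all only: norm_mult norm_of_real norm_ii mult_1 order_refl)
    also have "\<dots> \<le> K1 * (1 / (2 * sqrt l)) + K0 * (w' x / ((w x)\<^sup>2 + l)) + K0 * (w' x / ((w x)\<^sup>2 + l))"
      by (intro add_mono mult_mono K1[OF x] K0[OF x] a1 a2 a3 K1' K0') auto
    also have "\<dots> = B x" unfolding B_def by simp
    finally show ?thesis .
  qed
  have "cmod (integral {a..b} f) \<le> ?b"
    using integral_norm_bound_integral[of g "{a..b}" B] I2 I3 le
    by (auto simp: has_integral_iff)
  also have "\<dots> \<le> K1 / (2 * sqrt l) * (b - a) + 2 * K0 * (pi / sqrt l)"
  proof -
    have "arctan (w b / sqrt l) - arctan (w a / sqrt l) \<le> pi"
      using arctan_bounded[of "w b / sqrt l"] arctan_bounded[of "w a / sqrt l"] by linarith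
    moreover have "K0 \<ge> 0" using K0[of a] ab norm_ge_zero order_trans by (metis atLeastAtMost_iff order_refl)
    ultimately show ?thesis using l by (intro add_left_mono mult_left_mono divide_right_mono) auto
  qed
  also have "\<dots> = (K1 * (b - a) / 2 + 2 * pi * K0) / sqrt l"
    by (simp add: add_divide_distrib mult.commute)
  finally show ?thesis unfolding f_def .
qed

section \<open>Sine coefficients and Chebyshev expansions\<close>

text \<open>With U_n the Chebyshev polynomials of the second kind, U_n(cos x) sin x = sin ((n + 1)
  x). So these are the coefficients of G in the polynomials U_n(1 - r), and \<open>Suc n\<close>
  makes the index equal to the degree.\<close>

definition sin_coef :: "(real \<Rightarrow> complex) \<Rightarrow> nat \<Rightarrow> complex" where
  "sin_coef G n = 2 / of_real pi *
     integral {0..pi} (\<lambda>x. G (1 - cos x) * of_real (sin x) * of_real (sin (real (Suc n) * x)))"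

abbreviation poly_fun :: "complex poly \<Rightarrow> real \<Rightarrow> complex" where
  "poly_fun p \<equiv> (\<lambda>r. poly p (complex_of_real r))"

lemma continuous_on_poly_fun [continuous_intros]: "continuous_on S (poly_fun p)"
  by (intro continuous_intros)

lemma continuous_on_cos_comp:
  fixes G :: "real \<Rightarrow> complex"
  assumes "continuous_on {0..2} G"
  shows "continuous_on {0..pi} (\<lambda>x. G (1 - cos x))"
  by (rule continuous_on_compose2[OF assms]) (auto intro!: continuous_intros)

lemma integral_sin_sin:
  "integral {0..pi} (\<lambda>x. sin (real (Suc m) * x) * sin (real (Suc n) * x)) = (if m = n then pi / 2 else 0)"
proof (cases "m = n")
  case True
  have d: "((\<lambda>x. x / 2 - sin (2 * real (Suc n) * x) / (4 * real (Suc n))) has_vector_derivative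
      sin (real (Suc m) * x) * sin (real (Suc n) * x)) (at x within {0..pi})" for x
  proof -
    have "cos (2 * real (Suc n) * x) = 1 - 2 * (sin (real (Suc n) * x))\<^sup>2"
      using cos_double_sin[of "real (Suc n) * x"] by (simp only: mult.assoc)
    then have "1 / 2 - cos (2 * real (Suc n) * x) * (2 * real (Suc n)) / (4 * real (Suc n)) = sin (real (Suc m) * x) * sin (real (Suc n) * x)"
      using True by (simp add: field_simps power2_eq_square del: of_nat_Suc)
    then show ?thesis
      unfolding has_real_derivative_iff_has_vector_derivative[symmetric]
      by (auto intro!: derivative_eq_intros simp del: of_nat_Suc simp: mult_ac)
  qed
  have "sin (2 * real (Suc n) * pi) = 0"
    using sin_npi[of "2 * Suc n"] by (simp del: sin_npi of_nat_Suc)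
  then show ?thesis
    using integral_unique[OF fundamental_theorem_of_calculus[OF _ d]] True by (simp del: of_nat_Suc)
next
  case False
  define A B where "A = real m - real n" and "B = real m + real n + 2"
  have AB: "A \<noteq> 0" "B \<noteq> 0" using False by (auto simp: A_def B_def)
  have d: "((\<lambda>x. sin (A * x) / (2 * A) - sin (B * x) / (2 * B)) has_vector_derivative
      sin (real (Suc m) * x) * sin (real (Suc n) * x)) (at x within {0..pi})" for x
  proof -
    have "sin (real (Suc m) * x) * sin (real (Suc n) * x) = cos (A * x) / 2 - cos (B * x) / 2"
      unfolding sin_times_sin A_def B_def by (simp add: algebra_simps diff_divide_distrib)
    then show ?thesis using AB
      unfolding has_real_derivative_iff_has_vector_derivative[symmetric]
      by (auto intro!: derivative_eq_intros)
  qed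
  have "sin (A * pi) = 0" "sin (B * pi) = 0"
    using sin_npi_int[of "int m - int n"] sin_npi_int[of "int m + int n + 2"]
    by (simp_all add: A_def B_def mult.commute)
  then show ?thesis
    using integral_unique[OF fundamental_theorem_of_calculus[OF _ d]] False by simp
qed

lemma sin_coef_integrable:
  fixes G :: "real \<Rightarrow> complex"
  assumes "continuous_on {0..2} G"
  shows "(\<lambda>x. G (1 - cos x) * of_real (sin x) * of_real (sin (real (Suc n) * x))) integrable_on {0..pi}"
  by (intro integrable_continuous_interval continuous_intros continuous_on_cos_comp assms)

lemma sin_coef_bound:
  assumes "continuous_on {0..2} G" and M: "\<And>x. x \<in> {0..2} \<Longrightarrow> cmod (G x) \<le> M"
  shows "cmod (sin_coef G n) \<le> 2 * M"
proof -
  have "cmod (integral {0..pi} (\<lambda>x. G (1 - cos x) * of_real (sin x) * of_real (sin (real (Suc n) * x)))) \<le> M * (pi - 0)"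
  proof (rule integral_bound)
    fix x assume "x \<in> {0..pi}"
    have "cmod (G (1 - cos x)) * \<bar>sin x\<bar> * \<bar>sin (real (Suc n) * x)\<bar> \<le> M * 1 * 1"
      by (intro mult_mono M mult_nonneg_nonneg) (use M[of 0] norm_ge_zero[of "G 0"] in \<open>auto simp del: norm_ge_zero\<close>)
    then show "cmod (G (1 - cos x) * of_real (sin x) * of_real (sin (real (Suc n) * x))) \<le> M"
      by (simp add: norm_mult del: of_nat_Suc)
  qed (auto intro!: continuous_intros continuous_on_cos_comp assms)
  then show ?thesis unfolding sin_coef_def
    by (simp add: norm_mult norm_divide field_simps del: of_nat_Suc)
qed

lemma sin_coef_diff:
  assumes "continuous_on {0..2} G" "continuous_on {0..2} H"
  shows "sin_coef (\<lambda>x. G x - H x) n = sin_coef G n - sin_coef H n"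
  unfolding sin_coef_def left_diff_distrib
  by (subst integral_diff[OF sin_coef_integrable sin_coef_integrable]) (auto intro!: assms simp: right_diff_distrib simp del: of_nat_Suc)

lemma sin_coef_tendsto:
  assumes G: "continuous_on {0..2} G" and P: "\<And>k. continuous_on {0..2} (P k)"
    and u: "uniform_limit {0..2} P G sequentially"
  shows "(\<lambda>k. sin_coef (P k) n) \<longlonglongrightarrow> sin_coef G n"
proof (rule LIMSEQ_I)
  fix r :: real assume "r > 0"
  then have "\<forall>\<^sub>F k in sequentially. \<forall>x\<in>{0..2}. dist (P k x) (G x) < r / 4"
    using uniform_limitD[OF u, of "r/4"] by auto
  then obtain k0 where k0: "\<And>k x. k \<ge> k0 \<Longrightarrow> x \<in> {0..2} \<Longrightarrow> cmod (P k x - G x) \<le> r / 4"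
    unfolding eventually_sequentially dist_norm by (meson less_imp_le)
  have "cmod (sin_coef (P k) n - sin_coef G n) < r" if "k \<ge> k0" for k
  proof -
    have "cmod (sin_coef (\<lambda>x. P k x - G x) n) \<le> 2 * (r / 4)"
      by (rule sin_coef_bound) (use k0[OF that] in \<open>auto intro!: continuous_intros G P\<close>)
    then show ?thesis using \<open>r > 0\<close> by (simp add: sin_coef_diff[OF P G])
  qed
  then show "\<exists>no. \<forall>k\<ge>no. cmod (sin_coef (P k) n - sin_coef G n) < r" by blast
qed

lemma sin_coef_const: "sin_coef (\<lambda>_. a) n = (if n = 0 then a else 0)"
proof -
  have "integral {0..pi} (\<lambda>x. a * of_real (sin x) * of_real (sin (real (Suc n) * x)))
      = integral {0..pi} (\<lambda>x. a * of_real (sin (real (Suc 0) * x) * sin (real (Suc n) * x)))"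
    by (simp add: mult.assoc)
  also have "\<dots> = a * of_real (integral {0..pi} (\<lambda>x. sin (real (Suc 0) * x) * sin (real (Suc n) * x)))"
    unfolding integral_mult_right
    by (rule arg_cong[where f = "\<lambda>u. a * u"], rule integral_unique, rule has_integral_of_real,
        rule integrable_integral) (intro integrable_continuous_interval continuous_intros)
  finally show ?thesis unfolding sin_coef_def integral_sin_sin by simp
qed

lemma sin_Suc_Suc:
  "complex_of_real (sin (real (Suc (Suc n)) * x)) + of_real (sin (real n * x))
    = 2 * (of_real (sin (real (Suc n) * x)) * of_real (cos x))"
proof -
  have "sin (real (Suc (Suc n)) * x) + sin (real n * x) = 2 * (sin (real (Suc n) * x) * cos x)"
    unfolding sin_plus_sin by (simp add: algebra_simps add_divide_distrib)
  then show ?thesis by (metis of_real_add of_real_mult of_real_numeral)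
qed

text \<open>This is 2 cos x sin ((n+1) x) = sin ((n+2) x) + sin (n x), the three-term recurrence of
  the U_n. The operators \<open>cheb n\<close> satisfy the same one in \<open>cheb_lap\<close>. For
  n = 0 the lower neighbour is sin 0 = 0.\<close>

lemma sin_coef_times_id:
  assumes G: "continuous_on {0..2} G"
  shows "sin_coef (\<lambda>x. of_real x * G x) n =
    sin_coef G n - (sin_coef G (Suc n) + (if n = 0 then 0 else sin_coef G (n - 1))) / 2"
proof -
  let ?I = "\<lambda>m. integral {0..pi} (\<lambda>x. G (1 - cos x) * of_real (sin x) * of_real (sin (real m * x)))"
  have int: "(\<lambda>x. G (1 - cos x) * of_real (sin x) * of_real (sin (real m * x))) integrable_on {0..pi}" for m
    by (intro integrable_continuous_interval continuous_intros continuous_on_cos_comp assms)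
  have e: "of_real (1 - cos x) * G (1 - cos x) * of_real (sin x) * of_real (sin (real (Suc n) * x))
     = G (1 - cos x) * of_real (sin x) * of_real (sin (real (Suc n) * x))
       - (G (1 - cos x) * of_real (sin x) * of_real (sin (real (Suc (Suc n)) * x)) 
       + G (1 - cos x) * of_real (sin x) * of_real (sin (real n * x))) / 2" for x
  proof -
    have "of_real (sin (real (Suc n) * x)) * complex_of_real (cos x) = (of_real (sin (real (Suc (Suc n)) * x)) + of_real (sin (real n * x))) / 2"
      unfolding sin_Suc_Suc
      by simp
    note * = this
    have "of_real (1 - cos x) * G (1 - cos x) * of_real (sin x) * of_real (sin (real (Suc n) * x))
      = G (1 - cos x) * of_real (sin x) * of_real (sin (real (Suc n) * x))
       - G (1 - cos x) * of_real (sin x) * (of_real (sin (real (Suc n) * x)) * of_real (cos x))"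
      by (simp only: of_real_diff of_real_1) algebra
    then show ?thesis unfolding * by (simp add: distrib_left mult.assoc)
  qed
  have "integral {0..pi} (\<lambda>x. of_real (1 - cos x) * G (1 - cos x) * of_real (sin x) * of_real (sin (real (Suc n) * x)))
     = ?I (Suc n) - (?I (Suc (Suc n)) + ?I n) / 2"
    unfolding e
    by (subst integral_diff[OF int integrable_on_divide[OF integrable_add[OF int int]]], subst integral_divide,
        subst integral_add[OF int int]) simp
  moreover have "n = 0 \<Longrightarrow> ?I n = 0" by simp
  moreover have "n \<noteq> 0 \<Longrightarrow> Suc (n - 1) = n" by simp
  ultimately show ?thesis unfolding sin_coef_def
    by (cases "n = 0") (simp_all add: right_diff_distrib distrib_left diff_divide_distrib add_divide_distrib del: of_nat_Suc)
qed

lemma sin_coef_poly_pCons: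
  "sin_coef (poly_fun (pCons a p)) n = (if n = 0 then a else 0) + sin_coef (poly_fun p) n
     - (sin_coef (poly_fun p) (Suc n) + (if n = 0 then 0 else sin_coef (poly_fun p) (n - 1))) / 2"
proof -
  have "sin_coef (poly_fun (pCons a p)) n = sin_coef (\<lambda>x. of_real x * poly_fun p x - (- a)) n"
    by (simp add: add.commute)
  then show ?thesis
    using sin_coef_diff[of "\<lambda>x. of_real x * poly_fun p x" "\<lambda>_. - a" n]
    by (simp add: sin_coef_const sin_coef_times_id continuous_intros)
qed

lemma sin_coef_poly_eq_0: "n > degree p \<Longrightarrow> sin_coef (poly_fun p) n = 0"
proof (induction p arbitrary: n)
  case 0
  then show ?case using sin_coef_const[of 0] by simp
next
  case (pCons a p)
  show ?case
  proof (cases "p = 0")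
    case True
    then show ?thesis using pCons.prems sin_coef_const[of a n] by simp
  next
    case False
    then have "sin_coef (poly_fun p) n = 0" "sin_coef (poly_fun p) (Suc n) = 0" "sin_coef (poly_fun p) (n - 1) = 0"
      using pCons.prems by (auto intro!: pCons.IH)
    then show ?thesis using pCons.prems unfolding sin_coef_poly_pCons by simp
  qed
qed

text \<open>Summation by parts moves the recurrence from the coefficients to an arbitrary sequence
  \<open>s\<close>. It is used twice: with the sines in \<open>sin_poly_expansion\<close> and with
  \<open>cheb n f x\<close> in \<open>poly_op_cheb\<close>.\<close>

lemma sum_sin_coef_pCons:
  assumes N: "degree (pCons a p) \<le> N"
  shows "(\<Sum>n\<le>N. sin_coef (poly_fun (pCons a p)) n * s n) = a * s 0 +
    (\<Sum>n\<le>N. sin_coef (poly_fun p) n * (s n - (s (Suc n) + (if n = 0 then 0 else s (n - 1))) / 2))"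
proof -
  define c where "c = sin_coef (poly_fun p)"
  have "degree p \<le> N" using N by (cases "p = 0") auto
  \<comment> \<open>\<open>z\<close> and \<open>zN\<close> remove the boundary terms at the upper
    end of the sum.\<close>
  then have z: "c (Suc N) = 0" by (auto simp: c_def intro!: sin_coef_poly_eq_0)
  have zN: "c N = 0"
  proof (cases "p = 0")
    case True then show ?thesis using sin_coef_const[of 0] by (simp add: c_def)
  next
    case False then show ?thesis using N by (auto simp: c_def intro!: sin_coef_poly_eq_0)
  qed
  have "(\<Sum>n\<le>N. c (Suc n) * s n) = (\<Sum>n\<le>Suc N. if n = 0 then 0 else c n * s (n - 1))"
    unfolding sum.atMost_Suc_shift by simp
  then have 1: "(\<Sum>n\<le>N. c (Suc n) * s n) = (\<Sum>n\<le>N. c n * (if n = 0 then 0 else s (n - 1)))"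
    using z by (simp add: if_distrib cong: if_cong)
  have 2: "(\<Sum>n\<le>N. (if n = 0 then 0 else c (n - 1)) * s n) = (\<Sum>n\<le>N. c n * s (Suc n))"
  proof (cases N)
    case 0
    then show ?thesis using zN by simp
  next
    case (Suc k)
    have "(\<Sum>n\<le>Suc k. (if n = 0 then 0 else c (n - 1)) * s n) = (\<Sum>n\<le>k. c n * s (Suc n))"
      unfolding sum.atMost_Suc_shift by simp
    then show ?thesis using zN Suc by simp
  qed
  have tele: "(\<Sum>n\<le>N. (c (Suc n) + (if n = 0 then 0 else c (n - 1))) * s n)
     = (\<Sum>n\<le>N. c n * (s (Suc n) + (if n = 0 then 0 else s (n - 1))))"
    unfolding distrib_right distrib_left sum.distrib 1 2 by simp
  have "(\<Sum>n\<le>N. (if n = 0 then a else 0) * s n) = a * s 0"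
    by (simp add: if_distrib[of "\<lambda>u. u * _"] cong: if_cong)
  moreover have "(\<Sum>n\<le>N. (c (Suc n) + (if n = 0 then 0 else c (n - 1))) / 2 * s n)
      = (\<Sum>n\<le>N. c n * ((s (Suc n) + (if n = 0 then 0 else s (n - 1))) / 2))"
    using tele unfolding times_divide_eq_left times_divide_eq_right sum_divide_distrib[symmetric] by simp
  ultimately show ?thesis
    unfolding sin_coef_poly_pCons c_def[symmetric]
    by (simp add: distrib_right left_diff_distrib right_diff_distrib sum.distrib sum_subtractf
        del: times_divide_eq_left times_divide_eq_right)
qed

lemma sin_poly_expansion:
  "degree p \<le> N \<Longrightarrow> poly_fun p (1 - cos x) * of_real (sin x)
     = (\<Sum>n\<le>N. sin_coef (poly_fun p) n * of_real (sin (real (Suc n) * x)))"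
proof (induction p arbitrary: N)
  case 0
  then show ?case using sin_coef_const[of 0] by simp
next
  case (pCons a p)
  define s where "s n = complex_of_real (sin (real (Suc n) * x))" for n
  have dN: "degree p \<le> N" using pCons.prems by (cases "p = 0") auto
  have s: "s n - (s (Suc n) + (if n = 0 then 0 else s (n - 1))) / 2 = (1 - of_real (cos x)) * s n" for n
  proof -
    have "s (Suc n) + (if n = 0 then 0 else s (n - 1)) = 2 * (s n * of_real (cos x))"
      using sin_Suc_Suc[of n x] by (cases n) (simp_all add: s_def del: of_nat_Suc)
    then show ?thesis by (simp add: algebra_simps)
  qed
  have "(\<Sum>n\<le>N. sin_coef (poly_fun (pCons a p)) n * s n)
      = a * of_real (sin x) + (1 - of_real (cos x)) * (\<Sum>n\<le>N. sin_coef (poly_fun p) n * s n)"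
    unfolding sum_sin_coef_pCons[OF pCons.prems] s sum_distrib_left
    by (simp add: s_def mult.left_commute)
  also have "\<dots> = poly_fun (pCons a p) (1 - cos x) * of_real (sin x)"
    unfolding s_def pCons.IH[OF dN, symmetric] by (simp add: algebra_simps)
  finally show ?case by (simp add: s_def)
qed

text \<open>Expanding the square with the orthogonality of the sines, the claim reduces to |c n - a
  n|^2 >= 0 for each n: orthogonal projection minimises the distance. Any good sine approximation
  thus bounds the sum of |c n|^2 from below.\<close>

lemma sin_coef_best_approx:
  assumes G: "continuous_on {0..2} G"
  shows "integral {0..pi} (\<lambda>x. (cmod (G (1 - cos x) * of_real (sin x)))\<^sup>2) - pi / 2 * (\<Sum>n\<le>N. (cmod (sin_coef G n))\<^sup>2)
    \<le> integral {0..pi} (\<lambda>x. (cmod (G (1 - cos x) * of_real (sin x) - (\<Sum>n\<le>N. a n * of_real (sin (real (Suc n) * x)))))\<^sup>2)"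
proof -
  define g where "g x = G (1 - cos x) * of_real (sin x)" for x
  define S where "S x = (\<Sum>n\<le>N. a n * complex_of_real (sin (real (Suc n) * x)))" for x
  define c where "c = sin_coef G"
  have cg: "continuous_on {0..pi} g" unfolding g_def
    by (intro continuous_intros continuous_on_cos_comp assms)
  have cS: "continuous_on {0..pi} S" unfolding S_def
    by (intro continuous_intros)
  have e: "(cmod (g x - S x))\<^sup>2 = (cmod (g x))\<^sup>2 - 2 * Re (g x * cnj (S x)) + (cmod (S x))\<^sup>2" for x
    unfolding cmod_power2 by (simp add: power2_eq_square algebra_simps)
  have i1: "integral {0..pi} (\<lambda>x. (cmod (g x - S x))\<^sup>2) = integral {0..pi} (\<lambda>x. (cmod (g x))\<^sup>2)
      - 2 * integral {0..pi} (\<lambda>x. Re (g x * cnj (S x))) + integral {0..pi} (\<lambda>x. (cmod (S x))\<^sup>2)"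
    unfolding e
    by (intro integral_unique has_integral_add has_integral_diff has_integral_mult_right integrable_integral
        integrable_continuous_interval continuous_intros cg cS)
  have ig: "(\<lambda>x. g x * of_real (sin (real (Suc n) * x))) integrable_on {0..pi}" for n
    by (intro integrable_continuous_interval continuous_intros cg)
  have "integral {0..pi} (\<lambda>x. g x * cnj (S x)) = integral {0..pi} (\<lambda>x. \<Sum>n\<le>N. cnj (a n) * (g x * of_real (sin (real (Suc n) * x))))"
    unfolding S_def by (simp add: sum_distrib_left mult_ac del: of_nat_Suc)
  also have "\<dots> = (\<Sum>n\<le>N. cnj (a n) * integral {0..pi} (\<lambda>x. (g x * of_real (sin (real (Suc n) * x)))))"
    by (subst integral_sum) (auto intro!: integrable_on_mult_right ig simp del: of_nat_Suc)
  also have "\<dots> = (\<Sum>n\<le>N. cnj (a n) * (of_real pi / 2 * c n))"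
    unfolding c_def sin_coef_def g_def by (simp del: of_nat_Suc)
  finally have i2: "integral {0..pi} (\<lambda>x. Re (g x * cnj (S x))) = (\<Sum>n\<le>N. Re (cnj (a n) * c n)) * (pi / 2)"
  proof -
    assume *: "integral {0..pi} (\<lambda>x. g x * cnj (S x)) = (\<Sum>n\<le>N. cnj (a n) * (of_real pi / 2 * c n))"
    have "integral {0..pi} (\<lambda>x. Re (g x * cnj (S x))) = Re (integral {0..pi} (\<lambda>x. g x * cnj (S x)))"
      using integral_linear[of "\<lambda>x. g x * cnj (S x)" "{0..pi}" Re]
      by (simp add: o_def bounded_linear_Re integrable_continuous_interval continuous_intros cg cS)
    also have "\<dots> = (\<Sum>n\<le>N. Re (cnj (a n) * c n)) * (pi / 2)"
      unfolding * by (simp add: sum_distrib_right sum_distrib_left algebra_simps add_divide_distrib)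
    finally show ?thesis .
  qed
  have "integral {0..pi} (\<lambda>x. (cmod (S x))\<^sup>2) = (pi / 2) * (\<Sum>n\<le>N. (cmod (a n))\<^sup>2)"
  proof -
    have "(cmod (S x))\<^sup>2 = (\<Sum>m\<le>N. \<Sum>n\<le>N. Re (a m * cnj (a n)) * (sin (real (Suc m) * x) * sin (real (Suc n) * x)))" for x
    proof -
      have "complex_of_real ((cmod (S x))\<^sup>2) = S x * cnj (S x)" by (rule complex_norm_square)
      also have "\<dots> = (\<Sum>m\<le>N. \<Sum>n\<le>N. (a m * cnj (a n)) * of_real (sin (real (Suc m) * x) * sin (real (Suc n) * x)))"
        unfolding S_def cnj_sum sum_product by (intro sum.cong refl) (simp add: mult_ac del: of_nat_Suc)
      finally have "Re (complex_of_real ((cmod (S x))\<^sup>2)) = Re (\<Sum>m\<le>N. \<Sum>n\<le>N. (a m * cnj (a n)) * of_real (sin (real (Suc m) * x) * sin (real (Suc n) * x)))"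
        by simp
      then show ?thesis by (simp only: Re_complex_of_real Re_sum) simp
    qed
    then have "integral {0..pi} (\<lambda>x. (cmod (S x))\<^sup>2) = (\<Sum>m\<le>N. \<Sum>n\<le>N. Re (a m * cnj (a n)) * integral {0..pi} (\<lambda>x. sin (real (Suc m) * x) * sin (real (Suc n) * x)))"
      by (simp only:) (intro integral_unique has_integral_sum finite_atMost has_integral_mult_right integrable_integral
        integrable_continuous_interval continuous_intros)
    also have "\<dots> = (\<Sum>m\<le>N. (cmod (a m))\<^sup>2 * (pi / 2))"
      unfolding integral_sin_sin
    proof (intro sum.cong refl)
      fix m assume "m \<in> {..N}"
      have "Re (a m * cnj (a m)) = (cmod (a m))\<^sup>2" unfolding cmod_power2 by (simp add: power2_eq_square)
      then show "(\<Sum>n\<le>N. Re (a m * cnj (a n)) * (if m = n then pi / 2 else 0)) = (cmod (a m))\<^sup>2 * (pi / 2)"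
        using \<open>m \<in> {..N}\<close> by (simp add: if_distrib[of "\<lambda>u. _ * u"] cong: if_cong)
    qed
    finally show ?thesis by (simp add: sum_distrib_left mult.commute)
  qed
  then have "integral {0..pi} (\<lambda>x. (cmod (g x - S x))\<^sup>2) = integral {0..pi} (\<lambda>x. (cmod (g x))\<^sup>2)
     - pi / 2 * (\<Sum>n\<le>N. 2 * Re (cnj (a n) * c n) - (cmod (a n))\<^sup>2)"
    unfolding i1 i2 by (simp add: sum_subtractf sum_distrib_left algebra_simps)
  moreover have "(\<Sum>n\<le>N. 2 * Re (cnj (a n) * c n) - (cmod (a n))\<^sup>2) \<le> (\<Sum>n\<le>N. (cmod (c n))\<^sup>2)"
  proof (rule sum_mono)
    fix n
    have "(cmod (c n - a n))\<^sup>2 = (cmod (c n))\<^sup>2 - (2 * Re (cnj (a n) * c n) - (cmod (a n))\<^sup>2)"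
      unfolding cmod_power2 by (simp add: power2_eq_square algebra_simps)
    then show "2 * Re (cnj (a n) * c n) - (cmod (a n))\<^sup>2 \<le> (cmod (c n))\<^sup>2"
      using zero_le_power2[of "cmod (c n - a n)"] by linarith
  qed
  ultimately have "integral {0..pi} (\<lambda>x. (cmod (g x))\<^sup>2) - pi / 2 * (\<Sum>n\<le>N. (cmod (c n))\<^sup>2) \<le> integral {0..pi} (\<lambda>x. (cmod (g x - S x))\<^sup>2)"
    using mult_left_mono[of _ "\<Sum>n\<le>N. (cmod (c n))\<^sup>2" "pi/2"] by fastforce
  then show ?thesis unfolding g_def S_def c_def .
qed

lemma poly_fun_approx:
  fixes G :: "real \<Rightarrow> complex"
  assumes G: "continuous_on {a..b} G" and e: "e > 0"
  obtains p where "\<And>x. x \<in> {a..b} \<Longrightarrow> cmod (G x - poly_fun p x) < e"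
proof -
  obtain g where g: "polynomial_function g" "\<And>x. x \<in> {a..b} \<Longrightarrow> norm (G x - g x) < e"
    using Stone_Weierstrass_polynomial_function[OF _ G e] by auto
  have re: "real_polynomial_function (\<lambda>x. Re (g x))" "real_polynomial_function (\<lambda>x. Im (g x))"
    using g(1) unfolding polynomial_function_def
    by (auto simp: o_def intro!: bounded_linear_Re bounded_linear_Im)
  have ex: "\<exists>p. \<forall>x. poly_fun p x = of_real (r x)" if r: "real_polynomial_function r" for r :: "real \<Rightarrow> real"
  proof -
    obtain a n where r: "r = (\<lambda>x. \<Sum>i\<le>n. a i * x^i)"
      using r unfolding real_polynomial_function_iff_sum by blast
    have "poly_fun (\<Sum>i\<le>n. monom (of_real (a i)) i) x = of_real (r x)" for x
      unfolding r by (simp add: poly_sum poly_monom)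
    then show ?thesis by blast
  qed
  obtain p1 p2 where p: "\<forall>x. poly_fun p1 x = of_real (Re (g x))" "\<forall>x. poly_fun p2 x = of_real (Im (g x))"
    using ex re by metis
  have "poly_fun (p1 + smult \<i> p2) x = g x" for x
    using p complex_eq[of "g x"] by simp
  then show thesis using g(2) that by metis
qed

text \<open>The harder half of Parseval. If p approximates G uniformly, then p (1 - cos x) sin x is
  a finite sine sum close to G (1 - cos x) sin x, and \<open>sin_coef_best_approx\<close>
  applies.\<close>

lemma sin_coef_Parseval_ge:
  assumes G: "continuous_on {0..2} G" and e: "e > 0"
  obtains N where "(\<Sum>n\<le>N. (cmod (sin_coef G n))\<^sup>2)
     \<ge> 2 / pi * integral {0..pi} (\<lambda>x. (cmod (G (1 - cos x) * of_real (sin x)))\<^sup>2) - e"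
proof -
  \<comment> \<open>The squared error is at most d^2 pi = (e / 2) pi, which becomes \<open>e\<close>
    after multiplication by 2 / pi.\<close>
  define d where "d = sqrt (e / 2)"
  have d: "d > 0" using e by (simp add: d_def)
  obtain p where p: "\<And>x. x \<in> {0..2} \<Longrightarrow> cmod (G x - poly_fun p x) < d"
    using poly_fun_approx[OF G d] by blast
  define N where "N = degree p"
  let ?D = "integral {0..pi} (\<lambda>x. (cmod (G (1 - cos x) * of_real (sin x) - poly_fun p (1 - cos x) * of_real (sin x)))\<^sup>2)"
  have "?D \<le> d\<^sup>2 * (pi - 0)"
  proof -
    have "norm ?D \<le> d\<^sup>2 * (pi - 0)"
    proof (rule integral_bound)
      show "continuous_on {0..pi} (\<lambda>x. (cmod (G (1 - cos x) * of_real (sin x) - poly_fun p (1 - cos x) * of_real (sin x)))\<^sup>2)"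
        by (intro continuous_intros continuous_on_cos_comp G)
      fix x assume "x \<in> {0..pi}"
      have "cmod (G (1 - cos x) - poly_fun p (1 - cos x)) * \<bar>sin x\<bar> \<le> d * 1"
        by (intro mult_mono less_imp_le[OF p]) (auto simp: d less_imp_le)
      then have "(cmod ((G (1 - cos x) - poly_fun p (1 - cos x)) * of_real (sin x)))\<^sup>2 \<le> d\<^sup>2"
        by (intro power_mono) (simp_all add: norm_mult)
      then show "norm ((cmod (G (1 - cos x) * of_real (sin x) - poly_fun p (1 - cos x) * of_real (sin x)))\<^sup>2) \<le> d\<^sup>2"
        by (simp add: left_diff_distrib)
    qed auto
    then show ?thesis by simp
  qed
  then have "integral {0..pi} (\<lambda>x. (cmod (G (1 - cos x) * of_real (sin x)))\<^sup>2) - pi / 2 * (\<Sum>n\<le>N. (cmod (sin_coef G n))\<^sup>2) \<le> e / 2 * pi"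
    using sin_coef_best_approx[OF G, of N "sin_coef (poly_fun p)"] e
    unfolding sin_poly_expansion[of p N, unfolded N_def, OF order_refl] N_def d_def
    by (simp add: sin_poly_expansion[symmetric])
  then have "2 / pi * integral {0..pi} (\<lambda>x. (cmod (G (1 - cos x) * of_real (sin x)))\<^sup>2) - (\<Sum>n\<le>N. (cmod (sin_coef G n))\<^sup>2) \<le> e"
    by (simp add: field_simps)
  then show thesis using that[of N] by linarith
qed


section \<open>Sine coefficients of the oscillating symbol\<close>

lemma Cc_infinity_C1:
  assumes "chi \<in> Cc_infinity"
  obtains chi' where "\<And>x. (chi has_vector_derivative chi' x) (at x)" "continuous_on UNIV chi'"
proof -
  have d: "iter_deriv n chi differentiable (at x)" for n x
    using assms by (simp add: Cc_infinity_def smooth_def)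
  have "(chi has_vector_derivative iter_deriv 1 chi x) (at x)" for x
    using vector_derivative_works[THEN iffD1, OF d[of 0 x]] by (simp add: iter_deriv_def)
  moreover have "continuous_on UNIV (iter_deriv 1 chi)"
    by (intro continuous_at_imp_continuous_on ballI differentiable_imp_continuous_within d)
  ultimately show thesis using that by blast
qed

lemma zero_outside_supp: "x \<notin> supp f \<Longrightarrow> f x = 0"
  using closure_subset[of "{x. f x \<noteq> 0}"] by (auto simp: supp_def)

text \<open>Writing sin ((n+1) x) by exponentials produces the phases t (1 - cos x) + (n+1) x and t
  (1 - cos x) - (n+1) x. The linear term does not affect the second derivative t cos x, which is at
  least t / 2 on the support of the cutoff; hence the bound is uniform in n.\<close>

lemma oscillatory_sin_coef_bound:
  assumes chi: "chi \<in> Cc_infinity" and sup: "supp chi \<subseteq> {-1/2<..<1/2}"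
  obtains C where "C > 0" "\<And>t n. t > 0 \<Longrightarrow>
     cmod (sin_coef (\<lambda>x. of_real x * (iexp (t * x) * chi x)) n) \<le> C / sqrt t"
proof -
  obtain chi' where chi': "\<And>x. (chi has_vector_derivative chi' x) (at x)" "continuous_on UNIV chi'"
    by (rule Cc_infinity_C1[OF chi]) (rule that)
  have contchi: "continuous_on UNIV chi"
    by (meson chi'(1) continuous_at_imp_continuous_on has_vector_derivative_continuous)
  define psi where "psi x = of_real (1 - cos x) * chi (1 - cos x) * complex_of_real (sin x)" for x
  define psi' where "psi' x = (of_real (sin x) * chi (1 - cos x) + of_real (1 - cos x) * (of_real (sin x) * chi' (1 - cos x))) * complex_of_real (sin x)
      + of_real (1 - cos x) * chi (1 - cos x) * of_real (cos x)" for x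
  have dpsi: "(psi has_vector_derivative psi' x) (at x within S)" for x S
  proof -
    have c: "((\<lambda>x. 1 - cos x) has_real_derivative sin x) (at x within S)"
      by (auto intro!: derivative_eq_intros)
    then have c1: "((\<lambda>x. 1 - cos x) has_vector_derivative sin x) (at x within S)"
      by (simp add: has_real_derivative_iff_has_vector_derivative)
    have 1: "((\<lambda>x. complex_of_real (1 - cos x)) has_vector_derivative of_real (sin x)) (at x within S)"
      by (rule has_vector_derivative_of_real[OF c])
    have 2: "((\<lambda>x. chi (1 - cos x)) has_vector_derivative sin x *\<^sub>R chi' (1 - cos x)) (at x within S)"
      using vector_diff_chain_within[OF c1, of chi "chi' (1 - cos x)"] chi'(1)
      by (simp add: o_def has_vector_derivative_at_within)
    have 3: "((\<lambda>x. complex_of_real (sin x)) has_vector_derivative of_real (cos x)) (at x within S)"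
      by (rule has_vector_derivative_of_real)
        (auto intro!: derivative_eq_intros simp: has_real_derivative_iff_has_vector_derivative[symmetric])
    have "(psi has_vector_derivative (of_real (1 - cos x) * chi (1 - cos x)) * of_real (cos x)
       + (of_real (1 - cos x) * (sin x *\<^sub>R chi' (1 - cos x)) + of_real (sin x) * chi (1 - cos x)) * complex_of_real (sin x)) (at x within S)"
      unfolding psi_def by (intro has_vector_derivative_mult 1 2 3)
    then show ?thesis unfolding psi'_def by (simp add: scaleR_conv_of_real algebra_simps)
  qed
  have cpsi: "continuous_on S psi" for S
    unfolding psi_def by (intro continuous_intros continuous_on_compose2[OF contchi]) auto
  have cpsi': "continuous_on S psi'" for S
    unfolding psi'_def
    by (intro continuous_intros continuous_on_compose2[OF contchi] continuous_on_compose2[OF chi'(2)]) auto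
  obtain K0 where K0: "\<And>x. x \<in> {0..pi/3} \<Longrightarrow> cmod (psi x) \<le> K0"
    using compact_imp_bounded[OF compact_continuous_image[OF cpsi[of "{0..pi/3}"]]]
    unfolding bounded_iff by (metis compact_Icc image_eqI)
  obtain K1 where K1: "\<And>x. x \<in> {0..pi/3} \<Longrightarrow> cmod (psi' x) \<le> K1"
    using compact_imp_bounded[OF compact_continuous_image[OF cpsi'[of "{0..pi/3}"]]]
    unfolding bounded_iff by (metis compact_Icc image_eqI)
  have psi0: "psi x = 0" if "x \<in> {pi/3..pi}" for x
  proof -
    have "cos x \<le> cos (pi/3)" using that by (intro cos_monotone_0_pi_le) auto
    then have "1 - cos x \<ge> 1/2" by (simp add: cos_60)
    then have "chi (1 - cos x) = 0" using sup by (intro zero_outside_supp) auto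
    then show ?thesis by (simp add: psi_def)
  qed
  define B where "B = (K1 * (pi/3 - 0) / 2 + 2 * pi * K0)"
  have Bnn: "B \<ge> 0"
    using order_trans[OF norm_ge_zero K0[of 0]] order_trans[OF norm_ge_zero K1[of 0]] by (simp add: B_def)
  \<comment> \<open>The amplitude vanishes at 0 because of 1 - cos x and at pi/3 because of the
    cutoff, as the integration by parts requires.\<close>
  have osc: "cmod (integral {0..pi/3} (\<lambda>x. iexp (t * (1 - cos x) + m * x) * psi x)) \<le> B / sqrt (t / 2)"
    if t: "t > 0" for t m
    unfolding B_def
  proof (rule van_der_corput_second[where w = "\<lambda>x. t * sin x + m" and w' = "\<lambda>x. t * cos x" and psi' = psi'])
    fix x assume x: "x \<in> {0..pi/3}"
    have "cos x \<ge> cos (pi/3)" using x by (intro cos_monotone_0_pi_le) auto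
    then have "cos x \<ge> 1/2" by (simp add: cos_60)
    then show "t / 2 \<le> t * cos x" using t mult_left_mono[of "1/2" "cos x" t] by simp
  next
    show "psi (pi/3) = 0" by (rule psi0) auto
  qed (use t dpsi K0 K1 in \<open>auto intro!: derivative_eq_intros simp: psi_def [of 0]\<close>)
  \<comment> \<open>Two integrals of size B / sqrt (t / 2), divided by 2 and multiplied by 2 / pi;
    \<open>B + 1\<close> ensures positivity.\<close>
  define C where "C = (B + 1) * (2 * sqrt 2 / pi)"
  show thesis
  proof (rule that[of C])
    show "C > 0" using Bnn by (simp add: C_def)
    fix t :: real and n :: nat assume t: "t > 0"
    define I where "I m = integral {0..pi/3} (\<lambda>x. iexp (t * (1 - cos x) + m * x) * psi x)" for m
    have ii: "(\<lambda>x. iexp (t * (1 - cos x) + m * x) * psi x) integrable_on {0..pi/3}" for m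
      by (intro integrable_continuous_interval continuous_intros cpsi)
    define N where "N = real (Suc n)"
    let ?f = "\<lambda>x. of_real (1 - cos x) * (iexp (t * (1 - cos x)) * chi (1 - cos x)) * of_real (sin x) * complex_of_real (sin (real (Suc n) * x))"
    have f: "?f x = (iexp (t * (1 - cos x) + N * x) * psi x - iexp (t * (1 - cos x) + (- N) * x) * psi x) / (2 * \<i>)" for x
    proof -
      have s: "complex_of_real (sin (real (Suc n) * x)) = (iexp (N * x) - exp (- (\<i> * of_real (N * x)))) / (2 * \<i>)"
        unfolding sin_of_real[symmetric] N_def[symmetric] by (simp add: sin_exp_eq)
      have e: "iexp (t * (1 - cos x) + N * x) = iexp (t * (1 - cos x)) * iexp (N * x)"
        unfolding exp_add[symmetric] by (simp add: algebra_simps)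
      have e': "iexp (t * (1 - cos x) + (- N) * x) = iexp (t * (1 - cos x)) * exp (- (\<i> * complex_of_real (N * x)))"
        unfolding exp_add[symmetric] by (simp add: algebra_simps)
      have alg: "A * (E * c) * d * ((P - Q) / D) = (E * P * (A * c * d) - E * Q * (A * c * d)) / D"
        for A E c d P Q D :: complex by (simp add: algebra_simps diff_divide_distrib)
      show ?thesis unfolding e e' s psi_def by (rule alg)
    qed
    have "integral {0..pi} ?f = integral {0..pi/3} ?f"
    proof (rule integral_spike_set)
      have "{x \<in> {0..pi} - {0..pi/3}. ?f x \<noteq> 0} = {}"
      proof -
        have "?f x = 0" if "x \<in> {0..pi} - {0..pi/3}" for x
        proof -
          have "x \<in> {pi/3..pi}" using that by auto
          then show ?thesis unfolding f by (simp only: psi0) simp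
        qed
        then show ?thesis by blast
      qed
      then show "negligible {x \<in> {0..pi} - {0..pi/3}. ?f x \<noteq> 0}" by (metis negligible_empty)
      have "{x \<in> {0..pi/3} - {0..pi}. ?f x \<noteq> 0} = {}" by auto
      then show "negligible {x \<in> {0..pi/3} - {0..pi}. ?f x \<noteq> 0}" by (metis negligible_empty)
    qed
    also have "\<dots> = (I N - I (- N)) / (2 * \<i>)"
      unfolding f I_def integral_divide by (subst integral_diff[OF ii ii]) simp
    finally have "sin_coef (\<lambda>x. of_real x * (iexp (t * x) * chi x)) n = 2 / of_real pi * ((I N - I (- N)) / (2 * \<i>))"
      unfolding sin_coef_def by simp
    then have "cmod (sin_coef (\<lambda>x. of_real x * (iexp (t * x) * chi x)) n) = cmod (I N - I (- N)) / pi"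
      by (simp add: norm_mult norm_divide)
    also have "\<dots> \<le> (B / sqrt (t / 2) + B / sqrt (t / 2)) / pi"
      unfolding I_def by (intro divide_right_mono order_trans[OF norm_triangle_ineq4] add_mono osc t) simp
    also have "\<dots> = B * (2 * sqrt 2 / pi) / sqrt t"
      by (simp add: real_sqrt_divide mult.commute)
    also have "\<dots> \<le> C / sqrt t"
      unfolding C_def using t by (intro divide_right_mono mult_right_mono) auto
    finally show "cmod (sin_coef (\<lambda>x. of_real x * (iexp (t * x) * chi x)) n) \<le> C / sqrt t" .
  qed
qed

text \<open>The factor n of the overview appears as the number of pairs (i, j) with i + j = n, the
  form in which \<open>L1_norm_functional_calculus_ge\<close> consumes it.\<close>

lemma oscillatory_sin_coef_weighted_sum:
  assumes chi: "chi \<in> Cc_infinity" and sup: "supp chi \<subseteq> {-1/2<..<1/2}"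
    and one: "\<forall>x\<in>{-1/4..1/4}. chi x = 1"
  obtains t0 c where "t0 > 0" "c > 0"
    "\<And>t. t \<ge> t0 \<Longrightarrow> \<exists>N. (\<Sum>i=1..N. \<Sum>j=1..N.
       cmod (sin_coef (\<lambda>x. of_real x * (iexp (t * x) * chi x)) (i + j))) \<ge> c * t powr (3/2)"
proof -
  obtain C where C: "C > 0" "\<And>t n. t > 0 \<Longrightarrow>
     cmod (sin_coef (\<lambda>x. of_real x * (iexp (t * x) * chi x)) n) \<le> C / sqrt t"
    using oscillatory_sin_coef_bound[OF chi sup] by blast
  obtain chi' where "\<And>x. (chi has_vector_derivative chi' x) (at x)"
    by (rule Cc_infinity_C1[OF chi]) (rule that)
  then have contchi: "continuous_on S chi" for S
    by (meson continuous_at_imp_continuous_on has_vector_derivative_continuous)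
  define G where "G t x = of_real x * (iexp (t * x) * chi x)" for t x :: real
  have cG: "continuous_on S (G t)" for S t unfolding G_def
    by (intro continuous_intros contchi)
  define P where "P x = (cmod (of_real (1 - cos x) * chi (1 - cos x) * of_real (sin x)))\<^sup>2" for x
  have cP: "continuous_on S P" for S unfolding P_def
    by (intro continuous_intros continuous_on_compose2[OF contchi[of UNIV]]) auto
  have GP: "(cmod (G t (1 - cos x) * of_real (sin x)))\<^sup>2 = P x" for t x
    unfolding G_def P_def by (simp add: norm_mult)
  define A where "A = 2 / pi * integral {0..pi} P"
  have "A > 0"
  proof -
    \<comment> \<open>The point with 1 - cos y = 1/4, where the cutoff equals 1; it witnesses that
      \<open>P\<close> is not identically 0.\<close>
    define y where "y = arccos (3/4)"
    have y: "0 \<le> y" "y \<le> pi" "cos y = 3/4" by (auto simp: y_def arccos_lbound arccos_ubound)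
    have "sin y \<noteq> 0" using sin_cos_squared_add[of y] y by (auto simp: power2_eq_square)
    moreover have "chi (1 / 4) = 1" using one by simp
    ultimately have "P y \<noteq> 0" unfolding P_def by (simp add: y)
    then have "integral {0..pi} P \<noteq> 0"
      using integral_eq_0_iff[OF cP[of "{0..pi}"]] y pi_gt_zero
      by (metis P_def atLeastAtMost_iff zero_le_power2)
    moreover have "integral {0..pi} P \<ge> 0" by (rule integral_nonneg) (simp_all add: integrable_continuous_interval[OF cP] P_def)
    ultimately show ?thesis by (simp add: A_def)
  qed
  \<comment> \<open>Chosen so that the at most 2 eps t coefficients below \<open>K\<close>, each
    with square at most C^2 / t, contribute no more than A / 4.\<close>
  define eps where "eps = A / (8 * C\<^sup>2)"
  have eps: "eps > 0" using \<open>A > 0\<close> C by (simp add: eps_def)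
  \<comment> \<open>eps t >= 4 gives both K <= 2 eps t and K - 1 >= eps t / 2 after rounding
    up.\<close>
  define t0 where "t0 = max 1 (4 / eps)"
  define c where "c = eps / 2 * (A / (4 * C))"
  show thesis
  proof (rule that[of t0 c])
    show "t0 > 0" "c > 0" using eps \<open>A > 0\<close> C by (auto simp: t0_def c_def)
    fix t assume t: "t \<ge> t0"
    have tp: "t > 0" and te: "eps * t \<ge> 4" using t eps by (auto simp: t0_def field_simps)
    define a where "a n = cmod (sin_coef (G t) n)" for n
    have an: "a n \<le> C / sqrt t" "a n \<ge> 0" for n using C(2)[OF tp, of n] unfolding a_def G_def by auto
    obtain N where N: "(\<Sum>n\<le>N. (a n)\<^sup>2) \<ge> 2 / pi * integral {0..pi} (\<lambda>x. (cmod (G t (1 - cos x) * of_real (sin x)))\<^sup>2) - A / 4"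
      using sin_coef_Parseval_ge[OF cG[of _ t], of "A/4"] \<open>A > 0\<close> unfolding a_def by auto
    then have N: "(\<Sum>n\<le>N. (a n)\<^sup>2) \<ge> 3 * A / 4" unfolding GP by (simp add: A_def)
    have sq: "(a n)\<^sup>2 \<le> C / sqrt t * a n" for n
      unfolding power2_eq_square using an[of n] by (intro mult_right_mono)
    define K where "K = nat \<lceil>eps * t\<rceil>"
    have K: "real K \<ge> eps * t" "real K \<le> 2 * eps * t" using te by (auto simp: K_def) linarith+
    have "(\<Sum>n<K. (a n)\<^sup>2) \<le> (\<Sum>n<K. (C / sqrt t)\<^sup>2)"
      using an by (intro sum_mono power_mono) auto
    also have "\<dots> = real K * (C\<^sup>2 / t)" using tp by (simp add: power_divide)
    also have "\<dots> \<le> 2 * eps * t * (C\<^sup>2 / t)" using K tp by (intro mult_right_mono) auto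
    also have "\<dots> = A / 4" using tp C by (simp add: eps_def)
    finally have low: "(\<Sum>n<K. (a n)\<^sup>2) \<le> A / 4" .
    have "3 * A / 4 \<le> (\<Sum>n\<in>{..<K} \<union> {K..N}. (a n)\<^sup>2)"
      by (rule order_trans[OF N], rule sum_mono2) auto
    also have "\<dots> = (\<Sum>n<K. (a n)\<^sup>2) + (\<Sum>n=K..N. (a n)\<^sup>2)" by (rule sum.union_disjoint) auto
    also have "(\<Sum>n=K..N. (a n)\<^sup>2) \<le> (\<Sum>n=K..N. C / sqrt t * a n)" by (intro sum_mono sq)
    finally have "A / 2 \<le> C / sqrt t * (\<Sum>n=K..N. a n)" using low by (simp add: sum_distrib_left)
    then have S: "(\<Sum>n=K..N. a n) \<ge> A / (2 * C) * sqrt t" using C tp by (simp add: field_simps)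
    have "c * t powr (3/2) \<le> (eps * t / 2) * (A / (2 * C) * sqrt t)"
    proof -
      have "t powr (3/2) = t * sqrt t" using tp powr_add[of t 1 "1/2"] by (simp add: powr_half_sqrt)
      then show ?thesis unfolding c_def using eps \<open>A > 0\<close> C tp by (simp add: field_simps)
    qed
    also have "\<dots> \<le> (real K - 1) * (\<Sum>n=K..N. a n)"
      using K te S \<open>A > 0\<close> C tp by (intro mult_mono) auto
    \<comment> \<open>There are n - 1 pairs with i, j >= 1 and i + j = n, and n - 1 >= K - 1. The
      next lines index these pairs by i and enlarge to a square.\<close>
    also have "\<dots> \<le> (\<Sum>n=K..N. \<Sum>i=1..n-1. a n)"
      unfolding sum_distrib_left using K te an by (intro sum_mono) (auto intro!: mult_right_mono)
    also have "\<dots> = (\<Sum>p\<in>Sigma {K..N} (\<lambda>n. {1..n-1}). a (fst p))"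
      by (subst sum.Sigma) (auto intro!: sum.cong)
    also have "\<dots> = (\<Sum>(i,j)\<in>(\<lambda>(n,i). (i, n - i)) ` Sigma {K..N} (\<lambda>n. {1..n-1}). a (i + j))"
      by (subst sum.reindex) (auto simp: inj_on_def intro!: sum.cong)
    also have "\<dots> \<le> (\<Sum>(i,j)\<in>{1..N} \<times> {1..N}. a (i + j))"
      using an by (intro sum_mono2) (auto split: prod.splits)
    also have "\<dots> = (\<Sum>i=1..N. \<Sum>j=1..N. a (i + j))" by (rule sum.cartesian_product[symmetric])
    finally show "\<exists>N. (\<Sum>i=1..N. \<Sum>j=1..N.
       cmod (sin_coef (\<lambda>x. of_real x * (iexp (t * x) * chi x)) (i + j))) \<ge> c * t powr (3/2)"
      unfolding a_def G_def by blast
  qed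
qed

section \<open>The space L2 of a flow measure\<close>

text \<open>Isolates what the operator estimates use of the tree: the predecessor map and the level.
  \<open>tree_end\<close> provides both from an adjacency relation and an end.\<close>

locale flow_tree =
  fixes q :: nat and par :: "'v \<Rightarrow> 'v" and lev :: "'v \<Rightarrow> int"
  assumes q2: "q \<ge> 2" and card_children: "\<And>x. card {y. par y = x} = q"
    and lev_par: "\<And>x. lev (par x) = lev x + 1"
begin

abbreviation M where "M \<equiv> flow_measure q lev"

definition m :: "'v \<Rightarrow> real" where "m x = real q powi lev x"

lemma m_pos [simp]: "m x > 0" using q2 by (simp add: m_def)

lemma m_nonneg [simp]: "m x \<ge> 0" using m_pos[of x] by linarith

lemma m_neq_0 [simp]: "m x \<noteq> 0" using m_pos[of x] by linarith

lemma q_pos: "real q > 0" using q2 by simp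

lemma m_par: "m (par x) = real q * m x"
  using q2 by (simp add: m_def lev_par power_int_add)

lemma m_par_pow: "m ((par ^^ n) x) = real q ^ n * m x"
  by (induction n) (simp_all add: m_par)

lemma lev_par_pow: "lev ((par ^^ n) x) = lev x + int n"
  by (induction n) (simp_all add: lev_par)

lemma finite_children: "finite {y. par y = x}"
  using card_children[of x] q2 by (metis card.infinite not_numeral_le_zero)

lemma M_eq: "M = density (count_space UNIV) (\<lambda>x. ennreal (m x))"
  by (simp add: flow_measure_def m_def)

lemma space_M [simp]: "space M = UNIV" and sets_M [simp]: "sets M = UNIV"
  by (simp_all add: M_eq)

lemma measurable_M [simp]: "f \<in> borel_measurable M"
  by (simp add: M_eq)

lemma integrable_M_iff:
  fixes f :: "'v \<Rightarrow> 'b :: {banach, second_countable_topology}"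
  shows "integrable M f \<longleftrightarrow> (\<lambda>x. norm (f x) * m x) summable_on UNIV"
proof -
  have "integrable M f \<longleftrightarrow> integrable (count_space UNIV) (\<lambda>x. m x *\<^sub>R f x)"
    unfolding M_eq by (rule integrable_density) auto
  also have "\<dots> \<longleftrightarrow> Infinite_Sum.abs_summable_on (\<lambda>x. m x *\<^sub>R f x) UNIV"
    unfolding abs_summable_equivalent by (simp add: Infinite_Set_Sum.abs_summable_on_def)
  finally show ?thesis by (simp add: mult.commute)
qed

lemma integral_M:
  fixes f :: "'v \<Rightarrow> 'b :: {banach, second_countable_topology}"
  assumes "(\<lambda>x. norm (f x) * m x) summable_on UNIV"
  shows "(LINT x|M. f x) = (\<Sum>\<^sub>\<infinity>x. m x *\<^sub>R f x)"
proof -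
  have "(LINT x|M. f x) = (LINT x|count_space UNIV. m x *\<^sub>R f x)"
    unfolding M_eq by (rule integral_density) auto
  also have "\<dots> = infsetsum (\<lambda>x. m x *\<^sub>R f x) UNIV" by (simp add: infsetsum_def)
  also have "\<dots> = (\<Sum>\<^sub>\<infinity>x. m x *\<^sub>R f x)"
    using assms by (intro infsetsum_infsum) (simp add: abs_summable_equivalent[symmetric] mult.commute)
  finally show ?thesis .
qed

text \<open>Absorbing the square root of the mass into the function makes Minkowski and
  Cauchy-Schwarz for \<open>L2_set\<close> on finite sets applicable; norms are then suprema over
  finite sets (\<open>L2_set_le_nrm\<close>, \<open>L2_I\<close>).\<close>

definition wt :: "('v \<Rightarrow> complex) \<Rightarrow> 'v \<Rightarrow> real" where "wt f x = cmod (f x) * sqrt (m x)"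

lemma wt_square: "(wt f x)\<^sup>2 = (cmod (f x))\<^sup>2 * m x"
  by (simp add: wt_def power_mult_distrib)

lemma L2_iff: "f \<in> L2 M \<longleftrightarrow> (\<lambda>x. (wt f x)\<^sup>2) summable_on UNIV"
  by (simp add: L2_def integrable_M_iff wt_square)

abbreviation nrm :: "('v \<Rightarrow> complex) \<Rightarrow> real" where "nrm \<equiv> L2_norm M"

lemma nrm_eq: "f \<in> L2 M \<Longrightarrow> nrm f = sqrt (\<Sum>\<^sub>\<infinity>x. (wt f x)\<^sup>2)"
  by (simp add: L2_norm_def L2_iff wt_square integral_M mult.commute)

lemma nrm_nonneg [simp]: "nrm f \<ge> 0"
  by (simp add: L2_norm_def)

lemma nrm_square: "f \<in> L2 M \<Longrightarrow> (nrm f)\<^sup>2 = (\<Sum>\<^sub>\<infinity>x. (wt f x)\<^sup>2)"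
  by (simp add: nrm_eq infsum_nonneg)

lemma L2_set_le_nrm: "f \<in> L2 M \<Longrightarrow> finite A \<Longrightarrow> L2_set (wt f) A \<le> nrm f"
  unfolding L2_set_def by (subst nrm_eq) (auto intro!: real_sqrt_le_mono finite_sum_le_infsum simp: L2_iff)

lemma L2_I:
  assumes "\<And>A. finite A \<Longrightarrow> L2_set (wt f) A \<le> B"
  shows "f \<in> L2 M" "nrm f \<le> B"
proof -
  have B: "B \<ge> 0" using assms[of "{}"] by simp
  have *: "(\<Sum>x\<in>A. (wt f x)\<^sup>2) \<le> B\<^sup>2" if "finite A" for A
    using assms[OF that] power_mono[of "L2_set (wt f) A" B 2]
    by (simp add: L2_set_def sum_nonneg)
  show L: "f \<in> L2 M" unfolding L2_iff
    by (rule nonneg_bdd_above_summable_on) (auto intro!: bdd_aboveI2 *)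
  have "(\<Sum>\<^sub>\<infinity>x. (wt f x)\<^sup>2) \<le> B\<^sup>2"
    using L unfolding L2_iff by (rule infsum_le_finite_sums) (rule *)
  then show "nrm f \<le> B" unfolding nrm_eq[OF L] using B by (simp add: real_le_lsqrt)
qed

text \<open>Every point has positive mass, so evaluations are continuous on L2 and L2 limits can be
  identified point by point.\<close>

lemma pointwise_le_nrm: "f \<in> L2 M \<Longrightarrow> cmod (f x) \<le> nrm f / sqrt (m x)"
  using L2_set_le_nrm[of f "{x}"] by (simp add: L2_set_def wt_def pos_le_divide_eq abs_mult)

lemma nrm_zero_imp: "f \<in> L2 M \<Longrightarrow> nrm f = 0 \<Longrightarrow> f x = 0"
  using pointwise_le_nrm[of f x] by simp

lemma L2_zero [simp]: "(\<lambda>x. 0) \<in> L2 M" and nrm_zero [simp]: "nrm (\<lambda>x. 0) = 0"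
  using L2_I[of "\<lambda>x. 0" 0] by (simp_all add: L2_set_def wt_def antisym)

lemma L2_add:
  assumes "f \<in> L2 M" "g \<in> L2 M"
  shows "(\<lambda>x. f x + g x) \<in> L2 M" "nrm (\<lambda>x. f x + g x) \<le> nrm f + nrm g"
proof -
  have "L2_set (wt (\<lambda>x. f x + g x)) A \<le> nrm f + nrm g" if "finite A" for A
  proof -
    have "wt (\<lambda>x. f x + g x) x \<le> wt f x + wt g x" for x
      unfolding wt_def distrib_right[symmetric] by (intro mult_right_mono norm_triangle_ineq) simp
    then have "L2_set (wt (\<lambda>x. f x + g x)) A \<le> L2_set (\<lambda>x. wt f x + wt g x) A"
      by (intro L2_set_mono) (auto simp: wt_def)
    also have "\<dots> \<le> L2_set (wt f) A + L2_set (wt g) A" by (rule L2_set_triangle_ineq)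
    finally show ?thesis using L2_set_le_nrm[OF assms(1) that] L2_set_le_nrm[OF assms(2) that] by linarith
  qed
  then show "(\<lambda>x. f x + g x) \<in> L2 M" "nrm (\<lambda>x. f x + g x) \<le> nrm f + nrm g"
    using L2_I[of "\<lambda>x. f x + g x"] by blast+
qed

lemma L2_scale_aux:
  assumes "f \<in> L2 M"
  shows "(\<lambda>x. c * f x) \<in> L2 M" "nrm (\<lambda>x. c * f x) \<le> cmod c * nrm f"
proof -
  have "L2_set (wt (\<lambda>x. c * f x)) A \<le> cmod c * nrm f" if "finite A" for A
  proof -
    have "L2_set (wt (\<lambda>x. c * f x)) A = cmod c * L2_set (wt f) A"
      unfolding L2_set_right_distrib[OF norm_ge_zero] by (intro L2_set_cong refl) (simp add: wt_def norm_mult mult.assoc)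
    then show ?thesis using L2_set_le_nrm[OF assms that] by (simp add: mult_left_mono)
  qed
  then show "(\<lambda>x. c * f x) \<in> L2 M" "nrm (\<lambda>x. c * f x) \<le> cmod c * nrm f"
    using L2_I[of "\<lambda>x. c * f x"] by blast+
qed

lemmas L2_scale = L2_scale_aux(1)

lemma nrm_scale:
  assumes "f \<in> L2 M" shows "nrm (\<lambda>x. c * f x) = cmod c * nrm f"
proof (cases "c = 0")
  case False
  have "nrm (\<lambda>x. inverse c * (c * f x)) \<le> cmod (inverse c) * nrm (\<lambda>x. c * f x)"
    by (rule L2_scale_aux(2)[OF L2_scale[OF assms]])
  also have "(\<lambda>x. inverse c * (c * f x)) = f" using False by (simp add: fun_eq_iff)
  finally have "cmod c * nrm f \<le> nrm (\<lambda>x. c * f x)" using False by (simp add: norm_inverse inverse_eq_divide norm_divide pos_le_divide_eq mult.commute)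
  then show ?thesis using L2_scale_aux(2)[OF assms, of c] by linarith
qed simp

lemma L2_diff:
  assumes "f \<in> L2 M" "g \<in> L2 M"
  shows "(\<lambda>x. f x - g x) \<in> L2 M" "nrm (\<lambda>x. f x - g x) \<le> nrm f + nrm g"
  using L2_add[OF assms(1) L2_scale[OF assms(2), of "-1"]] nrm_scale[OF assms(2), of "-1"] by simp_all

lemma nrm_triangle_diff:
  assumes "f \<in> L2 M" "g \<in> L2 M" "h \<in> L2 M"
  shows "nrm (\<lambda>x. f x - h x) \<le> nrm (\<lambda>x. f x - g x) + nrm (\<lambda>x. g x - h x)"
  using L2_add(2)[OF L2_diff(1)[OF assms(1,2)] L2_diff(1)[OF assms(2,3)]] by simp

lemma L2_sum:
  assumes "\<And>i. i \<in> I \<Longrightarrow> f i \<in> L2 M"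
  shows "(\<lambda>x. \<Sum>i\<in>I. f i x) \<in> L2 M \<and> nrm (\<lambda>x. \<Sum>i\<in>I. f i x) \<le> (\<Sum>i\<in>I. nrm (f i))"
  using assms
proof (induction I rule: infinite_finite_induct)
  case (insert i I)
  then show ?case
    using L2_add[of "f i" "\<lambda>x. \<Sum>i\<in>I. f i x"] by simp
qed auto

text \<open>A form of Fatou: on each finite set the partial norms converge.\<close>

lemma L2_pointwise_limit:
  assumes L: "\<And>n. f n \<in> L2 M" and N: "\<And>n. nrm (f n) \<le> B" and lim: "\<And>x. (\<lambda>n. f n x) \<longlonglongrightarrow> g x"
  shows "g \<in> L2 M" "nrm g \<le> B"
proof -
  have "L2_set (wt g) A \<le> B" if "finite A" for A
  proof (rule LIMSEQ_le_const2)
    show "(\<lambda>n. L2_set (wt (f n)) A) \<longlonglongrightarrow> L2_set (wt g) A"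
      unfolding L2_set_def wt_def by (intro tendsto_intros lim)
    show "\<exists>N. \<forall>n\<ge>N. L2_set (wt (f n)) A \<le> B"
      using L2_set_le_nrm[OF L that] N by (meson order_trans)
  qed
  then show "g \<in> L2 M" "nrm g \<le> B" using L2_I by blast+
qed

text \<open>The limit is built pointwise and \<open>L2_pointwise_limit\<close> upgrades the
  convergence to the norm. The pointwise statement is kept in the conclusion because the kernel
  computation works at single vertices.\<close>

lemma L2_complete:
  assumes L: "\<And>n. f n \<in> L2 M"
    and C: "\<And>e. e > 0 \<Longrightarrow> \<exists>k. \<forall>i\<ge>k. \<forall>j\<ge>k. nrm (\<lambda>x. f i x - f j x) \<le> e"
  obtains g where "g \<in> L2 M" "(\<lambda>n. nrm (\<lambda>x. f n x - g x)) \<longlonglongrightarrow> 0" "\<And>x. (\<lambda>n. f n x) \<longlonglongrightarrow> g x"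
proof -
  have "convergent (\<lambda>n. f n x)" for x
  proof -
    have "Cauchy (\<lambda>n. f n x)"
    proof (rule metric_CauchyI)
      fix e :: real assume e: "e > 0"
      then obtain k where k: "\<And>i j. i \<ge> k \<Longrightarrow> j \<ge> k \<Longrightarrow> nrm (\<lambda>x. f i x - f j x) \<le> e / 2 * sqrt (m x)"
        using C[of "e / 2 * sqrt (m x)"] by auto
      have "dist (f i x) (f j x) < e" if "i \<ge> k" "j \<ge> k" for i j
      proof -
        have "cmod (f i x - f j x) \<le> nrm (\<lambda>x. f i x - f j x) / sqrt (m x)"
          by (rule pointwise_le_nrm[OF L2_diff(1)[OF L L]])
        also have "\<dots> \<le> e / 2 * sqrt (m x) / sqrt (m x)" using k[OF that] by (intro divide_right_mono) auto
        also have "\<dots> = e / 2" by simp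
        finally show ?thesis using e by (simp add: dist_norm)
      qed
      then show "\<exists>k. \<forall>i\<ge>k. \<forall>j\<ge>k. dist (f i x) (f j x) < e" by blast
    qed
    then show ?thesis by (simp add: Cauchy_convergent_iff)
  qed
  then obtain g where g: "\<And>x. (\<lambda>n. f n x) \<longlonglongrightarrow> g x" unfolding convergent_def by metis
  have close: "(\<lambda>x. f i x - g x) \<in> L2 M \<and> nrm (\<lambda>x. f i x - g x) \<le> e"
    if k: "\<forall>i\<ge>k. \<forall>j\<ge>k. nrm (\<lambda>x. f i x - f j x) \<le> e" and "i \<ge> k" for e k i
  proof -
    have 1: "(\<lambda>x. f i x - f (n + k) x) \<in> L2 M" for n by (rule L2_diff(1)[OF L L])
    have 2: "nrm (\<lambda>x. f i x - f (n + k) x) \<le> e" for n using k \<open>i \<ge> k\<close> by simp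
    have 3: "(\<lambda>n. f i x - f (n + k) x) \<longlonglongrightarrow> f i x - g x" for x
      by (intro tendsto_intros LIMSEQ_ignore_initial_segment g)
    show ?thesis using L2_pointwise_limit[of "\<lambda>n x. f i x - f (n + k) x", OF 1 2 3] by blast
  qed
  obtain k where k: "\<forall>i\<ge>k. \<forall>j\<ge>k. nrm (\<lambda>x. f i x - f j x) \<le> 1" using C[of 1] by auto
  have "(\<lambda>x. f k x - (f k x - g x)) \<in> L2 M"
    using close[OF k, of k] L2_diff(1)[OF L[of k]] by blast
  then have "g \<in> L2 M" by simp
  moreover have "(\<lambda>n. nrm (\<lambda>x. f n x - g x)) \<longlonglongrightarrow> 0"
  proof (rule LIMSEQ_I)
    fix r :: real assume "r > 0"
    then obtain k where k: "\<forall>i\<ge>k. \<forall>j\<ge>k. nrm (\<lambda>x. f i x - f j x) \<le> r / 2" using C[of "r / 2"] by auto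
    then show "\<exists>no. \<forall>n\<ge>no. norm (nrm (\<lambda>x. f n x - g x) - 0) < r"
      using close[OF k] \<open>r > 0\<close> by (intro exI[of _ k]) fastforce
  qed
  ultimately show thesis using that g by blast
qed

text \<open>The inner product as an unordered sum, which can be regrouped along the fibres of
  \<open>par\<close>.\<close>

definition hip :: "('v \<Rightarrow> complex) \<Rightarrow> ('v \<Rightarrow> complex) \<Rightarrow> complex" where
  "hip f g = (\<Sum>\<^sub>\<infinity>x. of_real (m x) * (f x * cnj (g x)))"

lemma hip_summable:
  assumes "f \<in> L2 M" "g \<in> L2 M"
  shows "(\<lambda>x. norm (of_real (m x) * (f x * cnj (g x)))) summable_on UNIV"
    and "cmod (hip f g) \<le> nrm f * nrm g"
proof -
  have *: "(\<Sum>x\<in>A. norm (of_real (m x) * (f x * cnj (g x)))) \<le> nrm f * nrm g" if "finite A" for A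
  proof -
    have "norm (of_real (m x) * (f x * cnj (g x))) = \<bar>wt f x\<bar> * \<bar>wt g x\<bar>" for x
    proof -
      have "m x = sqrt (m x) * sqrt (m x)" by simp
      then show ?thesis unfolding wt_def norm_mult abs_mult complex_mod_cnj
        by (simp add: mult_ac)
    qed
    then have "(\<Sum>x\<in>A. norm (of_real (m x) * (f x * cnj (g x)))) \<le> L2_set (wt f) A * L2_set (wt g) A"
      by (simp only: L2_set_mult_ineq)
    also have "\<dots> \<le> nrm f * nrm g"
      by (intro mult_mono L2_set_le_nrm assms that) auto
    finally show ?thesis .
  qed
  show s: "(\<lambda>x. norm (of_real (m x) * (f x * cnj (g x)))) summable_on UNIV"
    by (rule nonneg_bdd_above_summable_on) (auto intro!: bdd_aboveI2 * simp del: norm_mult simp: norm_mult[symmetric])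
  have "cmod (hip f g) \<le> (\<Sum>\<^sub>\<infinity>x. norm (of_real (m x) * (f x * cnj (g x))))"
    unfolding hip_def by (rule norm_infsum_bound[OF s])
  also have "\<dots> \<le> nrm f * nrm g"
    by (rule infsum_le_finite_sums[OF s]) (rule *)
  finally show "cmod (hip f g) \<le> nrm f * nrm g" .
qed

lemma hip_summable': "f \<in> L2 M \<Longrightarrow> g \<in> L2 M \<Longrightarrow> (\<lambda>x. of_real (m x) * (f x * cnj (g x))) summable_on UNIV"
  by (rule abs_summable_summable[OF hip_summable(1)])

lemma L2_inner_eq: "f \<in> L2 M \<Longrightarrow> g \<in> L2 M \<Longrightarrow> L2_inner M f g = hip f g"
  unfolding L2_inner_def hip_def using hip_summable(1)[of f g]
  by (subst integral_M) (simp_all add: norm_mult mult_ac scaleR_conv_of_real)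

lemma hip_self: "f \<in> L2 M \<Longrightarrow> hip f f = of_real ((nrm f)\<^sup>2)"
proof -
  assume f: "f \<in> L2 M"
  have "of_real (m x) * (f x * cnj (f x)) = complex_of_real ((wt f x)\<^sup>2)" for x
    unfolding wt_square by (simp add: complex_norm_square[symmetric] mult.commute)
  then show ?thesis unfolding hip_def nrm_square[OF f] using f
    by (simp only: L2_iff infsumI[OF has_sum_of_real[OF has_sum_infsum]])
qed

lemma hip_add_left: "f \<in> L2 M \<Longrightarrow> g \<in> L2 M \<Longrightarrow> h \<in> L2 M \<Longrightarrow> hip (\<lambda>x. f x + g x) h = hip f h + hip g h"
  unfolding hip_def infsum_add[OF hip_summable' hip_summable', symmetric]
  by (rule infsum_cong) (simp add: algebra_simps)

lemma hip_scale_left: "hip (\<lambda>x. c * f x) h = c * hip f h"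
  unfolding hip_def by (subst infsum_cmult_right'[symmetric]) (simp add: mult_ac)

lemma hip_commute: "hip g f = cnj (hip f g)"
  unfolding hip_def infsum_cnj[symmetric] by (simp add: mult_ac)

lemma hip_add_right: "f \<in> L2 M \<Longrightarrow> g \<in> L2 M \<Longrightarrow> h \<in> L2 M \<Longrightarrow> hip h (\<lambda>x. f x + g x) = hip h f + hip h g"
  by (subst (1 2 3) hip_commute) (simp add: hip_add_left)

lemma hip_scale_right: "hip h (\<lambda>x. c * f x) = cnj c * hip h f"
  by (subst (1 2) hip_commute) (simp add: hip_scale_left)

lemma nrm_add_orthogonal:
  assumes "f \<in> L2 M" "g \<in> L2 M" "hip f g = 0"
  shows "(nrm (\<lambda>x. f x + g x))\<^sup>2 = (nrm f)\<^sup>2 + (nrm g)\<^sup>2"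
proof -
  have "hip g f = 0" using hip_commute[of g f] assms(3) by simp
  then have "complex_of_real ((nrm (\<lambda>x. f x + g x))\<^sup>2) = of_real ((nrm f)\<^sup>2 + (nrm g)\<^sup>2)"
    unfolding hip_self[OF L2_add(1)[OF assms(1,2)], symmetric] of_real_add hip_self[OF assms(1), symmetric]
      hip_self[OF assms(2), symmetric]
    using assms by (simp add: hip_add_left hip_add_right L2_add)
  then show ?thesis using of_real_eq_iff by blast
qed

end

section \<open>The flow Laplacian as a function of an isometry\<close>

context flow_tree
begin

text \<open>The flow property of the measure; it makes \<open>up\<close> an isometry.\<close>

lemma sum_children_m: "(\<Sum>x | par x = y. m x) = m y"
proof -
  have "(\<Sum>x | par x = y. m x) = (\<Sum>x | par x = y. m y / real q)"
    using m_par q_pos by (intro sum.cong) auto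
  then show ?thesis using q_pos by (simp add: card_children)
qed

lemma bij_children: "bij_betw snd (SIGMA y:UNIV. {x. par x = y}) UNIV"
  by (rule bij_betwI[where g = "\<lambda>x. (par x, x)"]) auto

lemma infsum_children:
  fixes F :: "'v \<Rightarrow> 'b :: banach"
  assumes "F summable_on UNIV"
  shows "infsum F UNIV = (\<Sum>\<^sub>\<infinity>y. \<Sum>x | par x = y. F x)"
proof -
  have e: "(\<lambda>z. F (snd z)) = (\<lambda>(y, x). F x)" by (simp add: fun_eq_iff split_beta)
  have "(\<lambda>z. F (snd z)) summable_on (SIGMA y:UNIV. {x. par x = y})"
    unfolding summable_on_reindex_bij_betw[OF bij_children] by (rule assms)
  then have "(\<Sum>\<^sub>\<infinity>y. infsum F {x. par x = y}) = (\<Sum>\<^sub>\<infinity>(y, x)\<in>(SIGMA y:UNIV. {x. par x = y}). F x)"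
    unfolding e by (rule infsum_Sigma'_banach)
  also have "\<dots> = infsum F UNIV"
    using infsum_reindex_bij_betw[OF bij_children, of F] by (simp add: e)
  finally show ?thesis by (simp add: finite_children)
qed

definition up :: "('v \<Rightarrow> complex) \<Rightarrow> 'v \<Rightarrow> complex" where "up f x = f (par x)"

definition dn :: "('v \<Rightarrow> complex) \<Rightarrow> 'v \<Rightarrow> complex" where "dn f y = (\<Sum>x | par x = y. f x) / of_nat q"

definition lap :: "('v \<Rightarrow> complex) \<Rightarrow> 'v \<Rightarrow> complex" where "lap f x = f x - (up f x + dn f x) / 2"

lemma dn_up [simp]: "dn (up f) = f"
proof
  fix y
  have "(\<Sum>x | par x = y. up f x) = (\<Sum>x | par x = y. f y)" by (intro sum.cong) (auto simp: up_def)
  then show "dn (up f) y = f y" using q_pos by (simp add: dn_def card_children)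
qed

lemma up_L2_aux:
  assumes f: "f \<in> L2 M" shows "up f \<in> L2 M" "nrm (up f) \<le> nrm f"
proof -
  have "L2_set (wt (up f)) A \<le> nrm f" if A: "finite A" for A
  proof -
    have fin: "finite {x. par x \<in> par ` A}"
    proof -
      have "{x. par x \<in> par ` A} = (\<Union>y\<in>par ` A. {x. par x = y})" by auto
      then show ?thesis using A finite_children by simp
    qed
    \<comment> \<open>Enlarging \<open>A\<close> to full sets of siblings lets each fibre carry
      exactly the mass of its parent.\<close>
    have "(\<Sum>x\<in>A. (wt (up f) x)\<^sup>2) \<le> (\<Sum>x\<in>{x. par x \<in> par ` A}. (wt (up f) x)\<^sup>2)"
      using fin by (intro sum_mono2) auto
    also have "\<dots> = (\<Sum>y\<in>par ` A. \<Sum>x\<in>{x. x \<in> {x. par x \<in> par ` A} \<and> par x = y}. (wt (up f) x)\<^sup>2)"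
      by (rule sum.group[symmetric]) (use A fin in auto)
    also have "\<dots> = (\<Sum>y\<in>par ` A. (wt f y)\<^sup>2)"
    proof (rule sum.cong[OF refl])
      fix y assume "y \<in> par ` A"
      then have "(\<Sum>x\<in>{x. x \<in> {x. par x \<in> par ` A} \<and> par x = y}. (wt (up f) x)\<^sup>2) = (\<Sum>x | par x = y. (cmod (f y))\<^sup>2 * m x)"
        by (intro sum.cong) (auto simp: wt_square up_def)
      then show "(\<Sum>x\<in>{x. x \<in> {x. par x \<in> par ` A} \<and> par x = y}. (wt (up f) x)\<^sup>2) = (wt f y)\<^sup>2"
        by (simp add: sum_distrib_left[symmetric] sum_children_m wt_square)
    qed
    finally have "L2_set (wt (up f)) A \<le> L2_set (wt f) (par ` A)"
      unfolding L2_set_def by simp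
    also have "\<dots> \<le> nrm f" using A by (intro L2_set_le_nrm f) auto
    finally show ?thesis .
  qed
  then show "up f \<in> L2 M" "nrm (up f) \<le> nrm f" using L2_I by blast+
qed

text \<open>Cauchy-Schwarz over the q children loses a factor q, which the average and the child
  masses m y / q compensate.\<close>

lemma dn_L2_aux:
  assumes f: "f \<in> L2 M" shows "dn f \<in> L2 M" "nrm (dn f) \<le> nrm f"
proof -
  have "L2_set (wt (dn f)) A \<le> nrm f" if A: "finite A" for A
  proof -
    have fin: "finite {x. par x \<in> A}"
    proof -
      have "{x. par x \<in> A} = (\<Union>y\<in>A. {x. par x = y})" by auto
      then show ?thesis using A finite_children by simp
    qed
    have "(\<Sum>y\<in>A. (wt (dn f) y)\<^sup>2) \<le> (\<Sum>y\<in>A. \<Sum>x | par x = y. (wt f x)\<^sup>2)"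
    proof (rule sum_mono)
      fix y
      have "cmod (\<Sum>x | par x = y. f x) \<le> (\<Sum>x | par x = y. cmod (f x))" by (rule norm_sum)
      then have "(cmod (\<Sum>x | par x = y. f x))\<^sup>2 \<le> (\<Sum>x | par x = y. cmod (f x))\<^sup>2"
        by (rule power_mono) simp
      also have "\<dots> \<le> real q * (\<Sum>x | par x = y. (cmod (f x))\<^sup>2)"
        using sum_squared_le_sum_of_squares[of "\<lambda>x. cmod (f x)" "{x. par x = y}"]
        by (simp add: card_children mult.commute)
      finally have "(cmod (\<Sum>x | par x = y. f x))\<^sup>2 / real q * (m y / real q) \<le> (\<Sum>x | par x = y. (cmod (f x))\<^sup>2) * (m y / real q)"
        using q_pos by (intro mult_right_mono) (simp_all add: field_simps)
      moreover have "(wt (dn f) y)\<^sup>2 = (cmod (\<Sum>x | par x = y. f x))\<^sup>2 / real q * (m y / real q)"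
        unfolding wt_square by (simp add: dn_def norm_divide power_divide power2_eq_square)
      moreover have "(\<Sum>x | par x = y. (wt f x)\<^sup>2) = (\<Sum>x | par x = y. (cmod (f x))\<^sup>2) * (m y / real q)"
        unfolding sum_distrib_right by (intro sum.cong) (use m_par q_pos in \<open>auto simp: wt_square\<close>)
      ultimately show "(wt (dn f) y)\<^sup>2 \<le> (\<Sum>x | par x = y. (wt f x)\<^sup>2)" by simp
    qed
    also have "\<dots> = (\<Sum>y\<in>A. \<Sum>x\<in>{x. x \<in> {x. par x \<in> A} \<and> par x = y}. (wt f x)\<^sup>2)"
      by (intro sum.cong) auto
    also have "\<dots> = (\<Sum>x\<in>{x. par x \<in> A}. (wt f x)\<^sup>2)"
      by (rule sum.group) (use A fin in auto)
    finally have "L2_set (wt (dn f)) A \<le> L2_set (wt f) {x. par x \<in> A}"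
      unfolding L2_set_def by simp
    also have "\<dots> \<le> nrm f" using fin by (intro L2_set_le_nrm f) auto
    finally show ?thesis .
  qed
  then show "dn f \<in> L2 M" "nrm (dn f) \<le> nrm f" using L2_I by blast+
qed

lemmas up_L2 = up_L2_aux(1) and dn_L2 = dn_L2_aux(1) and nrm_dn_le = dn_L2_aux(2)

text \<open>Both maps are contractions and \<open>dn\<close> undoes \<open>up\<close>, so neither
  inequality can be strict.\<close>

lemma nrm_up: "f \<in> L2 M \<Longrightarrow> nrm (up f) = nrm f"
  using up_L2_aux[of f] dn_L2_aux(2)[OF up_L2_aux(1), of f] by simp

lemma hip_up_left:
  assumes f: "f \<in> L2 M" and g: "g \<in> L2 M"
  shows "hip (up f) g = hip f (dn g)"
proof -
  have "hip (up f) g = (\<Sum>\<^sub>\<infinity>y. \<Sum>x | par x = y. of_real (m x) * (up f x * cnj (g x)))"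
    unfolding hip_def by (rule infsum_children[OF hip_summable'[OF up_L2[OF f] g]])
  also have "\<dots> = hip f (dn g)"
    unfolding hip_def
  proof (rule infsum_cong)
    fix y
    have "(\<Sum>x | par x = y. of_real (m x) * (up f x * cnj (g x))) = (\<Sum>x | par x = y. of_real (m y / real q) * (f y * cnj (g x)))"
      using m_par q_pos by (intro sum.cong) (auto simp: up_def)
    also have "\<dots> = of_real (m y) * (f y * cnj (dn g y))"
      by (simp add: dn_def sum_distrib_left sum_divide_distrib)
    finally show "(\<Sum>x | par x = y. of_real (m x) * (up f x * cnj (g x))) = of_real (m y) * (f y * cnj (dn g y))" .
  qed
  finally show ?thesis .
qed

lemma hip_dn_left: "f \<in> L2 M \<Longrightarrow> g \<in> L2 M \<Longrightarrow> hip (dn f) g = hip f (up g)"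
  by (subst (1 2) hip_commute) (simp add: hip_up_left)

lemma lap_L2: "f \<in> L2 M \<Longrightarrow> lap f \<in> L2 M"
proof -
  assume f: "f \<in> L2 M"
  have "(\<lambda>x. f x - (1/2) * (up f x + dn f x)) \<in> L2 M"
    by (intro L2_diff(1) L2_scale L2_add(1) f up_L2 dn_L2)
  then show ?thesis by (simp add: lap_def[abs_def])
qed

lemma nrm_lap: "f \<in> L2 M \<Longrightarrow> nrm (lap f) \<le> 2 * nrm f"
proof -
  assume f: "f \<in> L2 M"
  have ud: "(\<lambda>x. up f x + dn f x) \<in> L2 M" by (intro L2_add(1) f up_L2 dn_L2)
  have "nrm (\<lambda>x. f x - (1/2) * (up f x + dn f x)) \<le> nrm f + nrm (\<lambda>x. (1/2) * (up f x + dn f x))"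
    by (intro L2_diff(2) L2_scale f ud)
  also have "nrm (\<lambda>x. (1/2) * (up f x + dn f x)) = 1/2 * nrm (\<lambda>x. up f x + dn f x)"
    by (subst nrm_scale[OF ud]) simp
  also have "nrm (\<lambda>x. up f x + dn f x) \<le> nrm f + nrm f"
    using L2_add(2)[OF up_L2[OF f] dn_L2[OF f]] nrm_up[OF f] nrm_dn_le[OF f] by linarith
  finally show ?thesis by (simp add: lap_def[abs_def])
qed

lemma up_linear: "up (\<lambda>x. a * f x + b * g x) x = a * up f x + b * up g x"
  by (simp add: up_def)

lemma dn_linear: "dn (\<lambda>x. a * f x + b * g x) x = a * dn f x + b * dn g x"
  by (simp add: dn_def sum.distrib sum_distrib_left add_divide_distrib)

lemma lap_linear: "lap (\<lambda>x. a * f x + b * g x) x = a * lap f x + b * lap g x"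
  unfolding lap_def up_linear dn_linear by (simp add: algebra_simps add_divide_distrib)

lemma lap_scale: "lap (\<lambda>x. a * f x) x = a * lap f x"
  using lap_linear[of a f 0 f x] by simp

lemma lap_sum: "lap (\<lambda>x. \<Sum>i\<in>I. c i * f i x) x = (\<Sum>i\<in>I. c i * lap (f i) x)"
proof (induction I arbitrary: x rule: infinite_finite_induct)
  case (insert i I)
  then show ?case using lap_linear[of "c i" "f i" 1 "\<lambda>x. \<Sum>i\<in>I. c i * f i x" x] by simp
qed (use lap_scale[of 0 "\<lambda>x. 0"] in auto)

lemma hip_lap:
  assumes "f \<in> L2 M" "g \<in> L2 M" shows "hip (lap f) g = hip f (lap g)"
proof -
  have l: "hip (lap u) v = hip u v - (hip (up u) v + hip (dn u) v) / 2" if "u \<in> L2 M" "v \<in> L2 M" for u v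
  proof -
    have e: "lap u = (\<lambda>x. u x + (-1/2) * (up u x + dn u x))" by (simp add: lap_def fun_eq_iff)
    show ?thesis unfolding e
      using that by (simp only: hip_add_left hip_scale_left L2_scale L2_add(1) up_L2 dn_L2) simp
  qed
  have "hip f (lap g) = cnj (hip (lap g) f)" by (rule hip_commute)
  also have "\<dots> = hip f g - (hip f (up g) + hip f (dn g)) / 2"
    using l[OF assms(2,1)] by (simp add: hip_commute[of f])
  finally show ?thesis
    using l[OF assms] assms by (simp add: hip_up_left hip_dn_left add.commute)
qed

text \<open>Normalised to have integral 1 and to represent evaluation at z (\<open>hip_pt\<close>).
  With this scaling \<open>dn\<close> sends point masses to point masses without a factor.\<close>

definition pt :: "'v \<Rightarrow> 'v \<Rightarrow> complex" where "pt z x = (if x = z then 1 / of_real (m z) else 0)"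

lemma L2_finite_support:
  assumes "finite {x. f x \<noteq> 0}" shows "f \<in> L2 M"
proof (rule L2_I(1))
  fix A :: "'v set" assume A: "finite A"
  have "(\<Sum>x\<in>A. (wt f x)\<^sup>2) = (\<Sum>x\<in>A \<inter> {x. f x \<noteq> 0}. (wt f x)\<^sup>2)"
    by (rule sum.mono_neutral_right) (auto simp: A wt_def)
  also have "\<dots> \<le> (\<Sum>x\<in>{x. f x \<noteq> 0}. (wt f x)\<^sup>2)"
    using assms by (intro sum_mono2) auto
  finally  show "L2_set (wt f) A \<le> L2_set (wt f) {x. f x \<noteq> 0}" by (simp add: L2_set_def)
qed

lemma pt_L2: "pt z \<in> L2 M"
proof (rule L2_finite_support)
  show "finite {x. pt z x \<noteq> 0}"
    by (rule finite_subset[of _ "{z}"]) (auto simp: pt_def split: if_splits)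
qed

lemma hip_pt: "hip (pt z) f = cnj (f z)"
proof -
  have "hip (pt z) f = (\<Sum>\<^sub>\<infinity>x\<in>{z}. of_real (m x) * (pt z x * cnj (f x)))"
    unfolding hip_def by (rule infsum_cong_neutral) (auto simp: pt_def)
  then show ?thesis by (simp add: pt_def)
qed

lemma dn_pt: "dn (pt z) = pt (par z)"
proof
  fix y
  have "(\<Sum>x | par x = y. pt z x) = (if par z = y then 1 / of_real (m z) else 0)"
    using finite_children[of y] by (simp add: pt_def sum.delta')
  then show "dn (pt z) y = pt (par z) y"
    by (simp add: dn_def pt_def m_par)
qed

text \<open>\<open>L2_adjoint\<close> is a definite description: existence comes from
  \<open>hip_up_left\<close>, uniqueness from testing against the point masses
  \<open>pt x\<close>.\<close>

lemma adjoint_grad: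
  assumes g: "g \<in> L2 M"
  shows "L2_adjoint M (\<lambda>f x. f x - f (par x)) g = (\<lambda>x. g x - dn g x)"
  unfolding L2_adjoint_def
proof (rule the_equality)
  have gd: "(\<lambda>x. g x - dn g x) \<in> L2 M" by (intro L2_diff(1) g dn_L2)
  have G: "(\<lambda>x. f x - f (par x)) \<in> L2 M" if "f \<in> L2 M" for f
    using L2_diff(1)[OF that up_L2[OF that]] by (simp add: up_def[abs_def])
  have main: "L2_inner M (\<lambda>x. f x - f (par x)) g = hip f (\<lambda>x. g x - dn g x)" if f: "f \<in> L2 M" for f
  proof -
    have "hip (\<lambda>x. f x - f (par x)) g = hip (\<lambda>x. f x + (-1) * up f x) g" by (simp add: up_def)
    also have "\<dots> = hip f g - hip f (dn g)"
      by (simp only: hip_add_left hip_scale_left L2_scale up_L2 f g hip_up_left) simp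
    also have "\<dots> = hip f (\<lambda>x. g x + (-1) * dn g x)"
      by (simp only: hip_add_right hip_scale_right L2_scale dn_L2 f g) simp
    finally show ?thesis using L2_inner_eq[OF G[OF f] g] by simp
  qed
  show "(\<lambda>x. g x - dn g x) \<in> L2 M \<and> (\<forall>f\<in>L2 M. L2_inner M (\<lambda>x. f x - f (par x)) g = L2_inner M f (\<lambda>x. g x - dn g x))"
    using main gd by (simp add: L2_inner_eq)
  fix h assume h: "h \<in> L2 M \<and> (\<forall>f\<in>L2 M. L2_inner M (\<lambda>x. f x - f (par x)) g = L2_inner M f h)"
  have "h x = g x - dn g x" for x
  proof -
    have "hip (pt x) h = hip (pt x) (\<lambda>x. g x - dn g x)"
      using h main[OF pt_L2[of x]] pt_L2[of x] by (simp add: L2_inner_eq)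
    then show ?thesis unfolding hip_pt complex_cnj_cancel_iff .
  qed
  then show "h = (\<lambda>x. g x - dn g x)" by blast
qed

text \<open>(1 - dn) (1 - up) = 2 - up - dn, because dn up = 1.\<close>

lemma half_adjoint_grad:
  assumes f: "f \<in> L2 M"
  shows "1 / 2 * L2_adjoint M (\<lambda>f x. f x - f (par x)) (\<lambda>x. f x - f (par x)) x = lap f x"
proof -
  have d: "dn (\<lambda>x. f x - f (par x)) x = dn f x - f x"
    using dn_linear[of 1 f "-1" "up f" x] by (simp add: up_def[abs_def] dn_up[unfolded up_def[abs_def]])
  have "(\<lambda>x. f x - f (par x)) \<in> L2 M"
    using L2_diff(1)[OF f up_L2[OF f]] by (simp add: up_def[abs_def])
  then have "L2_adjoint M (\<lambda>f x. f x - f (par x)) (\<lambda>x. f x - f (par x)) x = f x - f (par x) - (dn f x - f x)"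
    by (simp only: adjoint_grad d)
  then show ?thesis unfolding lap_def up_def by (simp only:) (simp add: field_simps)
qed

end

section \<open>Polynomials of an operator\<close>

lemma poly_op_altdef:
  "degree p \<le> N \<Longrightarrow> poly_op p A f x = (\<Sum>k\<le>N. coeff p k * (A ^^ k) f x)"
  unfolding poly_op_def by (intro sum.mono_neutral_left) (auto simp: coeff_eq_0)

lemma poly_op_0 [simp]: "poly_op 0 A f x = 0" by (simp add: poly_op_def)

lemma poly_op_pCons: "poly_op (pCons a p) A f x = a * f x + poly_op p A (A f) x"
proof -
  have "poly_op (pCons a p) A f x = (\<Sum>k\<le>Suc (degree p). coeff (pCons a p) k * (A ^^ k) f x)"
    by (rule poly_op_altdef) (simp add: degree_pCons_le)
  then show ?thesis unfolding poly_op_def sum.atMost_Suc_shift by (simp add: funpow_swap1)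
qed

lemma poly_op_add: "poly_op (p + r) A f x = poly_op p A f x + poly_op r A f x"
proof -
  define N where "N = max (degree p) (degree r)"
  have "degree (p + r) \<le> N" "degree p \<le> N" "degree r \<le> N" by (auto simp: N_def degree_add_le)
  then show ?thesis by (simp add: poly_op_altdef[of _ N] sum.distrib distrib_right)
qed

lemma poly_op_smult: "poly_op (smult a p) A f x = a * poly_op p A f x"
  using degree_smult_le[of a p]
  by (simp add: poly_op_altdef[of "smult a p" "degree p"] poly_op_def sum_distrib_left mult.assoc)

lemma poly_op_diff: "poly_op (p - r) A f x = poly_op p A f x - poly_op r A f x"
  using poly_op_add[of p "- r" A f x] poly_op_smult[of "-1" r A f x] by simp

context flow_tree
begin

lemma poly_op_L2: "f \<in> L2 M \<Longrightarrow> poly_op p lap f \<in> L2 M"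
proof -
  assume f: "f \<in> L2 M"
  have "(lap ^^ k) f \<in> L2 M" for k by (induction k) (simp_all add: f lap_L2)
  then have "(\<lambda>x. \<Sum>k\<le>degree p. coeff p k * (lap ^^ k) f x) \<in> L2 M"
    by (intro L2_sum[THEN conjunct1] L2_scale)
  then show ?thesis by (simp add: poly_op_def[abs_def])
qed

lemma lap_poly_op: "lap (poly_op p lap f) = poly_op p lap (lap f)"
  by (rule ext) (simp add: poly_op_def[abs_def] lap_sum funpow_swap1)

lemma poly_op_mult: "poly_op (p * r) lap f = poly_op p lap (poly_op r lap f)"
proof (induction p arbitrary: f)
  case 0
  then show ?case by (simp add: fun_eq_iff)
next
  case (pCons a p)
  show ?case
    by (rule ext) (simp add: mult_pCons_left poly_op_add poly_op_smult poly_op_pCons pCons.IH lap_poly_op)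
qed

lemma hip_poly_op:
  assumes "f \<in> L2 M" "g \<in> L2 M"
  shows "hip (poly_op p lap f) g = hip f (poly_op (map_poly cnj p) lap g)"
  using assms
proof (induction p arbitrary: f g)
  case 0
  have "poly_op 0 lap f = (\<lambda>x. 0 * f x)" "poly_op 0 lap g = (\<lambda>x. 0 * g x)" for f g
    by (simp_all add: fun_eq_iff)
  then show ?case by (simp only: map_poly_0 hip_scale_left hip_scale_right) simp
next
  case (pCons a p)
  have e: "poly_op (pCons b r) lap u = (\<lambda>x. b * u x + poly_op r lap (lap u) x)" for b r u
    by (simp add: fun_eq_iff poly_op_pCons)
  have m: "map_poly cnj (pCons a p) = pCons (cnj a) (map_poly cnj p)"
    using pCons.hyps by (simp add: map_poly_pCons)
  show ?case
    unfolding m e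
    using pCons
    by (simp add: hip_add_left hip_add_right hip_scale_left hip_scale_right L2_scale poly_op_L2 lap_L2
        lap_poly_op[symmetric] hip_lap)
qed

section \<open>Chebyshev polynomials of the Laplacian\<close>

definition cheb :: "nat \<Rightarrow> ('v \<Rightarrow> complex) \<Rightarrow> 'v \<Rightarrow> complex" where
  "cheb n f x = (\<Sum>i\<le>n. (up ^^ i) ((dn ^^ (n - i)) f) x)"

lemma funpow_up_linear: "(up ^^ i) (\<lambda>x. a * f x + b * g x) = (\<lambda>x. a * (up ^^ i) f x + b * (up ^^ i) g x)"
  by (induction i) (simp, simp, rule ext, rule up_linear)

lemma funpow_dn_linear: "(dn ^^ i) (\<lambda>x. a * f x + b * g x) = (\<lambda>x. a * (dn ^^ i) f x + b * (dn ^^ i) g x)"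
  by (induction i) (simp, simp, rule ext, rule dn_linear)

lemma cheb_linear: "cheb n (\<lambda>x. a * f x + b * g x) x = a * cheb n f x + b * cheb n g x"
  unfolding cheb_def funpow_dn_linear funpow_up_linear by (simp add: sum.distrib sum_distrib_left)

lemma cheb_0 [simp]: "cheb 0 f = f"
  by (simp add: cheb_def fun_eq_iff)

text \<open>In every summand containing a \<open>dn\<close> the new \<open>up\<close> is cancelled
  by it; only the pure power of \<open>up\<close> survives.\<close>

lemma cheb_up: "cheb n (up f) x = (if n = 0 then 0 else cheb (n - 1) f x) + (up ^^ Suc n) f x"
proof (cases n)
  case 0
  then show ?thesis by (simp add: cheb_def)
next
  case (Suc k)
  have "cheb n (up f) x = (\<Sum>i\<le>k. (up ^^ i) ((dn ^^ (Suc k - i)) (up f)) x) + (up ^^ Suc k) (up f) x"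
    by (simp add: cheb_def Suc)
  also have "(\<Sum>i\<le>k. (up ^^ i) ((dn ^^ (Suc k - i)) (up f)) x) = cheb k f x"
    unfolding cheb_def by (intro sum.cong refl) (simp add: Suc_diff_le funpow_swap1)
  finally show ?thesis using Suc by (simp add: funpow_swap1)
qed

lemma cheb_dn: "cheb n (dn f) x = cheb (Suc n) f x - (up ^^ Suc n) f x"
proof -
  have "cheb n (dn f) x = (\<Sum>i\<le>n. (up ^^ i) ((dn ^^ (Suc n - i)) f) x)"
    unfolding cheb_def by (intro sum.cong refl) (simp add: Suc_diff_le funpow_swap1)
  then show ?thesis by (simp add: cheb_def)
qed

text \<open>The terms \<open>(up ^^ Suc n) f\<close> from \<open>cheb_up\<close> and
  \<open>cheb_dn\<close> have opposite signs and cancel, which leaves the Chebyshev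
  recurrence.\<close>

lemma cheb_lap:
  "cheb n (lap f) x = cheb n f x - (cheb (Suc n) f x + (if n = 0 then 0 else cheb (n - 1) f x)) / 2"
proof -
  have e: "lap f = (\<lambda>x. 1 * f x + (-1/2) * (1 * up f x + 1 * dn f x))"
    by (simp add: lap_def fun_eq_iff)
  show ?thesis
    unfolding e cheb_linear cheb_up cheb_dn by simp
qed

text \<open>Multiplying p by the variable changes the coefficients and the operators by the same
  recurrence, so \<open>sum_sin_coef_pCons\<close> carries the induction.\<close>

lemma poly_op_cheb:
  "degree p \<le> N \<Longrightarrow> poly_op p lap f x = (\<Sum>n\<le>N. sin_coef (poly_fun p) n * cheb n f x)"
proof (induction p arbitrary: N f x)
  case 0
  then show ?case using sin_coef_const[of 0] by simp
next
  case (pCons a p)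
  have "degree p \<le> N" using pCons.prems by (cases "p = 0") auto
  from pCons.IH[OF this, of "lap f" x] show ?case
    unfolding poly_op_pCons sum_sin_coef_pCons[OF pCons.prems] cheb_lap by simp
qed

lemma funpow_up_L2: "f \<in> L2 M \<Longrightarrow> (up ^^ k) f \<in> L2 M \<and> nrm ((up ^^ k) f) = nrm f"
  by (induction k) (auto simp: up_L2 nrm_up)

lemma funpow_dn_L2: "f \<in> L2 M \<Longrightarrow> (dn ^^ k) f \<in> L2 M \<and> nrm ((dn ^^ k) f) \<le> nrm f"
  by (induction k) (auto simp: dn_L2 intro: order_trans[OF nrm_dn_le])

lemma cheb_L2:
  assumes f: "f \<in> L2 M" shows "cheb n f \<in> L2 M" "nrm (cheb n f) \<le> real (Suc n) * nrm f"
proof -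
  have 1: "(up ^^ i) ((dn ^^ k) f) \<in> L2 M \<and> nrm ((up ^^ i) ((dn ^^ k) f)) \<le> nrm f" for i k
    using funpow_up_L2[of "(dn ^^ k) f" i] funpow_dn_L2[OF f, of k] by auto
  have "cheb n f \<in> L2 M \<and> nrm (cheb n f) \<le> (\<Sum>i\<le>n. nrm ((up ^^ i) ((dn ^^ (n - i)) f)))"
    unfolding cheb_def[abs_def] using 1 by (intro L2_sum) blast
  moreover have "(\<Sum>i\<le>n. nrm ((up ^^ i) ((dn ^^ (n - i)) f))) \<le> (\<Sum>i\<le>n. nrm f)"
    using 1 by (intro sum_mono) blast
  ultimately show "cheb n f \<in> L2 M" "nrm (cheb n f) \<le> real (Suc n) * nrm f" by auto
qed

text \<open>At most N + 1 terms, each with a coefficient of size 2 R and an operator norm of at most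
  N + 1. What matters is that the loss is polynomial in the degree.\<close>

lemma nrm_poly_op_crude:
  assumes f: "f \<in> L2 M" and R: "\<And>x. x \<in> {0..2} \<Longrightarrow> cmod (poly_fun p x) \<le> R" and N: "degree p \<le> N"
  shows "nrm (poly_op p lap f) \<le> 2 * R * (real N + 1)\<^sup>2 * nrm f"
proof -
  have "poly_op p lap f = (\<lambda>x. \<Sum>n\<le>N. sin_coef (poly_fun p) n * cheb n f x)"
    using poly_op_cheb[OF N] by blast
  then have "nrm (poly_op p lap f) \<le> (\<Sum>n\<le>N. nrm (\<lambda>x. sin_coef (poly_fun p) n * cheb n f x))"
    using L2_sum[of "{..N}" "\<lambda>n x. sin_coef (poly_fun p) n * cheb n f x"] by (simp add: L2_scale cheb_L2 f)
  also have "\<dots> \<le> (\<Sum>n\<le>N. (2 * R) * ((real N + 1) * nrm f))"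
  proof (rule sum_mono)
    fix n assume n: "n \<in> {..N}"
    have "nrm (\<lambda>x. sin_coef (poly_fun p) n * cheb n f x) = cmod (sin_coef (poly_fun p) n) * nrm (cheb n f)"
      by (rule nrm_scale[OF cheb_L2(1)[OF f]])
    also have "\<dots> \<le> (2 * R) * ((real N + 1) * nrm f)"
    proof (intro mult_mono)
      show "cmod (sin_coef (poly_fun p) n) \<le> 2 * R"
        by (rule sin_coef_bound[OF continuous_on_poly_fun]) (rule R)
      show "nrm (cheb n f) \<le> (real N + 1) * nrm f"
        using cheb_L2(2)[OF f, of n] n mult_right_mono[of "real (Suc n)" "real N + 1" "nrm f"] by fastforce
      have "0 \<le> cmod (poly_fun p 0)" by simp
      also have "\<dots> \<le> R" by (rule R) simp
      finally show "0 \<le> 2 * R" by simp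
    qed simp
    finally show "nrm (\<lambda>x. sin_coef (poly_fun p) n * cheb n f x) \<le> (2 * R) * ((real N + 1) * nrm f)" .
  qed
  also have "\<dots> = 2 * R * (real N + 1)\<^sup>2 * nrm f" by (simp add: power2_eq_square algebra_simps)
  finally show ?thesis .
qed

text \<open>If R < b, dividing by the power of b gives 1 <= 2 (n d + 1)^2 y^n with y = R / b < 1
  along n = 2^k, and the right side tends to 0. Exponents are powers of 2 because the operator
  inequality is iterated by squaring.\<close>

lemma le_of_power_le_poly:
  fixes b R :: real
  assumes "b \<ge> 0" "R \<ge> 0" and le: "\<And>k. b ^ (2 ^ k) \<le> 2 * (real (2 ^ k * d) + 1)\<^sup>2 * R ^ (2 ^ k)"
  shows "b \<le> R"
proof (rule ccontr)
  assume "\<not> b \<le> R"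
  then have bR: "R < b" "b > 0" using assms by auto
  define y where "y = R / b"
  have y: "0 \<le> y" "y < 1" using bR assms by (auto simp: y_def)
  have "(\<lambda>n. 2 * (real (n * d) + 1)\<^sup>2 * y ^ n) \<longlonglongrightarrow> 0"
  proof (cases "y = 0")
    case True
    then have "eventually (\<lambda>n. 2 * (real (n * d) + 1)\<^sup>2 * y ^ n = 0) sequentially"
      by (intro eventually_sequentiallyI[of 1]) auto
    then show ?thesis by (rule tendsto_eventually)
  next
    case False
    then have "y > 0" using y by simp
    have "(\<lambda>n. 2 * (real n * D + 1)\<^sup>2 * y ^ n) \<longlonglongrightarrow> 0" for D :: real
    proof -
      \<comment> \<open>Splitting y^n as the square of (sqrt y)^n lets each linear factor absorb one
        decaying factor.\<close>
      have "(\<lambda>n. 2 * (D * (real n * sqrt y ^ n) + sqrt y ^ n)\<^sup>2) \<longlonglongrightarrow> 2 * (D * 0 + 0)\<^sup>2"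
        using y by (intro tendsto_intros powser_times_n_limit_0 LIMSEQ_power_zero) auto
      moreover have "(D * (real n * sqrt y ^ n) + sqrt y ^ n)\<^sup>2 = (real n * D + 1)\<^sup>2 * y ^ n" for n
      proof -
        have "D * (real n * sqrt y ^ n) + sqrt y ^ n = (real n * D + 1) * sqrt y ^ n" by (simp add: algebra_simps)
        moreover have "(sqrt y ^ n)\<^sup>2 = y ^ n"
          using y by (simp add: power_mult[symmetric] mult.commute[of n]) (simp add: power_mult)
        ultimately show ?thesis by (simp add: power_mult_distrib)
      qed
      ultimately show ?thesis by (simp add: mult.assoc)
    qed
    from this[of "real d"] show ?thesis by simp
  qed
  moreover have "filterlim (\<lambda>k. 2 ^ k :: nat) at_top sequentially"
    by (rule filterlim_subseq) (simp add: strict_mono_def)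
  ultimately have lim: "(\<lambda>k. 2 * (real (2 ^ k * d) + 1)\<^sup>2 * y ^ (2 ^ k)) \<longlonglongrightarrow> 0"
    by (rule filterlim_compose)
  have "1 \<le> 2 * (real (2 ^ k * d) + 1)\<^sup>2 * y ^ (2 ^ k)" for k
    using le[of k] bR by (simp add: y_def power_divide pos_le_divide_eq)
  then have "(1::real) \<le> 0" by (intro LIMSEQ_le_const[OF lim]) auto
  then show False by simp
qed

text \<open>
  The crude bound has a polynomial loss in the degree, which is removed by applying it to the powers
  of the positive polynomial \<open>cnj p * p\<close>.
\<close>
lemma nrm_poly_op:
  assumes f: "f \<in> L2 M" and R: "\<And>x. x \<in> {0..2} \<Longrightarrow> cmod (poly_fun p x) \<le> R"
  shows "nrm (poly_op p lap f) \<le> R * nrm f"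
proof (cases "nrm f = 0")
  case True
  then show ?thesis using nrm_poly_op_crude[OF f R order_refl] by simp
next
  case False
  then have nf: "nrm f > 0" using nrm_nonneg[of f] by linarith
  have "0 \<le> cmod (poly_fun p 0)" by simp
  also have "\<dots> \<le> R" by (rule R) simp
  finally have R0: "R \<ge> 0" .
  \<comment> \<open>For self-adjoint \<open>lap\<close>, r(lap) is the adjoint of p(lap) composed
    with p(lap), and the powers of \<open>r\<close> are again self-adjoint.\<close>
  define r where "r = map_poly cnj p * p"
  have r: "cmod (poly_fun r x) \<le> R\<^sup>2" if "x \<in> {0..2}" for x
    using R[OF that] by (simp add: r_def norm_mult power2_eq_square mult_mono')
  have pc: "map_poly cnj (map_poly cnj p) = p" for p :: "complex poly"
    by (simp add: map_poly_map_poly o_def)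
  have rc: "map_poly cnj r = r"
  proof -
    have "poly (map_poly cnj r) x = poly r x" for x
      by (simp add: r_def mult.commute)
    then show ?thesis by (simp add: poly_eq_poly_eq_iff[symmetric] fun_eq_iff)
  qed
  have rcp: "map_poly cnj (r ^ n) = r ^ n" for n
  proof -
    have "poly (map_poly cnj (r ^ n)) x = poly (r ^ n) x" for x
      using arg_cong[OF rc, of "\<lambda>r. poly r x"] by (simp add: complex_cnj_power[symmetric])
    then show ?thesis by (simp add: poly_eq_poly_eq_iff[symmetric] fun_eq_iff)
  qed
  define a where "a n = nrm (poly_op (r ^ n) lap f)" for n
  \<comment> \<open>Moving one factor r^n across the inner product and applying Cauchy-Schwarz;
    iterated, this compares the 2^k-th power of \<open>b 1\<close> with
    \<open>b (2 ^ k)\<close>.\<close>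
  have sq: "(a n)\<^sup>2 \<le> a (2 * n) * nrm f" for n
  proof -
    have "complex_of_real ((a n)\<^sup>2) = hip (poly_op (r ^ n) lap f) (poly_op (r ^ n) lap f)"
      unfolding a_def by (rule hip_self[symmetric, OF poly_op_L2[OF f]])
    also have "\<dots> = hip f (poly_op (r ^ (2 * n)) lap f)"
      by (subst hip_poly_op[OF f poly_op_L2[OF f]]) (simp add: rcp poly_op_mult[symmetric] power_add[symmetric] mult_2)
    finally have "(a n)\<^sup>2 = cmod (hip f (poly_op (r ^ (2 * n)) lap f))"
      by (metis norm_of_real abs_of_nonneg zero_le_power2)
    also have "\<dots> \<le> nrm f * a (2 * n)" unfolding a_def by (rule hip_summable(2)[OF f poly_op_L2[OF f]])
    finally show ?thesis by (simp add: mult.commute)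
  qed
  define b where "b n = a n / nrm f" for n
  have b0: "b n \<ge> 0" for n by (simp add: b_def a_def)
  have bsq: "(b n)\<^sup>2 \<le> b (2 * n)" for n
    using sq[of n] nf by (simp add: b_def power_divide power2_eq_square field_simps)
  have bpow: "b 1 ^ (2 ^ k) \<le> b (2 ^ k)" for k
  proof (induction k)
    case (Suc k)
    have "b 1 ^ (2 ^ Suc k) = (b 1 ^ (2 ^ k))\<^sup>2" by (simp add: power_mult[symmetric] mult.commute)
    also have "\<dots> \<le> (b (2 ^ k))\<^sup>2" using Suc b0 by (intro power_mono) auto
    also have "\<dots> \<le> b (2 ^ Suc k)" using bsq[of "2 ^ k"] by simp
    finally show ?case .
  qed simp
  have "b 1 \<le> R\<^sup>2"
  proof (rule le_of_power_le_poly[where d = "degree r"])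
    fix k :: nat
    have rk: "cmod (poly_fun (r ^ 2 ^ k) x) \<le> (R\<^sup>2) ^ (2 ^ k)" if "x \<in> {0..2}" for x
      using r[OF that] by (simp add: norm_power power_mono)
    have "a (2 ^ k) \<le> 2 * (R\<^sup>2) ^ (2 ^ k) * (real (2 ^ k * degree r) + 1)\<^sup>2 * nrm f"
      unfolding a_def by (rule nrm_poly_op_crude[OF f rk]) (auto simp: degree_power_le mult.commute)
    then have "b (2 ^ k) \<le> 2 * (real (2 ^ k * degree r) + 1)\<^sup>2 * (R\<^sup>2) ^ (2 ^ k)"
      using nf by (simp add: b_def field_simps)
    then show "b 1 ^ (2 ^ k) \<le> 2 * (real (2 ^ k * degree r) + 1)\<^sup>2 * (R\<^sup>2) ^ (2 ^ k)"
      using bpow[of k] by linarith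
  qed (use b0 in auto)
  then have a1: "a 1 \<le> R\<^sup>2 * nrm f" using nf by (simp add: b_def field_simps)
  have "complex_of_real ((nrm (poly_op p lap f))\<^sup>2) = hip (poly_op p lap f) (poly_op p lap f)"
    by (rule hip_self[symmetric, OF poly_op_L2[OF f]])
  also have "\<dots> = hip f (poly_op r lap f)"
    by (subst hip_poly_op[OF f poly_op_L2[OF f]]) (simp add: r_def poly_op_mult)
  finally have "(nrm (poly_op p lap f))\<^sup>2 = cmod (hip f (poly_op r lap f))"
    by (metis norm_of_real abs_of_nonneg zero_le_power2)
  also have "\<dots> \<le> nrm f * a 1" unfolding a_def power_one_right by (rule hip_summable(2)[OF f poly_op_L2[OF f]])
  also have "\<dots> \<le> nrm f * (R\<^sup>2 * nrm f)" using a1 by (rule mult_left_mono) simp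
  also have "\<dots> = (R * nrm f)\<^sup>2" by (simp add: power2_eq_square)
  finally show ?thesis by (rule power2_le_imp_le) (simp add: R0)
qed

end

section \<open>Spectrum and functional calculus\<close>

context flow_tree
begin

text \<open>\<open>flow_laplacian\<close> is described through an adjoint and is identified with
  \<open>lap\<close> on L2 only. Spectrum and functional calculus evaluate the operator only
  there.\<close>

lemma functional_calculus_cong:
  assumes A: "\<And>f. f \<in> L2 M \<Longrightarrow> A f = lap f" and f: "f \<in> L2 M"
  shows "functional_calculus M A F f = functional_calculus M lap F f"
proof -
  have pow: "(A ^^ k) f = (lap ^^ k) f \<and> (lap ^^ k) f \<in> L2 M" if "f \<in> L2 M" for f k
    by (induction k) (use that A lap_L2 in auto)
  then have P: "poly_op p A f = poly_op p lap f" for p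
    using f by (simp add: poly_op_def[abs_def])
  have "(L2_bounded M S \<and> (\<forall>f\<in>L2 M. S (\<lambda>x. A f x - z * f x) = f \<and> (\<lambda>x. A (S f) x - z * S f x) = f))
     \<longleftrightarrow> (L2_bounded M S \<and> (\<forall>f\<in>L2 M. S (\<lambda>x. lap f x - z * f x) = f \<and> (\<lambda>x. lap (S f) x - z * S f x) = f))" for S z
    using A by (auto simp: L2_bounded_def)
  then have S: "L2_spectrum M A = L2_spectrum M lap"
    unfolding L2_spectrum_def by simp
  show ?thesis
    unfolding functional_calculus_def S by (simp add: P)
qed

text \<open>The difference of the point masses at two siblings, which exist since q >= 2, is killed
  by \<open>dn\<close>. Its images under powers of \<open>up\<close> are orthogonal, and on their
  span \<open>lap\<close> acts as the discrete Laplacian of a half-line.\<close>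

lemma ex_wandering:
  obtains u where "u \<in> L2 M" "nrm u > 0" "dn u = (\<lambda>x. 0)"
proof -
  fix w :: 'v
  have "\<not> card {y. par y = w} \<le> Suc 0" using card_children[of w] q2 by simp
  then obtain a b where ab: "par a = w" "par b = w" "a \<noteq> b"
    using finite_children[of w] card_le_Suc0_iff_eq[of "{y. par y = w}"] by auto
  define u where "u = (\<lambda>x. 1 * pt a x + (-1) * pt b x)"
  have u: "u \<in> L2 M" unfolding u_def by (intro L2_add(1) L2_scale pt_L2)
  have "dn u = (\<lambda>x. 0)"
    unfolding u_def by (rule ext) (simp only: dn_linear dn_pt ab, simp)
  moreover have "nrm u \<noteq> 0"
  proof
    assume "nrm u = 0"
    then have "u a = 0" by (rule nrm_zero_imp[OF u])
    then show False using ab(3) by (simp add: u_def pt_def)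
  qed
  ultimately show thesis using that u nrm_nonneg[of u] by (metis less_eq_real_def)
qed

lemma hip_funpow_up: "f \<in> L2 M \<Longrightarrow> g \<in> L2 M \<Longrightarrow> hip ((up ^^ n) f) ((up ^^ n) g) = hip f g"
proof (induction n)
  case (Suc n)
  have "hip (up ((up ^^ n) f)) (up ((up ^^ n) g)) = hip ((up ^^ n) f) (dn (up ((up ^^ n) g)))"
    by (rule hip_up_left) (use Suc.prems funpow_up_L2 up_L2 in auto)
  then show ?case using Suc by simp
qed simp

lemma hip_wandering:
  assumes u: "u \<in> L2 M" "dn u = (\<lambda>x. 0)" and nk: "n < k"
  shows "hip ((up ^^ n) u) ((up ^^ k) u) = 0"
proof -
  define j where "j = k - n - 1"
  have k: "k = n + Suc j" using nk by (simp add: j_def)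
  have "hip ((up ^^ n) u) ((up ^^ k) u) = hip u ((up ^^ Suc j) u)"
    unfolding k funpow_add o_def by (rule hip_funpow_up) (use u(1) funpow_up_L2 in blast)+
  also have "\<dots> = hip (dn u) ((up ^^ j) u)"
    using hip_dn_left[of u "(up ^^ j) u"] u(1) funpow_up_L2 by simp
  also have "\<dots> = 0" using hip_scale_left[of 0 "dn u" "(up ^^ j) u"] by (simp add: u(2))
  finally show ?thesis .
qed

text \<open>Truncated sine waves along the half-line spanned by a wandering vector are approximate
  eigenvectors: the residual stays bounded while the norm tends to infinity, which excludes a
  bounded inverse.\<close>

lemma spectrum_ge:
  assumes th: "0 < th" "th < pi"
  shows "complex_of_real (1 - cos th) \<in> L2_spectrum M lap"
proof (rule ccontr)
  define r where "r = complex_of_real (1 - cos th)"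
  assume "complex_of_real (1 - cos th) \<notin> L2_spectrum M lap"
  then obtain S where S: "L2_bounded M S" "\<And>f. f \<in> L2 M \<Longrightarrow> S (\<lambda>x. lap f x - r * f x) = f"
    unfolding L2_spectrum_def r_def by blast
  then obtain B where B: "\<And>f. f \<in> L2 M \<Longrightarrow> nrm (S f) \<le> B * nrm f"
    unfolding L2_bounded_def by blast
  obtain u where u: "u \<in> L2 M" "nrm u > 0" "dn u = (\<lambda>x. 0)" by (rule ex_wandering)
  define w where "w n = (up ^^ n) u" for n
  have w: "w n \<in> L2 M" "nrm (w n) = nrm u" for n using funpow_up_L2[OF u(1), of n] by (auto simp: w_def)
  define s where "s n = complex_of_real (sin (real n * th))" for n
  define f where "f n x = (\<Sum>k<n. s (Suc k) * w k x)" for n x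
  have fS: "f (Suc n) = (\<lambda>x. f n x + s (Suc n) * w n x)" for n by (simp add: f_def fun_eq_iff)
  have f: "f n \<in> L2 M" for n
    unfolding f_def[abs_def] by (intro L2_sum[THEN conjunct1] L2_scale w)
  have two: "s (Suc (Suc n)) + s n = 2 * (s (Suc n) * of_real (cos th))" for n
    unfolding s_def by (rule sin_Suc_Suc)
  have lapw: "lap (w n) x = w n x - (w (Suc n) x + (if n = 0 then 0 else w (n - 1) x)) / 2" for n x
    by (cases n) (simp_all add: lap_def w_def u)
  \<comment> \<open>The sines solve the half-line recurrence and vanish at index 0, so only the two
    terms at the cut remain.\<close>
  have res: "lap (f n) x - r * f n x
      = s (Suc n) / 2 * (if n = 0 then 0 else w (n - 1) x) - s n / 2 * w n x" for n x
  proof (induction n)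
    case 0
    have "lap (\<lambda>x. 0 :: complex) x = 0" using lap_scale[of 0 "\<lambda>x. 0" x] by simp
    then show ?case by (simp add: f_def[abs_def] s_def)
  next
    case (Suc n)
    define W where "W = (if n = 0 then 0 else w (n - 1) x)"
    have "lap (f (Suc n)) x - r * f (Suc n) x = (lap (f n) x - r * f n x) + s (Suc n) * (lap (w n) x - r * w n x)"
      using lap_linear[of 1 "f n" "s (Suc n)" "w n" x] unfolding fS by (simp add: algebra_simps)
    also have "lap (w n) x - r * w n x = of_real (cos th) * w n x - (w (Suc n) x + W) / 2"
      unfolding lapw r_def W_def[symmetric] by (simp add: algebra_simps)
    also have "s (Suc n) * (of_real (cos th) * w n x - (w (Suc n) x + W) / 2)
        = (s (Suc (Suc n)) + s n) / 2 * w n x - s (Suc n) * ((w (Suc n) x + W) / 2)"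
      unfolding two by (simp add: algebra_simps)
    also have "(lap (f n) x - r * f n x) + \<dots> = s (Suc (Suc n)) / 2 * w n x - s (Suc n) / 2 * w (Suc n) x"
      unfolding Suc W_def[symmetric] by (simp add: field_simps)
    finally show ?case by simp
  qed
  have g: "nrm (\<lambda>x. lap (f n) x - r * f n x) \<le> nrm u" for n
  proof -
    have s1: "cmod (s k) \<le> 1" for k by (simp add: s_def)
    have e: "(\<lambda>x. lap (f n) x - r * f n x) = (\<lambda>x. (if n = 0 then 0 else s (Suc n) / 2) * w (n - 1) x - (s n / 2) * w n x)"
      by (rule ext) (simp add: res)
    have "nrm (\<lambda>x. lap (f n) x - r * f n x) \<le> cmod (if n = 0 then 0 else s (Suc n) / 2) * nrm u + cmod (s n / 2) * nrm u"
      unfolding e by (rule order_trans[OF L2_diff(2)[OF L2_scale[OF w(1)] L2_scale[OF w(1)]]])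
        (simp only: nrm_scale[OF w(1)] w(2) order_refl)
    also have "\<dots> \<le> 1/2 * nrm u + 1/2 * nrm u"
      by (intro add_mono mult_right_mono) (use s1 in \<open>auto simp: norm_divide\<close>)
    finally show ?thesis by simp
  qed
  have lr: "(\<lambda>x. lap (f n) x - r * f n x) \<in> L2 M" for n
    by (intro L2_diff(1) lap_L2 L2_scale f)
  \<comment> \<open>A bounded inverse would recover \<open>f n\<close> from a residual of norm at
    most that of \<open>u\<close>.\<close>
  have fb: "nrm (f n) \<le> \<bar>B\<bar> * nrm u" for n
  proof -
    have "nrm (f n) \<le> B * nrm (\<lambda>x. lap (f n) x - r * f n x)"
      using B[OF lr[of n]] S(2)[OF f[of n]] by simp
    also have "\<dots> \<le> \<bar>B\<bar> * nrm u" by (intro mult_mono g) auto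
    finally show ?thesis .
  qed
  have fn: "(nrm (f n))\<^sup>2 = (\<Sum>k<n. (sin (real (Suc k) * th))\<^sup>2) * (nrm u)\<^sup>2" for n
  proof (induction n)
    case 0
    then show ?case by (simp add: f_def[abs_def])
  next
    case (Suc n)
    have "hip (f k) (w n) = 0" if "k \<le> n" for k
      using that
    proof (induction k)
      case 0
      then show ?case using hip_scale_left[of 0 "f 0" "w n"] by (simp add: f_def[abs_def])
    next
      case (Suc k)
      have "hip (w k) (w n) = 0" unfolding w_def by (rule hip_wandering[OF u(1,3)]) (use Suc in auto)
      then show ?case unfolding fS using Suc by (simp add: hip_add_left hip_scale_left L2_scale f w)
    qed
    then have "hip (f n) (\<lambda>x. s (Suc n) * w n x) = 0" by (simp add: hip_scale_right)
    then show ?case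
      unfolding fS using Suc
      by (subst nrm_add_orthogonal[OF f L2_scale[OF w(1)]])
        (simp_all add: nrm_scale w power_mult_distrib distrib_right s_def del: of_nat_Suc)
  qed
  \<comment> \<open>Consecutive sines cannot both be small, as sin th is the sine of the difference
    of their arguments; hence each pair contributes at least (sin th)^2 / 2.\<close>
  have big: "(\<Sum>k<2 * n. (sin (real (Suc k) * th))\<^sup>2) \<ge> real n * ((sin th)\<^sup>2 / 2)" for n
  proof (induction n)
    case (Suc n)
    define a b where "a = real (Suc (2 * n)) * th" and "b = real (Suc (Suc (2 * n))) * th"
    have "th = b - a" by (simp add: a_def b_def algebra_simps)
    then have "sin th = sin b * cos a - cos b * sin a" by (simp add: sin_diff)
    also have "\<bar>\<dots>\<bar> \<le> \<bar>sin b\<bar> * \<bar>cos a\<bar> + \<bar>cos b\<bar> * \<bar>sin a\<bar>" by (metis abs_mult abs_triangle_ineq4)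
    also have "\<dots> \<le> \<bar>sin b\<bar> * 1 + 1 * \<bar>sin a\<bar>" by (intro add_mono mult_mono) auto
    finally have "(sin th)\<^sup>2 \<le> (\<bar>sin b\<bar> + \<bar>sin a\<bar>)\<^sup>2" using power_mono[of "\<bar>sin th\<bar>" "\<bar>sin b\<bar> + \<bar>sin a\<bar>" 2] by simp
    also have "\<dots> \<le> 2 * (sin a)\<^sup>2 + 2 * (sin b)\<^sup>2"
      using zero_le_power2[of "\<bar>sin b\<bar> - \<bar>sin a\<bar>"] by (simp add: power2_sum power2_diff)
    finally have "(sin th)\<^sup>2 / 2 \<le> (sin a)\<^sup>2 + (sin b)\<^sup>2" by simp
    then show ?case using Suc by (simp add: a_def b_def distrib_right del: of_nat_Suc) (simp add: algebra_simps)
  qed simp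
  have "real n * ((sin th)\<^sup>2 / 2) \<le> \<bar>B\<bar>\<^sup>2" for n
  proof -
    have "real n * ((sin th)\<^sup>2 / 2) * (nrm u)\<^sup>2 \<le> (nrm (f (2 * n)))\<^sup>2"
      unfolding fn using big[of n] by (rule mult_right_mono) simp
    also have "\<dots> \<le> (\<bar>B\<bar> * nrm u)\<^sup>2" using fb by (intro power_mono) auto
    finally show ?thesis using u(2) by (simp add: power_mult_distrib)
  qed
  moreover have "(sin th)\<^sup>2 / 2 > 0" using sin_gt_zero[OF th] by simp
  ultimately show False using reals_Archimedean3[of "(sin th)\<^sup>2 / 2"] by (metis not_le)
qed

text \<open>Neumann series, convergent because \<open>lap\<close> has norm at most 2. This crude
  bound serves to place the spectrum in a compact interval.\<close>

lemma spectrum_le: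
  assumes z: "z \<in> L2_spectrum M lap" shows "cmod z \<le> 2"
proof (rule ccontr)
  assume "\<not> cmod z \<le> 2"
  then have z2: "cmod z > 2" by simp
  then have z0: "z \<noteq> 0" by auto
  have pw: "(lap ^^ k) f \<in> L2 M" "nrm ((lap ^^ k) f) \<le> 2 ^ k * nrm f" if f: "f \<in> L2 M" for f k
  proof -
    have "(lap ^^ k) f \<in> L2 M \<and> nrm ((lap ^^ k) f) \<le> 2 ^ k * nrm f"
    proof (induction k)
      case (Suc k)
      then show ?case using nrm_lap[of "(lap ^^ k) f"] lap_L2 by auto
    qed (use f in auto)
    then show "(lap ^^ k) f \<in> L2 M" "nrm ((lap ^^ k) f) \<le> 2 ^ k * nrm f" by auto
  qed
  define T where "T f k x = - (1 / z ^ Suc k) * (lap ^^ k) f x" for f k x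
  define P where "P f n x = (\<Sum>k<n. T f k x)" for f n x
  \<comment> \<open>The series is summed at each vertex, where it converges by the bound on
    evaluations; its norm is then controlled through the partial sums \<open>P\<close>.\<close>
  define S where "S f x = (\<Sum>k. T f k x)" for f x
  define c where "c = 2 / cmod z"
  have c: "0 \<le> c" "c < 1" using z2 z0 by (auto simp: c_def pos_divide_less_eq)
  have TL: "T f k \<in> L2 M" "nrm (T f k) \<le> c ^ k * nrm f" if f: "f \<in> L2 M" for f k
  proof -
    show "T f k \<in> L2 M" unfolding T_def[abs_def] by (intro L2_scale pw f)
    have "nrm (T f k) = cmod (1 / z ^ Suc k) * nrm ((lap ^^ k) f)"
      unfolding T_def[abs_def] by (subst nrm_scale[OF pw(1)[OF f]]) simp
    also have "\<dots> \<le> 1 / cmod z ^ k * (2 ^ k * nrm f)"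
    proof (rule mult_mono)
      have "1 * cmod z ^ k \<le> cmod z ^ Suc k" using z2 unfolding power_Suc by (intro mult_right_mono) auto
      then show "cmod (1 / z ^ Suc k) \<le> 1 / cmod z ^ k"
        using z0 by (simp add: norm_divide norm_power norm_mult frac_le)
    qed (use pw[OF f] in auto)
    also have "\<dots> = c ^ k * nrm f" by (simp add: c_def power_divide)
    finally show "nrm (T f k) \<le> c ^ k * nrm f" .
  qed
  have PS: "(\<lambda>n. P f n x) \<longlonglongrightarrow> S f x" if f: "f \<in> L2 M" for f x
  proof -
    have "summable (\<lambda>k. T f k x)"
    proof (rule summable_comparison_test')
      show "summable (\<lambda>k. c ^ k * (nrm f / sqrt (m x)))" using c by (intro summable_mult2 summable_geometric) auto
      fix k :: nat
      have "cmod (T f k x) \<le> nrm (T f k) / sqrt (m x)" by (rule pointwise_le_nrm[OF TL(1)[OF f]])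
      also have "\<dots> \<le> c ^ k * nrm f / sqrt (m x)" by (intro divide_right_mono TL f) simp
      finally show "norm (T f k x) \<le> c ^ k * (nrm f / sqrt (m x))" by simp
    qed
    then show ?thesis unfolding P_def S_def by (rule summable_LIMSEQ)
  qed
  have PL: "P f n \<in> L2 M" "nrm (P f n) \<le> 1 / (1 - c) * nrm f" if f: "f \<in> L2 M" for f n
  proof -
    have 1: "P f n \<in> L2 M \<and> nrm (P f n) \<le> (\<Sum>k<n. nrm (T f k))"
      unfolding P_def[abs_def] by (rule L2_sum) (rule TL(1)[OF f])
    have "(\<Sum>k<n. nrm (T f k)) \<le> (\<Sum>k<n. c ^ k * nrm f)" by (intro sum_mono TL f)
    also have "\<dots> = (\<Sum>k<n. c ^ k) * nrm f" by (simp add: sum_distrib_right)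
    also have "\<dots> \<le> 1 / (1 - c) * nrm f"
    proof (rule mult_right_mono)
      have "(\<Sum>k<n. c ^ k) \<le> (\<Sum>k. c ^ k)" using c by (intro sum_le_suminf summable_geometric) auto
      then show "(\<Sum>k<n. c ^ k) \<le> 1 / (1 - c)" using c by (simp add: suminf_geometric)
    qed simp
    finally show "P f n \<in> L2 M" "nrm (P f n) \<le> 1 / (1 - c) * nrm f" using 1 by auto
  qed
  have SL: "S f \<in> L2 M" "nrm (S f) \<le> 1 / (1 - c) * nrm f" if f: "f \<in> L2 M" for f
    using L2_pointwise_limit[of "P f", OF PL(1)[OF f] PL(2)[OF f] PS[OF f]] by auto
  have tail: "(\<lambda>n. (1 / z ^ n) * (lap ^^ n) f x) \<longlonglongrightarrow> 0" if f: "f \<in> L2 M" for f x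
  proof (rule Lim_null_comparison)
    show "(\<lambda>n. c ^ n * (nrm f / sqrt (m x))) \<longlonglongrightarrow> 0"
      using c by (intro tendsto_mult_left_zero LIMSEQ_power_zero) auto
    have "cmod ((1 / z ^ n) * (lap ^^ n) f x) \<le> c ^ n * (nrm f / sqrt (m x))" for n
    proof -
      have "cmod ((1 / z ^ n) * (lap ^^ n) f x) = 1 / cmod z ^ n * cmod ((lap ^^ n) f x)"
        by (simp add: norm_mult norm_divide norm_power)
      also have "\<dots> \<le> 1 / cmod z ^ n * (2 ^ n * nrm f / sqrt (m x))"
        by (intro mult_left_mono order_trans[OF pointwise_le_nrm[OF pw(1)[OF f]]] divide_right_mono pw(2) f) auto
      also have "\<dots> = c ^ n * (nrm f / sqrt (m x))" by (simp add: c_def power_divide)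
      finally show ?thesis .
    qed
    then show "\<forall>\<^sub>F n in sequentially. norm ((1 / z ^ n) * (lap ^^ n) f x) \<le> c ^ n * (nrm f / sqrt (m x))"
      by simp
  qed
  have tele: "(\<Sum>k<n. - (1 / z ^ Suc k) * ((lap ^^ Suc k) f x - z * (lap ^^ k) f x)) = f x - (1 / z ^ n) * (lap ^^ n) f x" for f n x
  proof (induction n)
    case (Suc n)
    show ?case unfolding sum.lessThan_Suc Suc using z0 by (simp add: field_simps)
  qed simp
  have limf: "(\<lambda>n. f x - (1 / z ^ n) * (lap ^^ n) f x) \<longlonglongrightarrow> f x" if f: "f \<in> L2 M" for f x
    using tendsto_diff[OF tendsto_const tail[OF f], of "f x"] by simp
  have "S (\<lambda>x. lap f x - z * f x) = f \<and> (\<lambda>x. lap (S f) x - z * S f x) = f" if f: "f \<in> L2 M" for f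
  proof (intro conjI ext)
    fix x
    have g: "(\<lambda>x. lap f x - z * f x) \<in> L2 M" by (intro L2_diff(1) lap_L2 L2_scale f)
    have pl: "(lap ^^ k) (\<lambda>x. lap f x - z * f x) x = (lap ^^ Suc k) f x - z * (lap ^^ k) f x" for k x
    proof (induction k arbitrary: x)
      case (Suc k)
      have "(lap ^^ k) (\<lambda>x. lap f x - z * f x) = (\<lambda>x. 1 * (lap ^^ Suc k) f x + (- z) * (lap ^^ k) f x)"
        using Suc by (simp add: fun_eq_iff)
      then have "(lap ^^ Suc k) (\<lambda>x. lap f x - z * f x) x = lap (\<lambda>x. 1 * (lap ^^ Suc k) f x + (- z) * (lap ^^ k) f x) x"
        by simp
      then show ?case unfolding lap_linear by simp
    qed simp
    have "P (\<lambda>x. lap f x - z * f x) n x = f x - (1 / z ^ n) * (lap ^^ n) f x" for n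
      unfolding P_def T_def pl by (rule tele)
    then show "S (\<lambda>x. lap f x - z * f x) x = f x"
      using PS[OF g, of x] limf[OF f, of x] by (simp add: LIMSEQ_unique)
    have "lap (P f n) x - z * P f n x = f x - (1 / z ^ n) * (lap ^^ n) f x" for n
    proof -
      have "lap (P f n) x = (\<Sum>k<n. - (1 / z ^ Suc k) * (lap ^^ Suc k) f x)"
        unfolding P_def[abs_def] T_def lap_sum by simp
      moreover have "z * P f n x = (\<Sum>k<n. - (1 / z ^ Suc k) * (z * (lap ^^ k) f x))"
        unfolding P_def T_def sum_distrib_left by (intro sum.cong refl) (simp only: mult_ac)
      ultimately show ?thesis
        unfolding tele[symmetric] right_diff_distrib sum_subtractf by simp
    qed
    \<comment> \<open>At a fixed vertex \<open>lap\<close> involves finitely many values, so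
      pointwise convergence passes through it.\<close>
    moreover have "(\<lambda>n. lap (P f n) x - z * P f n x) \<longlonglongrightarrow> lap (S f) x - z * S f x"
      unfolding lap_def up_def dn_def by (intro tendsto_intros PS f) (use q2 in auto)
    ultimately show "lap (S f) x - z * S f x = f x"
      using limf[OF f, of x] by (simp add: LIMSEQ_unique)
  qed
  moreover have "L2_bounded M S" unfolding L2_bounded_def using SL by blast
  ultimately show False using z unfolding L2_spectrum_def by blast
qed

end

text \<open>\<open>spectrum_ge\<close> reaches only the open interval, whereas
  \<open>nrm_poly_op\<close> asks for a bound on the closed one.\<close>

lemma continuous_bound_closure:
  fixes g :: "real \<Rightarrow> complex"
  assumes g: "continuous_on UNIV g" and b: "\<And>x. x \<in> {0<..<2} \<Longrightarrow> cmod (g x) \<le> e" and x: "x \<in> {0..2}"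
  shows "cmod (g x) \<le> e"
proof (rule continuous_le_on_closure[of "{0<..<2::real}" "\<lambda>x. cmod (g x)" x e])
  show "continuous_on (closure {0<..<2::real}) (\<lambda>x. cmod (g x))"
    by (intro continuous_intros continuous_on_subset[OF g]) auto
qed (use b x in auto)

context flow_tree
begin

section \<open>Existence of the functional calculus\<close>

definition rspec :: "real set" where "rspec = {r. complex_of_real r \<in> L2_spectrum M lap}"

lemma rspec_ge: "{0<..<2} \<subseteq> rspec"
proof
  fix r :: real assume r: "r \<in> {0<..<2}"
  define th where "th = arccos (1 - r)"
  have "0 < th" "th < pi" "cos th = 1 - r"
    unfolding th_def using r by (auto intro!: arccos_lt_bounded[THEN conjunct1] arccos_lt_bounded[THEN conjunct2])
  then show "r \<in> rspec" using spectrum_ge[of th] by (simp add: rspec_def)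
qed

lemma rspec_le: "rspec \<subseteq> {-2..2}"
  unfolding rspec_def using spectrum_le by force

text \<open>Stated for two sequences: with equal ones it gives the Cauchy property, with different
  ones the independence of the limit from the approximation.\<close>

lemma poly_op_uniform_close:
  assumes f: "f \<in> L2 M" and F: "continuous_on UNIV F" and e: "e > 0"
    and p: "uniform_limit rspec (\<lambda>n. poly_fun (p n)) F sequentially"
    and p': "uniform_limit rspec (\<lambda>n. poly_fun (p' n)) F sequentially"
  obtains k where "\<And>i j. i \<ge> k \<Longrightarrow> j \<ge> k \<Longrightarrow> nrm (\<lambda>x. poly_op (p i) lap f x - poly_op (p' j) lap f x) \<le> e"
proof -
  \<comment> \<open>The 1 avoids division by zero when f = 0.\<close>
  define X where "X = nrm f + 1"
  define d where "d = e / (2 * X)"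
  have nf: "X > 0" using nrm_nonneg[of f] unfolding X_def by linarith
  have d: "d > 0" using e nf by (simp add: d_def)
  obtain k where k: "\<And>n x. n \<ge> k \<Longrightarrow> x \<in> rspec \<Longrightarrow> cmod (poly_fun (p n) x - F x) < d"
    using uniform_limitD[OF p d] unfolding eventually_sequentially dist_norm by blast
  obtain k' where k': "\<And>n x. n \<ge> k' \<Longrightarrow> x \<in> rspec \<Longrightarrow> cmod (poly_fun (p' n) x - F x) < d"
    using uniform_limitD[OF p' d] unfolding eventually_sequentially dist_norm by blast
  show thesis
  proof (rule that[of "max k k'"])
    fix i j assume ij: "i \<ge> max k k'" "j \<ge> max k k'"
    have "cmod (poly_fun (p i - p' j) x) \<le> 2 * d" if "x \<in> {0..2}" for x
    proof (rule continuous_bound_closure[OF _ _ that])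
      show "continuous_on UNIV (poly_fun (p i - p' j))" by (rule continuous_on_poly_fun)
      fix x :: real assume "x \<in> {0<..<2}"
      then have x: "x \<in> rspec" using rspec_ge by blast
      have "poly_fun (p i - p' j) x = (poly_fun (p i) x - F x) - (poly_fun (p' j) x - F x)" by simp
      also have "cmod \<dots> \<le> cmod (poly_fun (p i) x - F x) + cmod (poly_fun (p' j) x - F x)"
        by (rule norm_triangle_ineq4)
      also have "\<dots> \<le> d + d"
      proof -
        have "i \<ge> k" "j \<ge> k'" using ij by auto
        from k[OF this(1) x] k'[OF this(2) x] show ?thesis by linarith
      qed
      finally show "cmod (poly_fun (p i - p' j) x) \<le> 2 * d" by simp
    qed
    from nrm_poly_op[OF f this]
    have "nrm (\<lambda>x. poly_op (p i) lap f x - poly_op (p' j) lap f x) \<le> 2 * d * nrm f"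
      by (simp add: poly_op_diff[abs_def])
    also have "\<dots> \<le> 2 * d * X" using d by (intro mult_left_mono) (auto simp: X_def)
    also have "\<dots> = e" using nf by (simp add: d_def)
    finally show "nrm (\<lambda>x. poly_op (p i) lap f x - poly_op (p' j) lap f x) \<le> e" .
  qed
qed

text \<open>Shows that the definite description is realised and returns it in the form used later:
  uniform convergence on [0,2] for the sine coefficients, pointwise convergence for the
  kernel.\<close>

lemma functional_calculus_approx:
  assumes f: "f \<in> L2 M" and F: "continuous_on UNIV F"
  obtains p where "uniform_limit {0..2} (\<lambda>n. poly_fun (p n)) F sequentially"
    "\<And>x. (\<lambda>n. poly_op (p n) lap f x) \<longlonglongrightarrow> functional_calculus M lap F f x"
proof -
  have "\<exists>p. \<forall>x\<in>{-2..2}. cmod (F x - poly_fun p x) < inverse (real (Suc n))" for n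
  proof (rule poly_fun_approx[OF continuous_on_subset[OF F], of "-2" 2 "inverse (real (Suc n))"])
    fix p assume "\<And>x. x \<in> {-2..2} \<Longrightarrow> cmod (F x - poly_fun p x) < inverse (real (Suc n))"
    then show ?thesis by blast
  qed auto
  then obtain p where p: "\<And>n x. x \<in> {-2..2} \<Longrightarrow> cmod (F x - poly_fun (p n) x) < inverse (real (Suc n))"
    by metis
  have u: "uniform_limit {-2..2} (\<lambda>n. poly_fun (p n)) F sequentially"
  proof (rule uniform_limitI)
    fix e :: real assume "e > 0"
    then obtain N where N: "inverse (real (Suc N)) < e" using reals_Archimedean by blast
    show "\<forall>\<^sub>F n in sequentially. \<forall>x\<in>{-2..2}. dist (poly_fun (p n) x) (F x) < e"
      unfolding eventually_sequentially
    proof (intro exI[of _ N] allI impI ballI)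
      fix n x assume "N \<le> n" "x \<in> {-2..2::real}"
      have "inverse (real (Suc n)) \<le> inverse (real (Suc N))" using \<open>N \<le> n\<close> by simp
      then show "dist (poly_fun (p n) x) (F x) < e"
        using p[OF \<open>x \<in> _\<close>, of n] N unfolding dist_norm norm_minus_commute[of _ "F x"] by linarith
    qed
  qed
  have us: "uniform_limit rspec (\<lambda>n. poly_fun (p n)) F sequentially"
    by (rule uniform_limit_on_subset[OF u rspec_le])
  have cau: "\<exists>k. \<forall>i\<ge>k. \<forall>j\<ge>k. nrm (\<lambda>x. poly_op (p i) lap f x - poly_op (p j) lap f x) \<le> e" if "e > 0" for e
    using poly_op_uniform_close[OF f F that us us] by metis
  obtain g where g: "g \<in> L2 M" "(\<lambda>n. nrm (\<lambda>x. poly_op (p n) lap f x - g x)) \<longlonglongrightarrow> 0"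
      "\<And>x. (\<lambda>n. poly_op (p n) lap f x) \<longlonglongrightarrow> g x"
    by (rule L2_complete[of "\<lambda>n. poly_op (p n) lap f", OF poly_op_L2[OF f] cau], assumption, rule that)
  let ?Q = "\<lambda>h. h \<in> L2 M \<and> (\<forall>p. uniform_limit rspec (\<lambda>n. poly_fun (p n)) F sequentially \<longrightarrow>
     (\<lambda>n. nrm (\<lambda>x. poly_op (p n) lap f x - h x)) \<longlonglongrightarrow> 0)"
  have Qg: "?Q g"
  proof (intro conjI allI impI g(1))
    fix p' assume p': "uniform_limit rspec (\<lambda>n. poly_fun (p' n)) F sequentially"
    have *: "(\<lambda>n. nrm (\<lambda>x. poly_op (p' n) lap f x - poly_op (p n) lap f x)) \<longlonglongrightarrow> 0"
    proof (rule LIMSEQ_I)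
      fix e :: real assume e: "e > 0"
      obtain k where "\<And>i j. i \<ge> k \<Longrightarrow> j \<ge> k \<Longrightarrow> nrm (\<lambda>x. poly_op (p' i) lap f x - poly_op (p j) lap f x) \<le> e / 2"
        using poly_op_uniform_close[OF f F _ p' us, of "e / 2"] e by auto
      then show "\<exists>no. \<forall>n\<ge>no. norm (nrm (\<lambda>x. poly_op (p' n) lap f x - poly_op (p n) lap f x) - 0) < e"
        using e by (intro exI[of _ k]) fastforce
    qed
    show "(\<lambda>n. nrm (\<lambda>x. poly_op (p' n) lap f x - g x)) \<longlonglongrightarrow> 0"
    proof (rule tendsto_sandwich[OF _ _ tendsto_const])
      show "(\<lambda>n. nrm (\<lambda>x. poly_op (p' n) lap f x - poly_op (p n) lap f x) + nrm (\<lambda>x. poly_op (p n) lap f x - g x)) \<longlonglongrightarrow> 0"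
        using tendsto_add[OF * g(2)] by simp
    qed (auto intro!: always_eventually nrm_triangle_diff poly_op_L2 f g)
  qed
  moreover have "h = g" if "?Q h" for h
  proof
    fix x
    have "(\<lambda>n. poly_op (p n) lap f x - h x) \<longlonglongrightarrow> 0"
    proof (rule Lim_null_comparison)
      have "cmod (poly_op (p n) lap f x - h x) \<le> nrm (\<lambda>x. poly_op (p n) lap f x - h x) / sqrt (m x)" for n
        by (rule pointwise_le_nrm[OF L2_diff(1)[OF poly_op_L2[OF f]]]) (use that in blast)
      then show "\<forall>\<^sub>F n in sequentially. norm (poly_op (p n) lap f x - h x) \<le> nrm (\<lambda>x. poly_op (p n) lap f x - h x) / sqrt (m x)"
        by simp
      show "(\<lambda>n. nrm (\<lambda>x. poly_op (p n) lap f x - h x) / sqrt (m x)) \<longlonglongrightarrow> 0"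
        using that us by (intro tendsto_divide_zero) blast
    qed
    then have "(\<lambda>n. poly_op (p n) lap f x) \<longlonglongrightarrow> h x" by (rule LIM_zero_cancel)
    then show "h x = g x" using g(3)[of x] by (rule LIMSEQ_unique)
  qed
  ultimately have "functional_calculus M lap F f = g"
    unfolding functional_calculus_def rspec_def[symmetric] by (intro the_equality) blast+
  then show thesis using that[of p] g(3) uniform_limit_on_subset[OF u, of "{0..2}"] by auto
qed

section \<open>The kernel of a function of the Laplacian\<close>

lemma par_pow_eq_level: "(par ^^ a) x = (par ^^ b) z \<Longrightarrow> lev x + int a = lev z + int b"
  using lev_par_pow[of a x] lev_par_pow[of b z] by simp

text \<open>
  For \<open>i, j \<ge> 1\<close> these are the points whose geodesic to \<open>z\<close> goes up \<open>i\<close> steps and then down \<open>j\<close>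
  steps; otherwise the truncated subtraction makes the set meaningless.
\<close>
definition meet :: "'v \<Rightarrow> nat \<Rightarrow> nat \<Rightarrow> 'v set" where
  "meet z i j = {x. (par ^^ i) x = (par ^^ j) z \<and> (par ^^ (i - 1)) x \<noteq> (par ^^ (j - 1)) z}"

text \<open>Levels fix a - b, and two coinciding ancestors stay equal further up. Hence the
  coincidences form one upward ray, starting at (i, j) because (i - 1, j - 1) is excluded.\<close>

lemma meet_pow_eq_iff:
  assumes x: "x \<in> meet z i j" and ij: "i \<ge> 1" "j \<ge> 1"
  shows "(par ^^ a) x = (par ^^ b) z \<longleftrightarrow> (\<exists>k. a = i + k \<and> b = j + k)"
proof
  assume eq: "(par ^^ a) x = (par ^^ b) z"
  have "lev x + int i = lev z + int j" using x by (intro par_pow_eq_level) (simp add: meet_def)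
  with par_pow_eq_level[OF eq] have lv: "int a - int b = int i - int j" by linarith
  have "a \<ge> i"
  proof (rule ccontr)
    assume "\<not> a \<ge> i"
    \<comment> \<open>A coincidence below (i, j), pushed up k steps, would land on the excluded pair
      (i - 1, j - 1).\<close>
    define k where "k = i - 1 - a"
    have k: "i - 1 = k + a" "j - 1 = k + b" using \<open>\<not> a \<ge> i\<close> lv ij by (auto simp: k_def)
    have "(par ^^ (i - 1)) x = (par ^^ (j - 1)) z"
      unfolding k funpow_add o_def eq ..
    then show False using x by (simp add: meet_def)
  qed
  then show "\<exists>k. a = i + k \<and> b = j + k" using lv by (intro exI[of _ "a - i"]) auto
next
  assume "\<exists>k. a = i + k \<and> b = j + k"
  then obtain k where k: "a = k + i" "b = k + j" by (metis add.commute)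
  show "(par ^^ a) x = (par ^^ b) z" unfolding k funpow_add o_def using x by (simp add: meet_def)
qed

lemma meet_disjoint:
  assumes "x \<in> meet z i j" "x \<in> meet z i' j'" "i \<ge> 1" "j \<ge> 1" "i' \<ge> 1" "j' \<ge> 1"
  shows "i = i' \<and> j = j'"
proof -
  have "(par ^^ i') x = (par ^^ j') z" "(par ^^ i) x = (par ^^ j) z" using assms(1,2) by (auto simp: meet_def)
  then have "\<exists>k. i' = i + k \<and> j' = j + k" "\<exists>k. i = i' + k \<and> j = j' + k"
    using meet_pow_eq_iff[OF assms(1,3,4), of i' j'] meet_pow_eq_iff[OF assms(2,5,6), of i j] by blast+
  then show ?thesis by auto
qed

lemma desc_finite_card: "finite {x. (par ^^ n) x = w} \<and> card {x. (par ^^ n) x = w} = q ^ n"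
proof (induction n)
  case (Suc n)
  have e: "{x. (par ^^ Suc n) x = w} = (\<Union>y\<in>{x. (par ^^ n) x = w}. {x. par x = y})"
    by (auto simp: funpow_swap1)
  have "card {x. (par ^^ Suc n) x = w} = (\<Sum>y\<in>{x. (par ^^ n) x = w}. card {x. par x = y})"
    unfolding e using Suc finite_children by (intro card_UN_disjoint) auto
  then show ?case unfolding e using Suc finite_children by (simp add: card_children)
qed simp

lemma meet_finite: "finite (meet z i j)"
  using desc_finite_card[of i "(par ^^ j) z"] by (auto simp: meet_def intro: finite_subset[rotated])

text \<open>Of the q^i descendants of \<open>(par ^^ j) z\<close> at depth i, the q^(i-1) lying
  below \<open>(par ^^ (j - 1)) z\<close> are removed, and each point has mass m z q^(j-i). The
  total does not depend on i, and its q^j cancels the denominator in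
  \<open>poly_op_pt_meet_diff\<close>.\<close>

lemma meet_mass:
  assumes ij: "i \<ge> 1" "j \<ge> 1"
  shows "(\<Sum>x\<in>meet z i j. m x) = m z * real q ^ j * (1 - 1 / real q)"
proof -
  have qi: "real q ^ i > 0" for i using q_pos by simp
  have mx: "m x = m z * real q ^ j / real q ^ i" if "x \<in> meet z i j" for x
  proof -
    have "(par ^^ i) x = (par ^^ j) z" using that by (simp add: meet_def)
    then have "real q ^ i * m x = real q ^ j * m z" by (metis m_par_pow)
    then show ?thesis using qi[of i] by (simp add: field_simps)
  qed
  let ?A = "{x. (par ^^ i) x = (par ^^ j) z}" and ?B = "{x. (par ^^ (i - 1)) x = (par ^^ (j - 1)) z}"
  have "?B \<subseteq> ?A"
  proof
    fix x assume "x \<in> ?B"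
    then have "(par ^^ Suc (i - 1)) x = (par ^^ Suc (j - 1)) z" by simp
    then show "x \<in> ?A" using ij by simp
  qed
  moreover have "meet z i j = ?A - ?B" by (auto simp: meet_def)
  ultimately have "card (meet z i j) = q ^ i - q ^ (i - 1)"
    using desc_finite_card by (simp add: card_Diff_subset)
  moreover have "q ^ (i - 1) \<le> q ^ i" using q2 by (intro power_increasing) auto
  ultimately have "real (card (meet z i j)) = real q ^ i - real q ^ (i - 1)" by (simp add: of_nat_diff)
  also have "\<dots> = real q ^ i * (1 - 1 / real q)" using ij q_pos by (cases i) (simp_all add: field_simps)
  finally have "real (card (meet z i j)) * (m z * real q ^ j / real q ^ i) = m z * real q ^ j * (1 - 1 / real q)"
  proof -
    have "A * c * (X / A) = X * c" if "A > 0" for A c X :: real using that by simp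
    then show "real (card (meet z i j)) = real q ^ i * (1 - 1 / real q) \<Longrightarrow> ?thesis" using qi[of i] by metis
  qed
  then show ?thesis using mx by simp
qed

lemma meet_nonempty:
  assumes ij: "i \<ge> 1" "j \<ge> 1" shows "meet z i j \<noteq> {}"
proof
  assume "meet z i j = {}"
  then have "m z * real q ^ j * (1 - 1 / real q) = 0" using meet_mass[OF ij, of z] by simp
  then show False using q2 by simp
qed

lemma cheb_pt: "cheb n (pt z) x = (\<Sum>a\<le>n. if (par ^^ a) x = (par ^^ (n - a)) z then 1 / of_real (m ((par ^^ (n - a)) z)) else 0)"
proof -
  have d: "(dn ^^ k) (pt z) = pt ((par ^^ k) z)" for k by (induction k) (simp_all add: dn_pt)
  have u: "(up ^^ k) f x = f ((par ^^ k) x)" for k f and x :: 'v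
    by (induction k arbitrary: x) (simp_all add: up_def funpow_swap1[of par])
  show ?thesis unfolding cheb_def d u pt_def ..
qed

text \<open>Common ancestors sit at heights (i + k, j + k), so at most one summand of
  \<open>cheb n\<close> survives. It is written as a sum over k so that summations can be exchanged
  in \<open>poly_op_pt_meet\<close>.\<close>

lemma cheb_pt_meet:
  assumes x: "x \<in> meet z i j" and ij: "i \<ge> 1" "j \<ge> 1" and nN: "n \<le> N"
  shows "cheb n (pt z) x = (\<Sum>k\<le>N. if n = i + j + 2 * k then 1 / of_real (m z * real q ^ (j + k)) else 0)"
proof (cases "\<exists>k. n = i + j + 2 * k")
  case True
  then obtain k0 where k0: "n = i + j + 2 * k0" by blast
  have "cheb n (pt z) x = (\<Sum>a\<le>n. if a = i + k0 then 1 / of_real (m z * real q ^ (j + k0)) else 0)"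
    unfolding cheb_pt
  proof (rule sum.cong[OF refl])
    fix a assume a: "a \<in> {..n}"
    have "(\<exists>k. a = i + k \<and> n - a = j + k) \<longleftrightarrow> a = i + k0" using a k0 by auto
    moreover have "n - (i + k0) = j + k0" using k0 by simp
    ultimately show "(if (par ^^ a) x = (par ^^ (n - a)) z then 1 / complex_of_real (m ((par ^^ (n - a)) z)) else 0)
       = (if a = i + k0 then 1 / of_real (m z * real q ^ (j + k0)) else 0)"
      unfolding meet_pow_eq_iff[OF x ij] by (auto simp: m_par_pow mult.commute)
  qed
  also have "\<dots> = 1 / of_real (m z * real q ^ (j + k0))" using k0 by simp
  also have "\<dots> = (\<Sum>k\<le>N. if k = k0 then 1 / of_real (m z * real q ^ (j + k0)) else 0)" using k0 nN by simp
  also have "\<dots> = (\<Sum>k\<le>N. if n = i + j + 2 * k then 1 / of_real (m z * real q ^ (j + k)) else 0)"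
    by (intro sum.cong) (auto simp: k0)
  finally show ?thesis .
next
  case False
  have "\<not> (\<exists>k. a = i + k \<and> n - a = j + k)" if "a \<le> n" for a
  proof
    assume "\<exists>k. a = i + k \<and> n - a = j + k"
    then obtain k where "a = i + k" "n - a = j + k" by blast
    then have "n = i + j + 2 * k" using that by linarith
    then show False using False by blast
  qed
  then have "cheb n (pt z) x = 0"
    unfolding cheb_pt meet_pow_eq_iff[OF x ij] by (intro sum.neutral) auto
  moreover have "(\<Sum>k\<le>N. if n = i + j + 2 * k then 1 / complex_of_real (m z * real q ^ (j + k)) else 0) = 0"
    using False by (intro sum.neutral) auto
  ultimately show ?thesis by simp
qed

lemma poly_op_pt_meet:
  assumes x: "x \<in> meet z i j" and ij: "i \<ge> 1" "j \<ge> 1" and N: "degree p \<le> N"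
  shows "poly_op p lap (pt z) x = (\<Sum>k\<le>N. sin_coef (poly_fun p) (i + j + 2 * k) / of_real (m z * real q ^ (j + k)))"
proof -
  have "poly_op p lap (pt z) x = (\<Sum>n\<le>N. \<Sum>k\<le>N. if n = i + j + 2 * k then sin_coef (poly_fun p) n / of_real (m z * real q ^ (j + k)) else 0)"
    unfolding poly_op_cheb[OF N]
    by (intro sum.cong refl) (simp add: cheb_pt_meet[OF x ij, of _ N] sum_distrib_left if_distrib[of "\<lambda>u. _ * u"] cong: if_cong)
  also have "\<dots> = (\<Sum>k\<le>N. \<Sum>n\<le>N. if n = i + j + 2 * k then sin_coef (poly_fun p) n / of_real (m z * real q ^ (j + k)) else 0)"
    by (rule sum.swap)
  also have "\<dots> = (\<Sum>k\<le>N. sin_coef (poly_fun p) (i + j + 2 * k) / of_real (m z * real q ^ (j + k)))"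
  proof (rule sum.cong[OF refl])
    fix k
    show "(\<Sum>n\<le>N. if n = i + j + 2 * k then sin_coef (poly_fun p) n / of_real (m z * real q ^ (j + k)) else 0)
       = sin_coef (poly_fun p) (i + j + 2 * k) / of_real (m z * real q ^ (j + k))"
      using sin_coef_poly_eq_0[of p "i + j + 2 * k"] N by (cases "i + j + 2 * k \<le> N") auto
  qed
  finally show ?thesis .
qed

text \<open>
  Passing from \<open>(i, j)\<close> to \<open>(i + 1, j + 1)\<close> drops the leading term of the series for the kernel,
  so differences of kernel values isolate a single coefficient.
\<close>
lemma poly_op_pt_meet_diff:
  assumes x: "x \<in> meet z i j" and y: "y \<in> meet z (Suc i) (Suc j)" and ij: "i \<ge> 1" "j \<ge> 1"
  shows "poly_op p lap (pt z) x - poly_op p lap (pt z) y = sin_coef (poly_fun p) (i + j) / of_real (m z * real q ^ j)"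
proof -
  define N where "N = degree p"
  define t where "t k = sin_coef (poly_fun p) (i + j + 2 * k) / of_real (m z * real q ^ (j + k))" for k
  have "poly_op p lap (pt z) x = (\<Sum>k\<le>N. t k)"
    using poly_op_pt_meet[OF x ij, of p N] by (simp add: N_def t_def)
  moreover have "poly_op p lap (pt z) y = (\<Sum>k\<le>N. t (Suc k))"
    using poly_op_pt_meet[OF y, of p N] by (simp add: N_def t_def)
  ultimately have "poly_op p lap (pt z) x - poly_op p lap (pt z) y = (\<Sum>k\<le>N. t k - t (Suc k))"
    by (simp add: sum_subtractf)
  also have "\<dots> = t 0 - t (Suc N)" by (rule sum_telescope)
  also have "t (Suc N) = 0" using sin_coef_poly_eq_0[of p "i + j + 2 * Suc N"] by (simp add: t_def N_def)
  finally show ?thesis by (simp add: t_def)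
qed

lemma lap_pt_eq_poly_op: "poly_op p lap (lap (pt z)) x = poly_op (pCons 0 p) lap (pt z) x"
  by (simp add: poly_op_pCons)

text \<open>A single kernel value is a series with possible cancellation. Its difference with the
  value at (i + 1, j + 1) is one coefficient, and the triangle inequality costs only a factor 2
  since each pair is counted at most twice.\<close>

lemma L1_norm_functional_calculus_ge:
  assumes F: "continuous_on UNIV F" and K: "K > 0"
  shows "L1_norm M (functional_calculus M lap F (\<lambda>x. of_real K * lap (pt z) x)) \<ge>
    ennreal (K * (1 - 1 / real q) / 2 * (\<Sum>i=1..N. \<Sum>j=1..N. cmod (sin_coef (\<lambda>x. of_real x * F x) (i + j))))"
proof -
  define a where "a = (\<lambda>x. of_real K * lap (pt z) x)"
  define h where "h = functional_calculus M lap F a"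
  define c where "c n = sin_coef (\<lambda>x. of_real x * F x) n" for n
  have a: "a \<in> L2 M" unfolding a_def by (intro L2_scale lap_L2 pt_L2)
  obtain p where p0: "uniform_limit {0..2} (\<lambda>n. poly_fun (p n)) F sequentially"
    "\<And>x. (\<lambda>n. poly_op (p n) lap a x) \<longlonglongrightarrow> functional_calculus M lap F a x"
    by (rule functional_calculus_approx[OF a F], rule that)
  note p = p0[folded h_def]
  \<comment> \<open>Applying p(lap) to lap (pt z) amounts to the polynomial r p(r), hence the symbol
    \<open>of_real x * F x\<close>.\<close>
  define P where "P n = pCons 0 (p n)" for n
  have Pa: "poly_op (p n) lap a x = of_real K * poly_op (P n) lap (pt z) x" for n x
  proof -
    have "(lap ^^ k) a = (\<lambda>x. of_real K * (lap ^^ k) (lap (pt z)) x)" for k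
    proof (induction k)
      case (Suc k)
      show ?case by (rule ext) (simp add: Suc lap_scale)
    qed (simp add: a_def)
    then have "poly_op (p n) lap a x = of_real K * poly_op (p n) lap (lap (pt z)) x"
      unfolding poly_op_def by (simp add: sum_distrib_left mult.left_commute)
    then show ?thesis by (simp add: P_def lap_pt_eq_poly_op)
  qed
  have clim: "(\<lambda>n. sin_coef (poly_fun (P n)) k) \<longlonglongrightarrow> c k" for k
  proof -
    have e: "sin_coef (poly_fun (P n)) k = sin_coef (\<lambda>x. of_real x * poly_fun (p n) x) k" for n
      by (simp add: P_def)
    have u: "uniform_limit {0..2} (\<lambda>n x. of_real x * poly_fun (p n) x) (\<lambda>x. of_real x * F x) sequentially"
    proof (rule uniform_limitI)
      fix e :: real assume "e > 0"
      then have "\<forall>\<^sub>F n in sequentially. \<forall>x\<in>{0..2}. dist (poly_fun (p n) x) (F x) < e / 2"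
        using uniform_limitD[OF p(1), of "e / 2"] by simp
      then show "\<forall>\<^sub>F n in sequentially. \<forall>x\<in>{0..2}. dist (of_real x * poly_fun (p n) x) (of_real x * F x) < e"
      proof (rule eventually_mono, intro ballI)
        fix n and x :: real assume 1: "\<forall>x\<in>{0..2}. dist (poly_fun (p n) x) (F x) < e / 2" and x: "x \<in> {0..2}"
        have "dist (of_real x * poly_fun (p n) x) (of_real x * F x) = x * cmod (poly_fun (p n) x - F x)"
          unfolding dist_norm right_diff_distrib[symmetric] norm_mult using x by simp
        also have "\<dots> \<le> 2 * cmod (poly_fun (p n) x - F x)" using x by (intro mult_right_mono) auto
        also have "\<dots> < e" using bspec[OF 1 x] by (simp add: dist_norm)
        finally show "dist (of_real x * poly_fun (p n) x) (of_real x * F x) < e" .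
      qed
    qed
    show ?thesis unfolding e c_def
      by (rule sin_coef_tendsto[OF _ _ u]) (intro continuous_intros continuous_on_subset[OF F] | simp)+
  qed
  have hdiff: "h x - h y = of_real K * (c (i + j) / of_real (m z * real q ^ j))"
    if "x \<in> meet z i j" "y \<in> meet z (Suc i) (Suc j)" "i \<ge> 1" "j \<ge> 1" for x y i j
  proof (rule LIMSEQ_unique)
    show "(\<lambda>n. poly_op (p n) lap a x - poly_op (p n) lap a y) \<longlonglongrightarrow> h x - h y"
      by (intro tendsto_diff p)
    have "poly_op (p n) lap a x - poly_op (p n) lap a y = of_real K * (sin_coef (poly_fun (P n)) (i + j) / of_real (m z * real q ^ j))" for n
      unfolding Pa right_diff_distrib[symmetric] poly_op_pt_meet_diff[OF that] ..
    moreover have "(\<lambda>n. of_real K * (sin_coef (poly_fun (P n)) (i + j) / of_real (m z * real q ^ j))) \<longlonglongrightarrow> of_real K * (c (i + j) / of_real (m z * real q ^ j))"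
      using q2 by (intro tendsto_intros clim) auto
    ultimately show "(\<lambda>n. poly_op (p n) lap a x - poly_op (p n) lap a y) \<longlonglongrightarrow> of_real K * (c (i + j) / of_real (m z * real q ^ j))"
      by simp
  qed
  define y where "y i j = (SOME x. x \<in> meet z i j)" for i j
  have y: "y i j \<in> meet z i j" if "i \<ge> 1" "j \<ge> 1" for i j
    unfolding y_def using meet_nonempty[OF that, of z] by (metis someI_ex ex_in_conv)
  define eta where "eta i j = cmod (h (y i j))" for i j
  \<comment> \<open>All points of \<open>meet z i j\<close> have the same difference with one fixed
    point of the next set, so \<open>h\<close> is constant on it.\<close>
  have hconst: "cmod (h x) = eta i j" if x: "x \<in> meet z i j" and ij: "i \<ge> 1" "j \<ge> 1" for x i j
  proof -
    have yS: "y (Suc i) (Suc j) \<in> meet z (Suc i) (Suc j)" by (rule y) auto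
    have "h x - h (y (Suc i) (Suc j)) = h (y i j) - h (y (Suc i) (Suc j))"
      by (simp only: hdiff[OF x yS ij] hdiff[OF y[OF ij] yS ij])
    then have "h x = h (y i j)" by simp
    then show ?thesis by (simp add: eta_def)
  qed
  \<comment> \<open>\<open>Suc N\<close> makes room for the shifted pairs (i + 1, j + 1).\<close>
  define I where "I = {1..Suc N} \<times> {1..Suc N}"
  define A where "A = (\<Union>(i, j)\<in>I. meet z i j)"
  have finA: "finite A" unfolding A_def I_def using meet_finite by auto
  define W where "W = m z * (1 - 1 / real q)"
  have W: "W > 0" using q2 by (simp add: W_def)
  define g where "g i j = real q ^ j * eta i j" for i j
  have g0: "g i j \<ge> 0" for i j by (simp add: g_def eta_def)
  have sumA: "(\<Sum>x\<in>A. cmod (h x) * m x) = (\<Sum>i=1..Suc N. \<Sum>j=1..Suc N. W * g i j)"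
  proof -
    have "(\<Sum>x\<in>A. cmod (h x) * m x) = (\<Sum>ij\<in>I. \<Sum>x\<in>(case ij of (i, j) \<Rightarrow> meet z i j). cmod (h x) * m x)"
      unfolding A_def
    proof (rule sum.UNION_disjoint)
      show "\<forall>ij\<in>I. \<forall>kl\<in>I. ij \<noteq> kl \<longrightarrow> (case ij of (i, j) \<Rightarrow> meet z i j) \<inter> (case kl of (i, j) \<Rightarrow> meet z i j) = {}"
        using meet_disjoint by (force simp: I_def)
    qed (auto simp: I_def meet_finite)
    also have "\<dots> = (\<Sum>(i, j)\<in>I. W * g i j)"
    proof (rule sum.cong[OF refl], clarify)
      fix i j assume "(i, j) \<in> I"
      then have ij: "i \<ge> 1" "j \<ge> 1" by (auto simp: I_def)
      have "(\<Sum>x\<in>meet z i j. cmod (h x) * m x) = eta i j * (\<Sum>x\<in>meet z i j. m x)"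
        unfolding sum_distrib_left by (intro sum.cong refl) (simp add: hconst[OF _ ij])
      then show "(\<Sum>x\<in>meet z i j. cmod (h x) * m x) = W * g i j"
        unfolding meet_mass[OF ij] by (simp add: W_def g_def mult_ac)
    qed
    finally show ?thesis unfolding I_def by (simp only: sum.cartesian_product)
  qed
  have step: "K / m z * cmod (c (i + j)) \<le> g i j + g (Suc i) (Suc j)" if ij: "i \<ge> 1" "j \<ge> 1" for i j
  proof -
    have yS: "y (Suc i) (Suc j) \<in> meet z (Suc i) (Suc j)" by (rule y) auto
    have qj: "real q ^ j > 0" using q_pos by simp
    have "K * (cmod (c (i + j)) / (m z * real q ^ j)) = cmod (h (y i j) - h (y (Suc i) (Suc j)))"
      unfolding hdiff[OF y[OF ij] yS ij] norm_mult norm_divide norm_of_real using K qj by (simp add: abs_mult)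
    also have "\<dots> \<le> eta i j + eta (Suc i) (Suc j)" unfolding eta_def by (rule norm_triangle_ineq4)
    finally have "real q ^ j * (K * (cmod (c (i + j)) / (m z * real q ^ j))) \<le> real q ^ j * (eta i j + eta (Suc i) (Suc j))"
      using qj by (intro mult_left_mono) auto
    also have "real q ^ j * (K * (cmod (c (i + j)) / (m z * real q ^ j))) = K / m z * cmod (c (i + j))"
      using q2 by (simp add: field_simps)
    \<comment> \<open>The shifted value is owed the weight q^(j+1) and needs only q^j.\<close>
    also have "real q ^ j * (eta i j + eta (Suc i) (Suc j)) \<le> g i j + g (Suc i) (Suc j)"
    proof -
      have "real q ^ j \<le> real q ^ Suc j" using q2 by (intro power_increasing) auto
      then have "real q ^ j * eta (Suc i) (Suc j) \<le> real q ^ Suc j * eta (Suc i) (Suc j)"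
        by (rule mult_right_mono) (simp add: eta_def)
      then show ?thesis unfolding g_def by (simp add: distrib_left)
    qed
    finally show ?thesis .
  qed
  define T where "T = (\<Sum>i=1..Suc N. \<Sum>j=1..Suc N. g i j)"
  have s1: "(\<Sum>i=1..N. \<Sum>j=1..N. g i j) \<le> T"
  proof -
    have "(\<Sum>i=1..N. \<Sum>j=1..N. g i j) \<le> (\<Sum>i=1..N. \<Sum>j=1..Suc N. g i j)"
      using g0 by (intro sum_mono) (auto intro!: sum_mono2)
    also have "\<dots> \<le> T" unfolding T_def using g0 by (intro sum_mono2) (auto intro!: sum_nonneg add_nonneg_nonneg)
    finally show ?thesis .
  qed
  have s2: "(\<Sum>i=1..N. \<Sum>j=1..N. g (Suc i) (Suc j)) \<le> T"
  proof -
    have "(\<Sum>i=1..N. \<Sum>j=1..N. g (Suc i) (Suc j)) = (\<Sum>i=Suc 1..Suc N. \<Sum>j=Suc 1..Suc N. g i j)"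
      unfolding sum.shift_bounds_cl_Suc_ivl ..
    also have "\<dots> \<le> (\<Sum>i=Suc 1..Suc N. \<Sum>j=1..Suc N. g i j)"
      using g0 by (intro sum_mono) (auto intro!: sum_mono2)
    also have "\<dots> \<le> T" unfolding T_def using g0 by (intro sum_mono2) (auto intro!: sum_nonneg add_nonneg_nonneg)
    finally show ?thesis .
  qed
  have "(\<Sum>i=1..N. \<Sum>j=1..N. K / m z * cmod (c (i + j))) \<le> (\<Sum>i=1..N. \<Sum>j=1..N. g i j + g (Suc i) (Suc j))"
    by (intro sum_mono step) auto
  also have "\<dots> \<le> 2 * T" using s1 s2 by (simp add: sum.distrib)
  finally have *: "W / 2 * (K / m z * (\<Sum>i=1..N. \<Sum>j=1..N. cmod (c (i + j)))) \<le> W / 2 * (2 * T)"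
    using W by (intro mult_left_mono) (simp_all add: sum_distrib_left)
  have "K * (1 - 1 / real q) / 2 * S = W / 2 * (K / m z * S)" for S by (simp add: W_def)
  also note *
  also have "W / 2 * (2 * T) = (\<Sum>x\<in>A. cmod (h x) * m x)"
  proof -
    have "W / 2 * (2 * T) = W * T" by simp
    then show ?thesis unfolding sumA T_def by (simp only: sum_distrib_left)
  qed
  finally have "K * (1 - 1 / real q) / 2 * (\<Sum>i=1..N. \<Sum>j=1..N. cmod (c (i + j))) \<le> (\<Sum>x\<in>A. cmod (h x) * m x)" .
  then have "ennreal (K * (1 - 1 / real q) / 2 * (\<Sum>i=1..N. \<Sum>j=1..N. cmod (c (i + j)))) \<le> (\<Sum>x\<in>A. ennreal (cmod (h x) * m x))"
    by (subst sum_ennreal) (auto intro!: ennreal_leI)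
  also have "\<dots> = (\<integral>\<^sup>+x. ennreal (cmod (h x) * m x) * indicator A x \<partial>count_space UNIV)"
    using finA by (simp add: nn_integral_count_space_indicator[symmetric] nn_integral_count_space_finite)
  also have "\<dots> \<le> (\<integral>\<^sup>+x. ennreal (m x) * ennreal (cmod (h x)) \<partial>count_space UNIV)"
    by (intro nn_integral_mono) (auto simp: indicator_def ennreal_mult' mult.commute)
  also have "\<dots> = L1_norm M h"
    unfolding L1_norm_def M_eq by (subst nn_integral_density) auto
  finally show ?thesis unfolding h_def a_def c_def .
qed

end

section \<open>Ends of homogeneous trees\<close>

text \<open>Non-backtracking walks. Being local, the condition survives reversal and gluing, while
  in a tree it characterises geodesics (\<open>nbwalk_graph_dist\<close>). Only the values up to
  index n matter.\<close>

definition nbwalk :: "('v \<Rightarrow> 'v \<Rightarrow> bool) \<Rightarrow> (nat \<Rightarrow> 'v) \<Rightarrow> nat \<Rightarrow> bool" where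
  "nbwalk adj w n \<longleftrightarrow> (\<forall>i<n. adj (w i) (w (Suc i))) \<and> (\<forall>i. i + 2 \<le> n \<longrightarrow> w i \<noteq> w (i + 2))"

locale tree_graph =
  fixes q :: nat and adj :: "'v \<Rightarrow> 'v \<Rightarrow> bool"
  assumes tree: "homogeneous_tree q adj"
begin

lemma adj_irrefl: "\<not> adj x x" and adj_sym: "adj x y \<Longrightarrow> adj y x" and adj_conn: "adj\<^sup>*\<^sup>* x y"
  and card_adj: "card {y. adj x y} = q + 1"
  and acyclic: "\<lbrakk>length xs \<ge> 3; distinct xs; successively adj xs; adj (last xs) (hd xs)\<rbrakk> \<Longrightarrow> False"
  using tree unfolding homogeneous_tree_def by blast+

text \<open>A repetition at minimal distance encloses a cycle: distance 1 contradicts irreflexivity,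
  distance 2 is backtracking, and distance at least 3 contradicts acyclicity.\<close>

lemma nbwalk_inj_less:
  assumes w: "nbwalk adj w n"
  shows "i < j \<Longrightarrow> j \<le> n \<Longrightarrow> w i \<noteq> w j"
proof (induction "j - i" arbitrary: i j rule: less_induct)
  case less
  show ?case
  proof
    assume eq: "w i = w j"
    have step: "adj (w k) (w (Suc k))" if "k < n" for k using w that by (auto simp: nbwalk_def)
    have "j \<noteq> i + 1" using step[of i] adj_irrefl[of "w i"] less.prems eq by auto
    moreover have "j \<noteq> i + 2" using w less.prems eq by (auto simp: nbwalk_def)
    ultimately have ij: "i + 3 \<le> j" using less.prems by linarith
    define xs where "xs = map w [i..<j]"
    have ne: "[i..<j] \<noteq> []" using ij by simp
    have "distinct xs"
      unfolding xs_def distinct_map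
    proof (intro conjI distinct_upt inj_onI)
      fix a b assume ab: "a \<in> set [i..<j]" "b \<in> set [i..<j]" "w a = w b"
      show "a = b"
      proof (rule ccontr)
        assume "a \<noteq> b"
        then have "min a b < max a b" "max a b - min a b < j - i" "max a b \<le> n" "w (min a b) = w (max a b)"
          using ab less.prems by (auto simp: min_def max_def)
        then show False using less.hyps by blast
      qed
    qed
    moreover have "successively adj xs"
      unfolding xs_def successively_map successively_conv_nth using less.prems by (auto intro!: step)
    moreover have "adj (last xs) (hd xs)"
      using step[of "j - 1"] ij less.prems eq ne by (simp add: xs_def last_map hd_map)
    ultimately show False using acyclic[of xs] ij by (simp add: xs_def le_diff_conv2)
  qed
qed

lemma nbwalk_rev:
  assumes "nbwalk adj w n" shows "nbwalk adj (\<lambda>i. w (n - i)) n"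
  unfolding nbwalk_def
proof (intro conjI allI impI)
  fix i assume "i < n"
  then have "adj (w (n - Suc i)) (w (Suc (n - Suc i)))" using assms by (auto simp: nbwalk_def)
  then show "adj (w (n - i)) (w (n - Suc i))" using \<open>i < n\<close> adj_sym by (simp add: Suc_diff_Suc)
next
  fix i assume "i + 2 \<le> n"
  then have "w (n - (i + 2)) \<noteq> w (n - (i + 2) + 2)" using assms by (auto simp: nbwalk_def)
  moreover have "n - (i + 2) + 2 = n - i" using \<open>i + 2 \<le> n\<close> by simp
  ultimately show "w (n - i) \<noteq> w (n - (i + 2))" by metis
qed

text \<open>If the vertices before the common endpoint agree, both walks are shortened. If they
  differ, \<open>w\<close> followed by the reversal of \<open>v\<close> does not backtrack at the
  joint, so it is a closed non-backtracking walk, which \<open>nbwalk_inj_less\<close>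
  forbids.\<close>

lemma nbwalk_unique:
  assumes "nbwalk adj w n" "nbwalk adj v k" "w 0 = v 0" "w n = v k"
  shows "n = k \<and> (\<forall>i\<le>n. w i = v i)"
  using assms
proof (induction n arbitrary: k)
  case 0
  then have "k = 0" using nbwalk_inj_less[of v k 0 k] by (cases k) auto
  then show ?case using 0 by simp
next
  case (Suc n)
  note w = \<open>nbwalk adj w (Suc n)\<close> and v = \<open>nbwalk adj v k\<close>
  show ?case
  proof (cases k)
    case 0
    then show ?thesis using nbwalk_inj_less[OF w, of 0 "Suc n"] Suc.prems by simp
  next
    case k: (Suc k')
    show ?thesis
    proof (cases "w n = v k'")
      case True
      have "nbwalk adj w n" "nbwalk adj v k'" using w v k by (auto simp: nbwalk_def)
      then have "n = k' \<and> (\<forall>i\<le>n. w i = v i)" using Suc.IH True Suc.prems by blast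
      then show ?thesis using Suc.prems k le_Suc_eq by auto
    next
      case False
      define u where "u i = (if i \<le> Suc n then w i else v (k - (i - Suc n)))" for i
      have ulate: "u i = v (k - (i - Suc n))" if "i \<ge> Suc n" for i
        using that Suc.prems by (cases "i = Suc n") (auto simp: u_def)
      note rv = nbwalk_rev[OF v]
      have "nbwalk adj u (Suc n + k)"
        unfolding nbwalk_def
      proof (intro conjI allI impI)
        fix i assume i: "i < Suc n + k"
        show "adj (u i) (u (Suc i))"
        proof (cases "i < Suc n")
          case True
          then show ?thesis using w by (auto simp: u_def nbwalk_def)
        next
          case False
          then have "i - Suc n < k" "Suc i - Suc n = Suc (i - Suc n)" using i by auto
          then show ?thesis using rv False ulate[of i] ulate[of "Suc i"] by (auto simp: nbwalk_def)
        qed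
      next
        fix i assume i: "i + 2 \<le> Suc n + k"
        consider "i + 2 \<le> Suc n" | "i = n" | "i \<ge> Suc n" by linarith
        then show "u i \<noteq> u (i + 2)"
        proof cases
          case 1
          then show ?thesis using w by (auto simp: u_def nbwalk_def)
        next
          case 2
          then show ?thesis using False ulate[of "i + 2"] k by (simp add: u_def)
        next
          case 3
          then have "i - Suc n + 2 \<le> k" "i + 2 - Suc n = i - Suc n + 2" using i by auto
          then show ?thesis using rv 3 ulate[of i] ulate[of "i + 2"] by (auto simp: nbwalk_def)
        qed
      qed
      moreover have "u 0 = u (Suc n + k)" using Suc.prems ulate[of "Suc n + k"] by (simp add: u_def)
      ultimately show ?thesis using nbwalk_inj_less[of u "Suc n + k" 0 "Suc n + k"] by simp
    qed
  qed
qed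

section \<open>Distances and geodesic rays\<close>

lemma graph_dist_walk: "(adj ^^ graph_dist adj x y) x y"
  unfolding graph_dist_def using adj_conn[of x y] by (metis LeastI rtranclp_imp_relpowp)

lemma graph_dist_le: "(adj ^^ n) x y \<Longrightarrow> graph_dist adj x y \<le> n"
  unfolding graph_dist_def by (rule Least_le)

lemma geodesic_nbwalk:
  obtains w where "nbwalk adj w (graph_dist adj x y)" "w 0 = x" "w (graph_dist adj x y) = y"
proof -
  define d where "d = graph_dist adj x y"
  obtain w where w: "w 0 = x" "w d = y" "\<And>i. i < d \<Longrightarrow> adj (w i) (w (Suc i))"
    using graph_dist_walk[of x y] unfolding relpowp_fun_conv d_def by blast
  have "w i \<noteq> w (i + 2)" if i: "i + 2 \<le> d" for i
  proof
    assume eq: "w i = w (i + 2)"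
    \<comment> \<open>Cutting out the detour shortens the walk by 2, against minimality.\<close>
    define v where "v j = (if j \<le> i then w j else w (j + 2))" for j
    have "adj (v j) (v (Suc j))" if "j < d - 2" for j
      using w(3)[of j] w(3)[of "j + 2"] that eq by (cases "j < i"; cases "j = i") (auto simp: v_def)
    moreover have "v 0 = x" by (simp add: v_def w(1))
    moreover have "v (d - 2) = y"
    proof (cases "d - 2 \<le> i")
      case True
      then have "d - 2 = i" "d = i + 2" using i by auto
      then show ?thesis using eq w(2) by (simp add: v_def)
    next
      case False
      moreover have "d - 2 + 2 = d" using i by simp
      ultimately show ?thesis using w(2) unfolding v_def by metis
    qed
    ultimately have "(adj ^^ (d - 2)) x y" unfolding relpowp_fun_conv by blast
    then show False using graph_dist_le i unfolding d_def by fastforce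
  qed
  then have "nbwalk adj w d" using w by (auto simp: nbwalk_def)
  then show thesis using that w unfolding d_def by blast
qed

lemma nbwalk_graph_dist:
  assumes "nbwalk adj w n" shows "graph_dist adj (w 0) (w n) = n"
proof -
  obtain v where "nbwalk adj v (graph_dist adj (w 0) (w n))" "v 0 = w 0" "v (graph_dist adj (w 0) (w n)) = w n"
    by (rule geodesic_nbwalk)
  then show ?thesis using nbwalk_unique[OF assms] by metis
qed

text \<open>With the local criterion, dropping the first vertex of a ray or prepending a new one
  needs a check at the start only.\<close>

lemma geodesic_ray_iff:
  "geodesic_ray adj r \<longleftrightarrow> (\<forall>i. adj (r i) (r (Suc i)) \<and> r i \<noteq> r (i + 2))"
proof
  assume r: "geodesic_ray adj r"
  show "\<forall>i. adj (r i) (r (Suc i)) \<and> r i \<noteq> r (i + 2)"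
  proof (intro allI conjI)
    fix i
    have "graph_dist adj (r i) (r (i + 1)) = 1" using r unfolding geodesic_ray_def by blast
    then show "adj (r i) (r (Suc i))" using graph_dist_walk[of "r i" "r (i + 1)"] by (auto simp: OO_def)
    have "graph_dist adj (r i) (r (i + 2)) = 2" using r unfolding geodesic_ray_def by blast
    moreover have "graph_dist adj (r i) (r i) = 0" using graph_dist_le[of 0 "r i" "r i"] by simp
    ultimately show "r i \<noteq> r (i + 2)" by force
  qed
next
  assume r: "\<forall>i. adj (r i) (r (Suc i)) \<and> r i \<noteq> r (i + 2)"
  show "geodesic_ray adj r"
    unfolding geodesic_ray_def
  proof (intro allI)
    fix i j
    have "nbwalk adj (\<lambda>k. r (i + k)) j" using r unfolding nbwalk_def by (metis add.assoc add_Suc_right)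
    from nbwalk_graph_dist[OF this] show "graph_dist adj (r i) (r (i + j)) = j" by simp
  qed
qed

lemma geodesic_ray_nbwalk: "geodesic_ray adj r \<Longrightarrow> nbwalk adj r n"
  unfolding geodesic_ray_iff nbwalk_def by blast

end

locale tree_end = tree_graph +
  fixes \<omega> :: "(nat \<Rightarrow> 'a) set"
  assumes end_in: "\<omega> \<in> ends adj"
begin

abbreviation "par \<equiv> predecessor adj \<omega>"

lemma end_geodesic: "r \<in> \<omega> \<Longrightarrow> geodesic_ray adj r"
  using end_in unfolding ends_def quotient_def by auto

lemma end_equiv:
  assumes "r \<in> \<omega>" "s \<in> \<omega>" obtains k l where "\<And>n. r (k + n) = s (l + n)"
proof -
  obtain r0 where r0: "\<And>s. s \<in> \<omega> \<Longrightarrow> \<exists>k l. \<forall>n. r0 (k + n) = s (l + n)"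
    using end_in unfolding ends_def quotient_def by auto
  obtain k l k' l' where kl: "\<And>n. r0 (k + n) = r (l + n)" "\<And>n. r0 (k' + n) = s (l' + n)"
    using r0[OF assms(1)] r0[OF assms(2)] by blast
  have "r ((l + k') + n) = s ((l' + k) + n)" for n
    using kl(1)[of "k' + n"] kl(2)[of "k + n"] by (simp add: ac_simps)
  then show thesis using that by blast
qed

lemma end_closed:
  assumes "r \<in> \<omega>" "geodesic_ray adj s" "\<And>n. r (k + n) = s (l + n)" shows "s \<in> \<omega>"
proof -
  obtain r0 where r0: "\<omega> = {s. geodesic_ray adj r0 \<and> geodesic_ray adj s \<and> (\<exists>k l. \<forall>n. r0 (k + n) = s (l + n))}"
    using end_in unfolding ends_def quotient_def by auto
  obtain k' l' where kl: "\<And>n. r0 (k' + n) = r (l' + n)" using assms(1) unfolding r0 by blast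
  have "r0 ((k' + k) + n) = s ((l + l') + n)" for n
    using kl[of "k + n"] assms(3)[of "l' + n"] by (simp add: ac_simps)
  then show ?thesis using assms unfolding r0 by blast
qed

text \<open>The two rays meet at some r k = s l. Uniqueness of walks from the common start forces k
  = l, after which the tails agree.\<close>

lemma end_unique:
  assumes "r \<in> \<omega>" "s \<in> \<omega>" "r 0 = s 0" shows "r = s"
proof -
  obtain k l where kl: "\<And>n. r (k + n) = s (l + n)" using end_equiv[OF assms(1,2)] by blast
  have "k = l \<and> (\<forall>i\<le>k. r i = s i)"
    by (rule nbwalk_unique) (use assms kl[of 0] in \<open>auto intro: geodesic_ray_nbwalk end_geodesic\<close>)
  then have "r i = s i" for i using kl[of "i - k"] by (cases "i \<le> k") auto
  then show ?thesis by auto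
qed

lemma end_tail: "r \<in> \<omega> \<Longrightarrow> (\<lambda>n. r (Suc n)) \<in> \<omega>"
  using end_closed[of r "\<lambda>n. r (Suc n)" 1 0] end_geodesic[of r] by (auto simp: geodesic_ray_iff)

lemma end_extend:
  assumes "r \<in> \<omega>" "adj (r 0) y" "y \<noteq> r 1" shows "case_nat y r \<in> \<omega>"
proof (rule end_closed[OF assms(1), of _ 0 1])
  show "geodesic_ray adj (case_nat y r)"
    using end_geodesic[OF assms(1)] adj_sym[OF assms(2)] assms(3)
    by (auto simp: geodesic_ray_iff split: nat.splits)
qed auto

text \<open>The ray is transported along a path from one known origin: crossing an edge either drops
  the first vertex or prepends one.\<close>

lemma end_ray_ex: "\<exists>r\<in>\<omega>. r 0 = x"
proof -
  obtain r0 where r0: "r0 \<in> \<omega>"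
    using end_in unfolding ends_def quotient_def by auto
  from adj_conn[of "r0 0" x] show ?thesis
  proof (induction rule: rtranclp_induct)
    case base
    then show ?case using r0 by blast
  next
    case (step y z)
    then obtain r where r: "r \<in> \<omega>" "r 0 = y" by blast
    show ?case
    proof (cases "z = r 1")
      case True
      then show ?thesis using end_tail[OF r(1)] by force
    next
      case False
      then have "case_nat z r \<in> \<omega>" using end_extend[OF r(1), of z] step.hyps r by simp
      then show ?thesis by (intro bexI[of _ "case_nat z r"]) simp_all
    qed
  qed
qed

definition ray :: "'a \<Rightarrow> nat \<Rightarrow> 'a" where "ray x = (SOME r. r \<in> \<omega> \<and> r 0 = x)"

lemma ray: "ray x \<in> \<omega>" "ray x 0 = x"
  using someI_ex[of "\<lambda>r. r \<in> \<omega> \<and> r 0 = x"] end_ray_ex[of x] unfolding ray_def by blast+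

lemma ray_eqI: "r \<in> \<omega> \<Longrightarrow> r 0 = x \<Longrightarrow> r = ray x"
  using end_unique ray by metis

lemma tree_le_ray: "tree_le \<omega> x y \<longleftrightarrow> y \<in> range (ray x)"
  unfolding tree_le_def using ray ray_eqI by metis

lemma adj_ray: "adj x (ray x 1)"
  using end_geodesic[OF ray(1)[of x], unfolded geodesic_ray_iff, rule_format, of 0] ray(2)[of x] by simp

lemma par_eq: "par x = ray x 1"
  unfolding predecessor_def
proof (rule the_equality)
  show "adj x (ray x 1) \<and> tree_le \<omega> x (ray x 1)"
    using adj_ray[of x] by (simp add: tree_le_ray)
next
  fix y assume y: "adj x y \<and> tree_le \<omega> x y"
  then obtain n where n: "y = ray x n" by (auto simp: tree_le_ray)
  \<comment> \<open>The single edge and the initial piece of the ray are two walks from x to y, so n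
    = 1.\<close>
  have "nbwalk adj (\<lambda>i. if i = 0 then x else y) 1" using y by (auto simp: nbwalk_def)
  from nbwalk_unique[OF this geodesic_ray_nbwalk[OF end_geodesic[OF ray(1)[of x]], of n]] n ray(2)[of x]
  show "y = ray x 1" by auto
qed

lemma ray_Suc: "ray x (Suc n) = ray (par x) n"
proof -
  have "(\<lambda>n. ray x (Suc n)) = ray (par x)"
    by (rule ray_eqI[OF end_tail[OF ray(1)]]) (simp only: par_eq One_nat_def)
  then show ?thesis by (rule fun_cong)
qed

lemma ray_par: "ray x n = (par ^^ n) x"
  by (induction n arbitrary: x) (simp_all add: ray ray_Suc funpow_swap1)

lemma par_trapezoid: "tree_le \<omega> y x \<and> graph_dist adj x y = n \<longleftrightarrow> (par ^^ n) y = x"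
proof -
  have "graph_dist adj (ray y m) y = m" for m
    using nbwalk_graph_dist[OF nbwalk_rev[OF geodesic_ray_nbwalk[OF end_geodesic[OF ray(1)]]], of y m] ray(2)
    by simp
  then show ?thesis unfolding tree_le_ray ray_par by auto
qed

lemma trapezoid_eq: "trapezoid adj \<omega> h k x = {y. \<exists>n. h \<le> n \<and> n < k \<and> (par ^^ n) y = x}"
  unfolding trapezoid_def par_trapezoid[symmetric] by auto

text \<open>A neighbour y of x other than \<open>par x\<close> can be prepended to the ray of x, so
  \<open>par y = x\<close>. Exactly one of the q + 1 neighbours is therefore not a child.\<close>

lemma card_children: "card {y. par y = x} = q"
proof -
  have 1: "adj x (par x)" for x
    using adj_ray[of x] by (simp add: par_eq)
  have 2: "par (par x) \<noteq> x"
  proof -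
    have "ray x 0 \<noteq> ray x (0 + 2)" using end_geodesic[OF ray(1)[of x]] unfolding geodesic_ray_iff by blast
    then show ?thesis by (simp add: ray ray_par numeral_2_eq_2)
  qed
  have 3: "par y = x" if "adj x y" "y \<noteq> par x" for y
  proof -
    have "case_nat y (ray x) \<in> \<omega>" using end_extend[OF ray(1)[of x], of y] that ray(2)[of x] by (simp add: par_eq)
    from ray_eqI[OF this, of y] have "ray y 1 = x" by (auto simp: ray dest: fun_cong[where x = 1] sym)
    then show ?thesis by (simp add: par_eq)
  qed
  have "{y. adj x y} = insert (par x) {y. par y = x}" using 1 3 adj_sym by blast
  moreover have "finite {y. adj x y}" using card_adj[of x] by (metis card.infinite add_is_0 one_neq_zero)
  ultimately show ?thesis using card_adj[of x] 2 by simp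
qed

end

section \<open>Atoms\<close>

context flow_tree
begin

lemma nn_integral_M_finite:
  assumes "finite A" shows "(\<integral>\<^sup>+x. ennreal (g x) * indicator A x \<partial>M) = (\<Sum>x\<in>A. ennreal (m x) * ennreal (g x))"
proof -
  have "(\<integral>\<^sup>+x. ennreal (g x) * indicator A x \<partial>M) = (\<integral>\<^sup>+x. ennreal (m x) * (ennreal (g x) * indicator A x) \<partial>count_space UNIV)"
    unfolding M_eq by (subst nn_integral_density) auto
  also have "\<dots> = (\<integral>\<^sup>+x. (ennreal (m x) * ennreal (g x)) * indicator A x \<partial>count_space UNIV)"
    by (simp add: mult.assoc)
  also have "\<dots> = (\<Sum>x\<in>A. ennreal (m x) * ennreal (g x))"
    using assms by (simp add: nn_integral_count_space_indicator[symmetric] nn_integral_count_space_finite)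
  finally show ?thesis .
qed

lemma measure_M_finite:
  assumes "finite A" shows "measure M A = (\<Sum>x\<in>A. m x)"
proof -
  have "emeasure M A = (\<integral>\<^sup>+x. ennreal 1 * indicator A x \<partial>M)" by simp
  also have "\<dots> = (\<Sum>x\<in>A. ennreal (m x))" unfolding nn_integral_M_finite[OF assms] by simp
  also have "\<dots> = ennreal (\<Sum>x\<in>A. m x)" by (rule sum_ennreal) simp
  finally show ?thesis by (simp add: measure_def sum_nonneg)
qed

lemma integral_M_finite:
  fixes f :: "'v \<Rightarrow> complex"
  assumes "finite A" "\<And>x. x \<notin> A \<Longrightarrow> f x = 0"
  shows "(LINT x|M. f x) = (\<Sum>x\<in>A. of_real (m x) * f x)" "integrable M f"
proof -
  have s: "(\<lambda>x. norm (f x) * m x) summable_on UNIV"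
  proof (rule summable_on_cong_neutral[THEN iffD1])
    show "(\<lambda>x. norm (f x) * m x) summable_on A" using assms(1) by (rule summable_on_finite)
  qed (use assms(2) in auto)
  show "integrable M f" unfolding integrable_M_iff by (rule s)
  have "(LINT x|M. f x) = (\<Sum>\<^sub>\<infinity>x. m x *\<^sub>R f x)" by (rule integral_M[OF s])
  also have "\<dots> = (\<Sum>\<^sub>\<infinity>x\<in>A. m x *\<^sub>R f x)" by (rule infsum_cong_neutral) (use assms(2) in auto)
  finally show "(LINT x|M. f x) = (\<Sum>x\<in>A. of_real (m x) * f x)" using assms(1) by (simp add: scaleR_conv_of_real)
qed

text \<open>The admissible trapezoid with ratio 4 / 1 and apex two levels above z. Depths 1, 2 and 3
  contain \<open>par z\<close>, z and the children of z, the support of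
  \<open>lap (pt z)\<close>.\<close>

definition trap :: "'v \<Rightarrow> 'v set" where
  "trap z = {y. \<exists>n. 1 \<le> n \<and> n < 4 \<and> (par ^^ n) y = par (par z)}"

text \<open>\<open>pt z\<close>, \<open>up (pt z)\<close> and \<open>pt (par z)\<close> all have
  integral 1 and are bounded by 1 / m z; they enter with weights 1, -1/2, -1/2.\<close>

lemma lap_pt_integral: "(LINT x|M. lap (pt z) x) = 0"
  and lap_pt_support: "x \<notin> trap z \<Longrightarrow> lap (pt z) x = 0"
  and lap_pt_bound: "cmod (lap (pt z) x) \<le> 2 / m z"
proof -
  have e: "lap (pt z) x = pt z x - (up (pt z) x + pt (par z) x) / 2" for x
    by (simp add: lap_def dn_pt)
  have I1: "(LINT x|M. pt w x) = 1" "integrable M (pt w)" for w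
    using integral_M_finite[of "{w}" "pt w"] by (auto simp: pt_def)
  have I2: "(LINT x|M. up (pt z) x) = 1" "integrable M (up (pt z))"
  proof -
    have *: "up (pt z) x = 0" if "x \<notin> {x. par x = z}" for x using that by (simp add: up_def pt_def)
    note I = integral_M_finite[OF finite_children[of z] *, simplified]
    have "(\<Sum>x | par x = z. complex_of_real (m x) * up (pt z) x) = (\<Sum>x | par x = z. of_real (m x)) / of_real (m z)"
      unfolding sum_divide_distrib by (intro sum.cong) (auto simp: up_def pt_def)
    then show "(LINT x|M. up (pt z) x) = 1"
      using I(1) sum_children_m[of z] by (simp add: of_real_sum[symmetric] del: of_real_sum)
    show "integrable M (up (pt z))" by (rule I(2))
  qed
  show "(LINT x|M. lap (pt z) x) = 0"
    unfolding e using I1 I2 by (simp add: integral_divide_zero)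
  have sup: "lap (pt z) x = 0" if "x \<notin> {z, par z} \<union> {y. par y = z}" for x
    using that by (simp add: e up_def pt_def)
  show "x \<notin> trap z \<Longrightarrow> lap (pt z) x = 0"
  proof -
    assume x: "x \<notin> trap z"
    have "(par ^^ 2) z = par (par z)" "(par ^^ 1) (par z) = par (par z)"
      "par y = z \<Longrightarrow> (par ^^ 3) y = par (par z)" for y
      by (simp_all add: numeral_2_eq_2 numeral_3_eq_3)
    then have "{z, par z} \<union> {y. par y = z} \<subseteq> trap z"
      unfolding trap_def by (auto intro: exI[of _ "2::nat"] exI[of _ "1::nat"] exI[of _ "3::nat"])
    then show ?thesis using sup x by blast
  qed
  have p1: "cmod (pt z y) \<le> 1 / m z" for y by (simp add: pt_def norm_divide)
  have p2: "cmod (pt (par z) y) \<le> 1 / m z" for y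
  proof -
    have "m z \<le> m (par z)" using q2 mult_right_mono[of 1 "real q" "m z"] by (simp add: m_par)
    then show ?thesis by (simp add: pt_def norm_divide frac_le)
  qed
  have "cmod (lap (pt z) x) \<le> cmod (pt z x) + cmod ((up (pt z) x + pt (par z) x) / 2)"
    unfolding e by (rule norm_triangle_ineq4)
  also have "cmod ((up (pt z) x + pt (par z) x) / 2) \<le> (1 / m z + 1 / m z) / 2"
    unfolding norm_divide using p1[of "par x"] p2[of x]
    by (simp only: up_def) (intro divide_mono order_trans[OF norm_triangle_ineq] add_mono, auto)
  finally show "cmod (lap (pt z) x) \<le> 2 / m z" using p1[of x] by simp
qed

text \<open>By the flow property each of the three generations has the mass q^2 m z of the
  apex.\<close>

lemma trap_measure: "0 < measure M (trap z)" "measure M (trap z) \<le> 3 * (real q)\<^sup>2 * m z"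
proof -
  define w where "w = par (par z)"
  have t: "trap z = (\<Union>n\<in>{1..<4}. {y. (par ^^ n) y = w})"
    by (auto simp: trap_def w_def)
  have fin: "finite (trap z)" unfolding t using desc_finite_card by auto
  have z: "z \<in> trap z" unfolding trap_def by (auto intro!: exI[of _ "2::nat"] simp: numeral_2_eq_2)
  show "0 < measure M (trap z)"
    unfolding measure_M_finite[OF fin] using fin z by (intro sum_pos) auto
  have "measure M (trap z) \<le> (\<Sum>n\<in>{1..<4}. (\<Sum>x | (par ^^ n) x = w. m x))"
    unfolding t using desc_finite_card
    by (intro order_trans[OF measure_UNION_le]) (auto simp: measure_M_finite intro!: sum_mono)
  also have "\<dots> = (\<Sum>n\<in>{1..<4::nat}. m w)"
  proof (rule sum.cong[OF refl])
    fix n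
    have "(\<Sum>x | (par ^^ n) x = w. m x) = (\<Sum>x | (par ^^ n) x = w. m w / real q ^ n)"
      using m_par_pow[of n] q_pos by (intro sum.cong) auto
    then show "(\<Sum>x | (par ^^ n) x = w. m x) = m w" using desc_finite_card[of n w] q_pos by simp
  qed
  also have "\<dots> = 3 * (real q)\<^sup>2 * m z" by (simp add: w_def m_par power2_eq_square)
  finally show "measure M (trap z) \<le> 3 * (real q)\<^sup>2 * m z" .
qed

end

lemma H1_L1_opnorm_ge:
  assumes tree: "homogeneous_tree q adj" and \<omega>: "\<omega> \<in> ends adj" and lev: "level_function adj \<omega> lev"
    and q: "q \<ge> 2" and F: "continuous_on UNIV F"
  shows "H1_L1_opnorm q adj \<omega> lev (functional_calculus (flow_measure q lev) (flow_laplacian q adj \<omega> lev) F)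
    \<ge> ennreal ((1 - 1 / real q) / (12 * (real q)\<^sup>2) *
        (\<Sum>i=1..N. \<Sum>j=1..N. cmod (sin_coef (\<lambda>x. of_real x * F x) (i + j))))"
proof -
  interpret tree_end q adj \<omega> by unfold_locales (use tree \<omega> in auto)
  interpret flow_tree q par lev
    by unfold_locales (use q card_children lev in \<open>auto simp: level_function_def\<close>)
  \<comment> \<open>Makes K times the bound 2 / m z equal to 1 / (3 q^2 m z), the size allowed to an
    atom on \<open>trap z\<close>.\<close>
  define K where "K = 1 / (6 * (real q)\<^sup>2)"
  have K: "K > 0" using q by (simp add: K_def)
  fix z :: 'a
  define a where "a = (\<lambda>x. of_real K * lap (pt z) x)"
  have aL: "a \<in> L2 M" unfolding a_def by (intro L2_scale lap_L2 pt_L2)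
  have lapeq: "flow_laplacian q adj \<omega> lev f = lap f" if "f \<in> L2 M" for f
    using half_adjoint_grad[OF that]
    by (simp add: fun_eq_iff flow_laplacian_def flow_gradient_def[abs_def])
  have trap: "trap z = trapezoid adj \<omega> 1 4 (par (par z))"
    unfolding trap_def trapezoid_eq ..
  have "atom q adj \<omega> lev a"
    unfolding atom_def
  proof (intro exI[of _ "trap z"] conjI allI impI)
    show "admissible_trapezoid adj \<omega> (trap z)"
      unfolding admissible_trapezoid_def trap
      by (intro disjI2 exI[of _ "par (par z)"] exI[of _ "1::nat"] exI[of _ "4::nat"]) auto
    show "x \<notin> trap z \<Longrightarrow> a x = 0" for x using lap_pt_support by (simp add: a_def)
    show "(LINT x|M. a x) = 0" unfolding a_def by (simp add: lap_pt_integral)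
    show "cmod (a x) \<le> 1 / measure M (trap z)" for x
    proof -
      have "cmod (a x) \<le> K * (2 / m z)"
        unfolding a_def norm_mult norm_of_real abs_of_pos[OF K]
        using K by (intro mult_left_mono lap_pt_bound) simp
      also have "\<dots> = 1 / (3 * (real q)\<^sup>2 * m z)" by (simp add: K_def)
      also have "\<dots> \<le> 1 / measure M (trap z)"
        using trap_measure[of z] q by (intro divide_left_mono) (auto intro!: mult_pos_pos)
      finally show ?thesis .
    qed
  qed
  \<comment> \<open>The atom is its own decomposition, with coefficients 1, 0, 0, ...; hence its H1
    norm is at most 1.\<close>
  then have dec: "atomic_decomposition q adj \<omega> lev a (\<lambda>j. if j = 0 then 1 else 0) (\<lambda>_. a)"
    unfolding atomic_decomposition_def
  proof (intro conjI)
    show "summable (\<lambda>j. cmod (if j = 0 then 1 else 0))"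
      by (rule summable_finite[of "{0}"]) auto
    have "(\<Sum>j<n. (if j = 0 then 1 else 0) * a x) = a x" if "n \<ge> 1" for n :: nat and x
      using that by (simp add: if_distrib[of "\<lambda>u. u * _"] cong: if_cong)
    then have "L1_norm M (\<lambda>x. a x - (\<Sum>j<n. (if j = 0 then 1 else 0) * a x)) = 0" if "n \<ge> 1" for n :: nat
      using that by (simp add: L1_norm_def)
    then show "(\<lambda>n. L1_norm M (\<lambda>x. a x - (\<Sum>j<n. (if j = 0 then 1 else 0) * a x))) \<longlonglongrightarrow> 0"
      by (intro tendsto_eventually eventually_sequentiallyI[of 1])
  qed simp
  have "(\<Sum>j. cmod (if j = 0 then 1 else 0)) = 1"
    using suminf_finite[of "{0::nat}" "\<lambda>j. cmod (if j = 0 then 1 else 0)"] by simp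
  then have "H1_norm q adj \<omega> lev a \<le> ennreal 1"
    unfolding H1_norm_def
  proof (intro Inf_lower CollectI exI conjI)
    assume "(\<Sum>j::nat. cmod (if j = 0 then 1 else 0)) = 1"
    then show "ennreal 1 = ennreal (\<Sum>j::nat. cmod (if j = 0 then 1 else 0))" by simp
  qed (rule dec)
  moreover have "a \<in> H1 q adj \<omega> lev" unfolding H1_def using dec by blast
  ultimately have le: "L1_norm M (functional_calculus M (flow_laplacian q adj \<omega> lev) F a)
      \<le> H1_L1_opnorm q adj \<omega> lev (functional_calculus M (flow_laplacian q adj \<omega> lev) F)"
    unfolding H1_L1_opnorm_def using aL by (intro SUP_upper) auto
  have eq: "functional_calculus M (flow_laplacian q adj \<omega> lev) F a = functional_calculus M lap F a"
    by (rule functional_calculus_cong[OF lapeq aL])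
  have K2: "(1 - 1 / real q) / (12 * (real q)\<^sup>2) = K * (1 - 1 / real q) / 2" by (simp add: K_def)
  show ?thesis
    unfolding K2 using L1_norm_functional_calculus_ge[OF F K, of N z, folded a_def] le[unfolded eq]
    by (rule order_trans)
qed

section \<open>Fourier inversion\<close>

text \<open>Decay without smoothness, since inversion needs no more; derivatives are tracked
  separately by \<open>rdiff\<close>.\<close>

definition rapid :: "(real \<Rightarrow> complex) \<Rightarrow> bool" where
  "rapid u \<longleftrightarrow> continuous_on UNIV u \<and> (\<forall>N. \<exists>C. \<forall>x. (1 + \<bar>x\<bar>) ^ N * cmod (u x) \<le> C)"

definition poly_growth :: "(real \<Rightarrow> complex) \<Rightarrow> bool" where
  "poly_growth w \<longleftrightarrow> continuous_on UNIV w \<and> (\<exists>N C. \<forall>x. cmod (w x) \<le> C * (1 + \<bar>x\<bar>) ^ N)"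

lemma rapid_continuous: "rapid u \<Longrightarrow> continuous_on UNIV u"
  by (simp add: rapid_def)

lemma rapid_measurable: "rapid u \<Longrightarrow> u \<in> borel_measurable borel"
  by (intro borel_measurable_continuous_onI rapid_continuous)

lemma rapidE:
  assumes "rapid u" obtains C where "C \<ge> 0" "\<And>x. (1 + \<bar>x\<bar>) ^ N * cmod (u x) \<le> C"
proof -
  obtain C where C: "\<And>x. (1 + \<bar>x\<bar>) ^ N * cmod (u x) \<le> C" using assms unfolding rapid_def by blast
  have "0 \<le> (1 + \<bar>0\<bar>) ^ N * cmod (u 0)" by simp
  also have "\<dots> \<le> C" by (rule C)
  finally show thesis using C that by blast
qed

lemma rapid_mult:
  assumes w: "poly_growth w" and u: "rapid u" shows "rapid (\<lambda>x. w x * u x)"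
  unfolding rapid_def
proof (intro conjI allI)
  show "continuous_on UNIV (\<lambda>x. w x * u x)"
    using w u by (intro continuous_intros) (auto simp: rapid_def poly_growth_def)
  fix N
  obtain K C where C: "\<And>x. cmod (w x) \<le> C * (1 + \<bar>x\<bar>) ^ K" using w unfolding poly_growth_def by blast
  have "0 \<le> cmod (w 0)" by simp
  also have "\<dots> \<le> C" using C[of 0] by simp
  finally have C0: "C \<ge> 0" .
  obtain D where D: "\<And>x. (1 + \<bar>x\<bar>) ^ (N + K) * cmod (u x) \<le> D" by (rule rapidE[OF u], rule that)
  have "(1 + \<bar>x\<bar>) ^ N * cmod (w x * u x) \<le> C * D" for x
  proof -
    have "(1 + \<bar>x\<bar>) ^ N * cmod (w x * u x) \<le> (1 + \<bar>x\<bar>) ^ N * (C * (1 + \<bar>x\<bar>) ^ K * cmod (u x))"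
      unfolding norm_mult by (intro mult_left_mono mult_right_mono C) auto
    also have "\<dots> = C * ((1 + \<bar>x\<bar>) ^ (N + K) * cmod (u x))" by (simp add: power_add mult_ac)
    also have "\<dots> \<le> C * D" using C0 D by (intro mult_left_mono)
    finally show ?thesis .
  qed
  then show "\<exists>C. \<forall>x. (1 + \<bar>x\<bar>) ^ N * cmod (w x * u x) \<le> C" by blast
qed

lemma rapid_add:
  assumes "rapid u" "rapid v" shows "rapid (\<lambda>x. u x + v x)"
  unfolding rapid_def
proof (intro conjI allI)
  show "continuous_on UNIV (\<lambda>x. u x + v x)"
    using assms by (intro continuous_intros) (auto simp: rapid_def)
  fix N
  obtain C where C: "\<And>x. (1 + \<bar>x\<bar>) ^ N * cmod (u x) \<le> C" by (rule rapidE[OF assms(1)], rule that)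
  obtain D where D: "\<And>x. (1 + \<bar>x\<bar>) ^ N * cmod (v x) \<le> D" by (rule rapidE[OF assms(2)], rule that)
  have "(1 + \<bar>x\<bar>) ^ N * cmod (u x + v x) \<le> C + D" for x
  proof -
    have "(1 + \<bar>x\<bar>) ^ N * cmod (u x + v x) \<le> (1 + \<bar>x\<bar>) ^ N * (cmod (u x) + cmod (v x))"
      by (intro mult_left_mono norm_triangle_ineq) auto
    then show ?thesis using C[of x] D[of x] by (simp add: distrib_left)
  qed
  then show "\<exists>C. \<forall>x. (1 + \<bar>x\<bar>) ^ N * cmod (u x + v x) \<le> C" by blast
qed

lemma poly_growthI:
  "continuous_on UNIV w \<Longrightarrow> (\<And>x. cmod (w x) \<le> C * (1 + \<bar>x\<bar>) ^ N) \<Longrightarrow> poly_growth w"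
  unfolding poly_growth_def by blast

lemma poly_growth_const: "poly_growth (\<lambda>x. c)"
  by (rule poly_growthI[of _ "cmod c" 0]) auto

lemma poly_growth_id: "poly_growth (\<lambda>x. c * of_real x)"
proof (rule poly_growthI[of _ "cmod c" 1])
  show "cmod (c * of_real x) \<le> cmod c * (1 + \<bar>x\<bar>) ^ 1" for x
    unfolding norm_mult by (intro mult_left_mono) auto
qed (intro continuous_intros)

lemma rapid_scale: "rapid u \<Longrightarrow> rapid (\<lambda>x. c * u x)"
  by (rule rapid_mult[OF poly_growth_const])

text \<open>Peetre's inequality, the source of the factor (1 + |t|)^s in the Sobolev bound.\<close>

lemma one_plus_abs_shift_le: "1 + \<bar>x + a\<bar> \<le> (1 + \<bar>a\<bar>) * (1 + \<bar>x\<bar>)" for x a :: real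
proof -
  have "1 + \<bar>x + a\<bar> \<le> 1 + \<bar>x\<bar> + \<bar>a\<bar>" by linarith
  also have "\<dots> \<le> (1 + \<bar>a\<bar>) * (1 + \<bar>x\<bar>)" by (simp add: algebra_simps)
  finally show ?thesis .
qed

lemma rapid_affine:
  assumes u: "rapid u" and c: "\<bar>c\<bar> = 1" shows "rapid (\<lambda>x. u (a + c * x))"
  unfolding rapid_def
proof (intro conjI allI)
  show "continuous_on UNIV (\<lambda>x. u (a + c * x))"
    by (rule continuous_on_compose2[OF rapid_continuous[OF u]]) (auto intro!: continuous_intros)
  fix N
  obtain C where C: "\<And>x. (1 + \<bar>x\<bar>) ^ N * cmod (u x) \<le> C" by (rule rapidE[OF u], rule that)
  have "(1 + \<bar>x\<bar>) ^ N * cmod (u (a + c * x)) \<le> (1 + \<bar>a\<bar>) ^ N * C" for x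
  proof -
    have "\<bar>x\<bar> = \<bar>c * x\<bar>" using c by (simp add: abs_mult)
    also have "\<dots> = \<bar>(a + c * x) + (- a)\<bar>" by simp
    finally have "1 + \<bar>x\<bar> \<le> (1 + \<bar>a\<bar>) * (1 + \<bar>a + c * x\<bar>)" using one_plus_abs_shift_le[of "a + c * x" "- a"] by simp
    then have "(1 + \<bar>x\<bar>) ^ N \<le> (1 + \<bar>a\<bar>) ^ N * (1 + \<bar>a + c * x\<bar>) ^ N"
      using power_mono[of "1 + \<bar>x\<bar>" _ N] by (simp add: power_mult_distrib[symmetric])
    then have "(1 + \<bar>x\<bar>) ^ N * cmod (u (a + c * x)) \<le> (1 + \<bar>a\<bar>) ^ N * (1 + \<bar>a + c * x\<bar>) ^ N * cmod (u (a + c * x))"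
      by (rule mult_right_mono) simp
    also have "\<dots> \<le> (1 + \<bar>a\<bar>) ^ N * C"
      unfolding mult.assoc by (intro mult_left_mono C) auto
    finally show ?thesis .
  qed
  then show "\<exists>C. \<forall>x. (1 + \<bar>x\<bar>) ^ N * cmod (u (a + c * x)) \<le> C" by blast
qed

lemma integrable_inverse_square: "integrable lborel (\<lambda>x::real. C / (1 + x\<^sup>2))"
proof -
  have "integrable lborel (\<lambda>x::real. inverse (1 + x\<^sup>2))"
    using integrable_inverse_1_plus_square by (simp add: set_integrable_def einterval_def)
  then show ?thesis unfolding divide_inverse by (rule integrable_mult_right)
qed

lemma rapid_le_inverse_square:
  assumes "rapid u" obtains C where "\<And>x. cmod (u x) \<le> C / (1 + x\<^sup>2)"
proof -
  obtain C where C: "\<And>x. (1 + \<bar>x\<bar>) ^ 2 * cmod (u x) \<le> C" by (rule rapidE[OF assms], rule that)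
  have "cmod (u x) \<le> C / (1 + x\<^sup>2)" for x
  proof -
    have p: "1 + x\<^sup>2 > 0" by (simp add: add_pos_nonneg)
    have "(1 + x\<^sup>2) * cmod (u x) \<le> (1 + \<bar>x\<bar>) ^ 2 * cmod (u x)"
      by (intro mult_right_mono) (simp_all add: power2_sum)
    then show ?thesis using C[of x] p by (simp add: pos_le_divide_eq mult.commute)
  qed
  then show thesis by (rule that)
qed

lemma rapid_integrable:
  assumes u: "rapid u" shows "integrable lborel u"
proof -
  obtain C where C: "\<And>x. cmod (u x) \<le> C / (1 + x\<^sup>2)" by (rule rapid_le_inverse_square[OF u], rule that)
  show ?thesis
  proof (rule Bochner_Integration.integrable_bound[OF integrable_inverse_square[of C]])
    show "AE x in lborel. norm (u x) \<le> norm (C / (1 + x\<^sup>2))"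
      using C by (intro AE_I2) (metis abs_ge_self order_trans real_norm_def)
  qed (simp add: rapid_measurable[OF u])
qed

section \<open>The multiplication formula and Fourier inversion\<close>

abbreviation fker :: "real \<Rightarrow> real \<Rightarrow> complex" where
  "fker \<xi> x \<equiv> exp (- (\<i> * complex_of_real (\<xi> * x)))"

lemma norm_exp_i [simp]: "cmod (iexp x) = 1" "cmod (exp (- (\<i> * complex_of_real x))) = 1"
  using norm_exp_i_times[of x] norm_exp_i_times[of "- x"] by simp_all

lemma integrable_mult_exp:
  assumes "integrable lborel u"
  shows "integrable lborel (\<lambda>x. u x * fker \<xi> x)"
    and "integrable lborel (\<lambda>x. u x * iexp (\<xi> * x))"
  using assms by (auto intro!: Bochner_Integration.integrable_bound[OF assms] simp: norm_mult)

lemma fourier_bound: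
  assumes "integrable lborel u" shows "cmod (fourier u \<xi>) \<le> (LINT x|lborel. cmod (u x))"
proof -
  have "cmod (fourier u \<xi>) \<le> (LINT x|lborel. cmod (u x * fker \<xi> x))"
    unfolding fourier_def by (rule integral_norm_bound)
  then show ?thesis by (simp add: norm_mult)
qed

text \<open>The derivative of \<open>u x * fker \<xi> x\<close> is integrable and its primitive
  decays at both ends, so it integrates to 0.\<close>

lemma fourier_deriv:
  assumes u: "rapid u" and u': "rapid u'" and d: "\<And>x. (u has_vector_derivative u' x) (at x)"
  shows "fourier u' \<xi> = \<i> * of_real \<xi> * fourier u \<xi>"
proof -
  define F where "F x = u x * fker \<xi> x" for x
  define f where "f x = u' x * fker \<xi> x - \<i> * of_real \<xi> * (u x * fker \<xi> x)" for x
  have dF: "(F has_vector_derivative f x) (at x)" for x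
  proof -
    have "((\<lambda>x. - (\<i> * complex_of_real (\<xi> * x))) has_vector_derivative - (\<i> * of_real \<xi>)) (at x)"
      by (auto intro!: derivative_eq_intros has_vector_derivative_minus has_vector_derivative_mult_right has_vector_derivative_of_real)
    then have "(exp \<circ> (\<lambda>x. - (\<i> * complex_of_real (\<xi> * x))) has_vector_derivative
        (- (\<i> * of_real \<xi>)) * fker \<xi> x) (at x)"
      by (rule field_vector_diff_chain_at) (auto intro!: derivative_eq_intros)
    then have e: "((\<lambda>x. fker \<xi> x) has_vector_derivative
        (- (\<i> * of_real \<xi>)) * fker \<xi> x) (at x)"
      by (simp add: o_def)
    have "(F has_vector_derivative u x * ((- (\<i> * of_real \<xi>)) * fker \<xi> x) + u' x * fker \<xi> x) (at x)"
      unfolding F_def by (rule has_vector_derivative_mult[OF d e])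
    then show ?thesis by (simp add: f_def algebra_simps)
  qed
  have i1: "integrable lborel (\<lambda>x. u' x * fker \<xi> x)"
    and i2: "integrable lborel (\<lambda>x. \<i> * of_real \<xi> * (u x * fker \<xi> x))"
    by (intro integrable_mult_exp integrable_mult_right rapid_integrable u u')+
  have if_: "integrable lborel f" unfolding f_def using i1 i2 by (rule Bochner_Integration.integrable_diff)
  obtain C where C: "\<And>x. cmod (u x) \<le> C / (1 + x\<^sup>2)" by (rule rapid_le_inverse_square[OF u], rule that)
  have FC: "norm (F x) \<le> C / (1 + x\<^sup>2)" for x using C[of x] by (simp add: F_def norm_mult)
  have sq: "filterlim (\<lambda>x::real. 1 + x\<^sup>2) at_infinity at_top" "filterlim (\<lambda>x::real. 1 + x\<^sup>2) at_infinity at_bot"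
    using filterlim_pow_at_top[OF _ filterlim_ident, of 2]
      filterlim_pow_at_bot_even[OF _ filterlim_ident, of 2]
    by (auto intro!: filterlim_at_top_imp_at_infinity filterlim_tendsto_add_at_top[OF tendsto_const])
  have "(F \<longlongrightarrow> 0) at_top"
    by (rule Lim_null_comparison[OF always_eventually[OF allI[OF FC]] tendsto_divide_0[OF tendsto_const sq(1)]])
  then have B: "((F \<circ> real_of_ereal) \<longlongrightarrow> 0) (at_left \<infinity>)" unfolding ereal_tendsto_simps .
  have "(F \<longlongrightarrow> 0) at_bot"
    by (rule Lim_null_comparison[OF always_eventually[OF allI[OF FC]] tendsto_divide_0[OF tendsto_const sq(2)]])
  then have A: "((F \<circ> real_of_ereal) \<longlongrightarrow> 0) (at_right (-\<infinity>))" unfolding ereal_tendsto_simps .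
  have cf: "isCont f x" for x
  proof -
    have "continuous_on UNIV f" unfolding f_def
      by (intro continuous_intros rapid_continuous u u')
    then show ?thesis by (simp add: continuous_on_eq_continuous_at)
  qed
  have "(LBINT x=-\<infinity>..\<infinity>. f x) = 0 - 0"
    by (rule interval_integral_FTC_integrable[OF _ dF cf _ A B]) (use if_ in \<open>auto simp: set_integrable_def einterval_def\<close>)
  then have "(LINT x|lborel. f x) = 0"
    by (simp add: interval_lebesgue_integral_def set_lebesgue_integral_def einterval_def)
  then show ?thesis
    unfolding f_def Bochner_Integration.integral_diff[OF i1 i2] by (simp add: fourier_def)
qed

lemma Fubini_exp:
  assumes u: "integrable lborel u" and v: "integrable lborel v"
  shows "(LINT x|lborel. u x * (LINT \<xi>|lborel. v \<xi> * iexp (\<xi> * x)))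
       = (LINT \<xi>|lborel. v \<xi> * (LINT x|lborel. u x * iexp (\<xi> * x)))"
proof -
  have [measurable]: "u \<in> borel_measurable borel" "v \<in> borel_measurable borel"
    using borel_measurable_integrable[OF u] borel_measurable_integrable[OF v] by simp_all
  let ?G = "\<lambda>\<xi> x. u x * (v \<xi> * iexp (\<xi> * x))"
  have "integrable (lborel \<Otimes>\<^sub>M lborel) (case_prod ?G)"
  proof (rule lborel_pair.Fubini_integrable)
    show "case_prod ?G \<in> borel_measurable (lborel \<Otimes>\<^sub>M lborel)" by measurable
    have "(LINT x|lborel. norm (case (\<xi>, x) of (\<xi>, x) \<Rightarrow> ?G \<xi> x)) = cmod (v \<xi>) * (LINT x|lborel. cmod (u x))" for \<xi>
      by (simp add: norm_mult mult.commute)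
    then show "integrable lborel (\<lambda>\<xi>. LINT x|lborel. norm (case (\<xi>, x) of (\<xi>, x) \<Rightarrow> ?G \<xi> x))"
      using v by simp
    show "AE \<xi> in lborel. integrable lborel (\<lambda>x. case (\<xi>, x) of (\<xi>, x) \<Rightarrow> ?G \<xi> x)"
    proof (rule AE_I2)
      fix \<xi> :: real
      have "integrable lborel (\<lambda>x. v \<xi> * (u x * iexp (\<xi> * x)))"
        by (intro integrable_mult_right integrable_mult_exp u)
      then show "integrable lborel (\<lambda>x. case (\<xi>, x) of (\<xi>, x) \<Rightarrow> ?G \<xi> x)"
        by (simp add: mult.left_commute)
    qed
  qed
  from lborel_pair.Fubini_integral[OF this]
  have "(LINT x|lborel. (LINT \<xi>|lborel. ?G \<xi> x)) = (LINT \<xi>|lborel. (LINT x|lborel. ?G \<xi> x))" .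
  moreover have "(LINT x|lborel. ?G \<xi> x) = v \<xi> * (LINT x|lborel. u x * iexp (\<xi> * x))" for \<xi>
    by (subst integral_mult_right_zero[symmetric]) (simp add: mult.left_commute)
  ultimately show ?thesis by simp
qed

text \<open>A Gaussian factor of width n + 1 is inserted. By dominated convergence the damped
  integral tends to the left side; by Fubini it is 2 pi times an average of f against a normal
  density of width 1 / (n + 1), which tends to the right side.\<close>

lemma fourier_inversion:
  assumes f: "rapid f" and fh: "integrable lborel (fourier f)"
  shows "(LINT \<xi>|lborel. fourier f \<xi> * iexp (\<xi> * x)) = 2 * of_real pi * f x"
proof -
  define I where "I n = (LINT \<xi>|lborel. (fourier f \<xi> * iexp (\<xi> * x)) * of_real (exp (- (\<xi> / real (Suc n))\<^sup>2 / 2)))" for n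
  note fi = rapid_integrable[OF f]
  have [measurable]: "f \<in> borel_measurable borel" by (rule rapid_measurable[OF f])
  have [measurable]: "fourier f \<in> borel_measurable borel" using borel_measurable_integrable[OF fh] by simp
  have lim1: "I \<longlonglongrightarrow> (LINT \<xi>|lborel. fourier f \<xi> * iexp (\<xi> * x))"
    unfolding I_def
  proof (rule integral_dominated_convergence[where w = "\<lambda>\<xi>. cmod (fourier f \<xi>)"])
    show "AE \<xi> in lborel. (\<lambda>n. fourier f \<xi> * iexp (\<xi> * x) * of_real (exp (- (\<xi> / real (Suc n))\<^sup>2 / 2)))
        \<longlonglongrightarrow> fourier f \<xi> * iexp (\<xi> * x)"
    proof (rule AE_I2)
      fix \<xi> :: real
      have "(\<lambda>n. \<xi> / real (Suc n)) \<longlonglongrightarrow> 0" by (rule LIMSEQ_Suc[OF lim_const_over_n])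
      then have "(\<lambda>n. complex_of_real (exp (- (\<xi> / real (Suc n))\<^sup>2 / 2))) \<longlonglongrightarrow> of_real (exp (- 0\<^sup>2 / 2))"
        by (intro tendsto_intros) auto
      then show "(\<lambda>n. fourier f \<xi> * iexp (\<xi> * x) * of_real (exp (- (\<xi> / real (Suc n))\<^sup>2 / 2)))
        \<longlonglongrightarrow> fourier f \<xi> * iexp (\<xi> * x)"
        using tendsto_mult[OF tendsto_const] by fastforce
    qed
    show "AE \<xi> in lborel. norm (fourier f \<xi> * iexp (\<xi> * x) * of_real (exp (- (\<xi> / real (Suc n))\<^sup>2 / 2))) \<le> cmod (fourier f \<xi>)" for n
      by (intro AE_I2) (simp add: norm_mult mult_left_le del: of_nat_Suc)
  qed (use fh in \<open>auto intro!: integrable_norm simp del: of_nat_Suc\<close>)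
  \<comment> \<open>The characteristic function of the standard normal distribution, rescaled by
    c.\<close>
  have gauss: "(LINT \<xi>|lborel. of_real (exp (- (\<xi> / c)\<^sup>2 / 2)) * iexp (\<xi> * y))
     = of_real (c * sqrt (2 * pi) * exp (- (c * y)\<^sup>2 / 2))" if c: "c > 0" for c y :: real
  proof -
    have "of_real (exp (- (c * y)\<^sup>2 / 2)) = char std_normal_distribution (c * y)"
      by (simp add: char_std_normal_distribution)
    also have "\<dots> = (LINT z|lborel. std_normal_density z *\<^sub>R iexp (c * y * z))"
      unfolding char_def by (subst integral_density) auto
    also have "\<dots> = (1 / sqrt (2 * pi)) *\<^sub>R (LINT z|lborel. of_real (exp (- z\<^sup>2 / 2)) * iexp (c * y * z))"
      by (subst integral_scaleR_right[symmetric]) (simp add: std_normal_density_def scaleR_conv_of_real)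
    finally have *: "(LINT z|lborel. of_real (exp (- z\<^sup>2 / 2)) * iexp (c * y * z)) = of_real (sqrt (2 * pi) * exp (- (c * y)\<^sup>2 / 2))"
      by (simp add: scaleR_conv_of_real field_simps)
    have "(LINT \<xi>|lborel. of_real (exp (- (\<xi> / c)\<^sup>2 / 2)) * iexp (\<xi> * y))
      = \<bar>c\<bar> *\<^sub>R (LINT z|lborel. of_real (exp (- ((0 + c * z) / c)\<^sup>2 / 2)) * iexp ((0 + c * z) * y))"
      using c by (intro lborel_integral_real_affine) simp
    also have "\<dots> = c *\<^sub>R (LINT z|lborel. of_real (exp (- z\<^sup>2 / 2)) * iexp (c * y * z))"
      using c by (simp add: mult_ac)
    finally show ?thesis unfolding * by (simp add: scaleR_conv_of_real mult.assoc)
  qed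
  have gi: "integrable lborel (\<lambda>\<xi>. complex_of_real (exp (- (\<xi> / c)\<^sup>2 / 2)))" if c: "c > 0" for c :: real
  proof -
    have "integrable lborel std_normal_density" by (rule integrable_normal_moment[of 1 0 0, simplified] | simp)+
    then have "integrable lborel (\<lambda>z. sqrt (2 * pi) * std_normal_density z)" by (rule integrable_mult_right)
    then have "integrable lborel (\<lambda>z::real. exp (- z\<^sup>2 / 2))" by (simp add: std_normal_density_def)
    from lborel_integrable_real_affine[OF this, of "1 / c" 0] show ?thesis
      using c by (intro integrable_of_real) simp
  qed
  have In: "I n = 2 * of_real pi * (LINT z|lborel. of_real (std_normal_density z) * f (x + z / real (Suc n)))" for n
  proof -
    define c where "c = real (Suc n)"
    have c: "c > 0" by (simp add: c_def)
    let ?v = "\<lambda>\<xi>. iexp (\<xi> * x) * complex_of_real (exp (- (\<xi> / c)\<^sup>2 / 2))"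
    have vi: "integrable lborel ?v"
      using integrable_mult_exp(2)[OF gi[OF c], of x] by (simp add: mult_ac)
    have vi': "integrable lborel (\<lambda>\<xi>. ?v (- \<xi>))"
      using lborel_integrable_real_affine[OF vi, of "-1" 0] by simp
    have "I n = (LINT \<xi>|lborel. ?v \<xi> * fourier f \<xi>)"
      unfolding I_def c_def by (simp only: mult_ac)
    \<comment> \<open>The reflection turns the kernel of \<open>fourier\<close> into the one in
      \<open>Fubini_exp\<close>.\<close>
    also have "\<dots> = (LINT \<xi>|lborel. ?v (- \<xi>) * fourier f (- \<xi>))"
      using lborel_integral_real_affine[of "-1" "\<lambda>\<xi>. ?v \<xi> * fourier f \<xi>" 0] by simp
    also have "\<dots> = (LINT \<xi>|lborel. ?v (- \<xi>) * (LINT y|lborel. f y * iexp (\<xi> * y)))"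
      unfolding fourier_def by simp
    also have "\<dots> = (LINT y|lborel. f y * (LINT \<xi>|lborel. ?v (- \<xi>) * iexp (\<xi> * y)))"
      by (rule Fubini_exp[OF fi vi', symmetric])
    also have "\<dots> = (LINT y|lborel. f y * of_real (c * sqrt (2 * pi) * exp (- (c * (y - x))\<^sup>2 / 2)))"
    proof (intro Bochner_Integration.integral_cong refl)
      fix y
      have "(LINT \<xi>|lborel. ?v (- \<xi>) * iexp (\<xi> * y))
         = (LINT \<xi>|lborel. of_real (exp (- (\<xi> / c)\<^sup>2 / 2)) * iexp (\<xi> * (y - x)))"
      proof (intro Bochner_Integration.integral_cong refl)
        fix \<xi>
        have "iexp (\<xi> * (y - x)) = iexp (- \<xi> * x) * iexp (\<xi> * y)"
          unfolding exp_add[symmetric] by (simp add: algebra_simps)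
        then show "?v (- \<xi>) * iexp (\<xi> * y) = of_real (exp (- (\<xi> / c)\<^sup>2 / 2)) * iexp (\<xi> * (y - x))"
          by (simp add: mult_ac)
      qed
      then show "f y * (LINT \<xi>|lborel. ?v (- \<xi>) * iexp (\<xi> * y)) = f y * of_real (c * sqrt (2 * pi) * exp (- (c * (y - x))\<^sup>2 / 2))"
        unfolding gauss[OF c] by simp
    qed
    also have "\<dots> = \<bar>1 / c\<bar> *\<^sub>R (LINT z|lborel. f (x + 1 / c * z) * of_real (c * sqrt (2 * pi) * exp (- (c * ((x + 1 / c * z) - x))\<^sup>2 / 2)))"
      using c by (intro lborel_integral_real_affine) simp
    also have "\<dots> = (1 / c) *\<^sub>R (LINT z|lborel. of_real (c * (2 * pi)) * (of_real (std_normal_density z) * f (x + z / c)))"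
    proof -
      have s: "sqrt (2 * pi) = 2 * pi / sqrt (2 * pi)" by (simp add: real_div_sqrt)
      have *: "f (x + 1 / c * z) * of_real (c * sqrt (2 * pi) * exp (- (c * ((x + 1 / c * z) - x))\<^sup>2 / 2))
        = of_real (c * (2 * pi)) * (of_real (std_normal_density z) * f (x + z / c))" for z
      proof -
        have "c * ((x + 1 / c * z) - x) = z" using c by simp
        moreover have "c * sqrt (2 * pi) * exp (- z\<^sup>2 / 2) = c * (2 * pi) * std_normal_density z"
          unfolding std_normal_density_def by (subst s) simp
        ultimately show ?thesis by (simp only: of_real_mult) (simp add: mult_ac)
      qed
      have "\<bar>1 / c\<bar> = 1 / c" using c by simp
      then show ?thesis by (simp only: *)
    qed
    also have "\<dots> = 2 * of_real pi * (LINT z|lborel. of_real (std_normal_density z) * f (x + z / c))"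
      unfolding integral_mult_right_zero using c by (simp add: scaleR_conv_of_real)
    finally show ?thesis unfolding c_def .
  qed
  have sni: "integrable lborel (\<lambda>z. std_normal_density z)" by (rule integrable_normal_moment[of 1 0 0, simplified] | simp)+
  have lim2: "(\<lambda>n. LINT z|lborel. of_real (std_normal_density z) * f (x + z / real (Suc n))) \<longlonglongrightarrow> (LINT z|lborel. of_real (std_normal_density z) * f x)"
  proof -
    obtain C where C: "\<And>x. (1 + \<bar>x\<bar>) ^ 0 * cmod (f x) \<le> C" by (rule rapidE[OF f], rule that)
    show ?thesis
    proof (rule integral_dominated_convergence[where w = "\<lambda>z. std_normal_density z * C"])
      show "integrable lborel (\<lambda>z. std_normal_density z * C)" using sni by (rule integrable_mult_left)
      show "AE z in lborel. (\<lambda>n. of_real (std_normal_density z) * f (x + z / real (Suc n))) \<longlonglongrightarrow> of_real (std_normal_density z) * f x"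
      proof (rule AE_I2)
        fix z :: real
        have "(\<lambda>n. x + z / real (Suc n)) \<longlonglongrightarrow> x + 0"
          by (intro tendsto_intros LIMSEQ_Suc[OF lim_const_over_n])
        moreover have "isCont f x" using rapid_continuous[OF f] by (simp add: continuous_on_eq_continuous_at)
        ultimately have "(\<lambda>n. f (x + z / real (Suc n))) \<longlonglongrightarrow> f x"
          using isCont_tendsto_compose[of x f] by simp
        then show "(\<lambda>n. of_real (std_normal_density z) * f (x + z / real (Suc n))) \<longlonglongrightarrow> of_real (std_normal_density z) * f x"
          by (intro tendsto_intros)
      qed
      show "AE z in lborel. norm (of_real (std_normal_density z) * f (x + z / real (Suc n))) \<le> std_normal_density z * C" for n
        using C by (intro AE_I2) (auto simp: norm_mult intro!: mult_left_mono)
    qed auto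
  qed
  have one: "(LINT z|lborel. complex_of_real (std_normal_density z) * f x) = f x"
  proof -
    have "(LINT z|lborel. std_normal_density z) = 1" by (rule integral_normal_density) simp
    then show ?thesis by (simp add: integral_mult_left_zero)
  qed
  have "I \<longlonglongrightarrow> 2 * of_real pi * f x"
    unfolding In[abs_def] using tendsto_mult[OF tendsto_const lim2, of "2 * of_real pi"] unfolding one .
  then show ?thesis using lim1 by (rule LIMSEQ_unique[rotated])
qed

section \<open>Sobolev norms of modulated bumps\<close>

text \<open>Counts how many derivatives exist and decay rapidly. The derivative is quantified rather
  than computed, so closure under products follows by exhibiting it.\<close>

primrec rdiff :: "nat \<Rightarrow> (real \<Rightarrow> complex) \<Rightarrow> bool" where
  "rdiff 0 u \<longleftrightarrow> rapid u"
| "rdiff (Suc n) u \<longleftrightarrow> rapid u \<and> (\<exists>u'. (\<forall>x. (u has_vector_derivative u' x) (at x)) \<and> rdiff n u')"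

lemma rdiff_rapid: "rdiff n u \<Longrightarrow> rapid u"
  by (cases n) auto

lemma rdiff_SucI:
  "rapid u \<Longrightarrow> (\<And>x. (u has_vector_derivative u' x) (at x)) \<Longrightarrow> rdiff n u' \<Longrightarrow> rdiff (Suc n) u"
  by auto

lemma rdiff_SucD: "rdiff (Suc n) u \<Longrightarrow> rdiff n u"
  by (induction n arbitrary: u) auto

lemma rdiff_add: "rdiff n u \<Longrightarrow> rdiff n v \<Longrightarrow> rdiff n (\<lambda>x. u x + v x)"
proof (induction n arbitrary: u v)
  case (Suc n)
  obtain u' where u': "\<And>x. (u has_vector_derivative u' x) (at x)" "rdiff n u'" using Suc.prems(1) by auto
  obtain v' where v': "\<And>x. (v has_vector_derivative v' x) (at x)" "rdiff n v'" using Suc.prems(2) by auto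
  show ?case
    unfolding rdiff.simps
    using Suc.prems rdiff_rapid Suc.IH[OF u'(2) v'(2)] has_vector_derivative_add[OF u'(1) v'(1)]
    by (intro conjI exI[of _ "\<lambda>x. u' x + v' x"] rapid_add) blast+
qed (simp add: rapid_add)

lemma rdiff_scale: "rdiff n u \<Longrightarrow> rdiff n (\<lambda>x. c * u x)"
proof (induction n arbitrary: u)
  case (Suc n)
  obtain u' where u': "\<And>x. (u has_vector_derivative u' x) (at x)" "rdiff n u'" using Suc.prems by auto
  show ?case
    unfolding rdiff.simps
    using Suc.prems rdiff_rapid Suc.IH[OF u'(2)] has_vector_derivative_mult_right[OF u'(1), of c]
    by (intro conjI exI[of _ "\<lambda>x. c * u' x"] rapid_scale) blast+
qed (simp add: rapid_scale)

lemma rdiff_times_id: "rdiff n u \<Longrightarrow> rdiff n (\<lambda>x. of_real x * u x)"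
proof (induction n arbitrary: u)
  case 0
  then show ?case using rapid_mult[OF poly_growth_id[of 1], of u] by simp
next
  case (Suc n)
  obtain u' where u': "\<And>x. (u has_vector_derivative u' x) (at x)" "rdiff n u'" using Suc.prems by auto
  have x: "((\<lambda>x. complex_of_real x) has_vector_derivative 1) (at x)" for x
    using has_vector_derivative_of_real[OF DERIV_ident] by simp
  have "((\<lambda>x. of_real x * u x) has_vector_derivative of_real x * u' x + 1 * u x) (at x)" for x
    by (rule has_vector_derivative_mult[OF x u'(1)])
  moreover have "rdiff n (\<lambda>x. of_real x * u' x + 1 * u x)"
    using rdiff_add[OF Suc.IH[OF u'(2)] rdiff_SucD[OF Suc.prems]] by simp
  moreover have "rapid (\<lambda>x. of_real x * u x)"
    using rapid_mult[OF poly_growth_id[of 1] rdiff_rapid[OF Suc.prems]] by simp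
  ultimately show ?case by (intro rdiff_SucI)
qed

lemma rdiff_shift: "rdiff n u \<Longrightarrow> rdiff n (\<lambda>x. u (a + x))"
proof (induction n arbitrary: u)
  case 0
  then show ?case using rapid_affine[of u 1 a] by simp
next
  case (Suc n)
  obtain u' where u': "\<And>x. (u has_vector_derivative u' x) (at x)" "rdiff n u'" using Suc.prems by auto
  have "((\<lambda>x. u (a + x)) has_vector_derivative u' (a + x)) (at x)" for x
  proof -
    have "((\<lambda>x. a + x) has_vector_derivative 1) (at x)"
      by (auto intro!: derivative_eq_intros simp: has_real_derivative_iff_has_vector_derivative[symmetric])
    from vector_diff_chain_at[OF this u'(1)] show ?thesis by (simp add: o_def)
  qed
  moreover have "rapid (\<lambda>x. u (a + x))" using rapid_affine[OF rdiff_rapid[OF Suc.prems], of 1 a] by simp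
  ultimately show ?case using Suc.IH[OF u'(2)] by (intro rdiff_SucI)
qed

text \<open>The power 2 a of the Japanese bracket; the Bessel multiplier of order s is
  \<open>japanese (- s / 2)\<close>.\<close>

definition japanese :: "real \<Rightarrow> real \<Rightarrow> complex" where
  "japanese a x = of_real ((1 + x\<^sup>2) powr a)"

lemma one_plus_square_pos: "1 + x\<^sup>2 > (0::real)" by (simp add: add_pos_nonneg)

lemma continuous_japanese: "continuous_on UNIV (japanese a)"
proof -
  have "1 + x\<^sup>2 \<noteq> 0" for x :: real using one_plus_square_pos[of x] by linarith
  then show ?thesis unfolding japanese_def by (intro continuous_intros) auto
qed

lemma norm_japanese: "cmod (japanese a x) = (1 + x\<^sup>2) powr a"
  by (simp add: japanese_def)

lemma one_plus_square_powr_le: "a \<ge> 0 \<Longrightarrow> (1 + x\<^sup>2) powr (a / 2) \<le> (1 + \<bar>x\<bar>) powr a" for a x :: real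
proof -
  assume a: "a \<ge> 0"
  have "(1 + x\<^sup>2) powr (a / 2) \<le> ((1 + \<bar>x\<bar>)\<^sup>2) powr (a / 2)"
    using a one_plus_square_pos[of x] by (intro powr_mono2) (auto simp: power2_sum)
  also have "\<dots> = (1 + \<bar>x\<bar>) powr a"
    by (simp add: powr_powr power2_eq_square powr_mult powr_add[symmetric])
  finally show ?thesis .
qed

lemma powr_le_power: "(1 + \<bar>x\<bar>) powr a \<le> (1 + \<bar>x\<bar>) ^ nat \<lceil>\<bar>a\<bar>\<rceil>" for a x :: real
proof -
  have "(1 + \<bar>x\<bar>) powr a \<le> (1 + \<bar>x\<bar>) powr real (nat \<lceil>\<bar>a\<bar>\<rceil>)"
    by (intro powr_mono) linarith+
  also have "\<dots> = (1 + \<bar>x\<bar>) ^ nat \<lceil>\<bar>a\<bar>\<rceil>" by (rule powr_realpow) simp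
  finally show ?thesis .
qed

lemma poly_growth_japanese: "poly_growth (japanese a)"
proof (rule poly_growthI[OF continuous_japanese, of _ 1 "nat \<lceil>\<bar>2 * \<bar>a\<bar>\<bar>\<rceil>"])
  fix x
  have "cmod (japanese a x) \<le> (1 + x\<^sup>2) powr ((2 * \<bar>a\<bar>) / 2)"
    unfolding norm_japanese by (intro powr_mono) auto
  also have "\<dots> \<le> (1 + \<bar>x\<bar>) powr (2 * \<bar>a\<bar>)" by (rule one_plus_square_powr_le) simp
  also have "\<dots> \<le> (1 + \<bar>x\<bar>) ^ nat \<lceil>\<bar>2 * \<bar>a\<bar>\<bar>\<rceil>" by (rule powr_le_power)
  finally show "cmod (japanese a x) \<le> 1 * (1 + \<bar>x\<bar>) ^ nat \<lceil>\<bar>2 * \<bar>a\<bar>\<bar>\<rceil>" by simp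
qed

lemma japanese_deriv: "(japanese a has_vector_derivative 2 * of_real a * (of_real x * japanese (a - 1) x)) (at x)"
proof -
  have "((\<lambda>x. (1 + x\<^sup>2) powr a) has_real_derivative 2 * a * (x * (1 + x\<^sup>2) powr (a - 1))) (at x)"
    using one_plus_square_pos[of x] by (auto intro!: derivative_eq_intros simp: powr_diff field_simps)
  from has_vector_derivative_of_real[OF this] show ?thesis
    by (simp add: japanese_def[abs_def])
qed

text \<open>Differentiation replaces a by a - 1, hence the induction over all exponents at
  once.\<close>

lemma rdiff_japanese: "rdiff n u \<Longrightarrow> rdiff n (\<lambda>x. japanese a x * u x)"
proof (induction n arbitrary: u a)
  case 0
  then show ?case by (simp add: rapid_mult poly_growth_japanese)
next
  case (Suc n)
  obtain u' where u': "\<And>x. (u has_vector_derivative u' x) (at x)" "rdiff n u'" using Suc.prems by auto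
  have "((\<lambda>x. japanese a x * u x) has_vector_derivative
      japanese a x * u' x + 2 * of_real a * (of_real x * japanese (a - 1) x) * u x) (at x)" for x
    by (rule has_vector_derivative_mult[OF japanese_deriv u'(1)])
  moreover have "rdiff n (\<lambda>x. japanese a x * u' x + 2 * of_real a * (of_real x * japanese (a - 1) x) * u x)"
    using rdiff_add[OF Suc.IH[OF u'(2), of a] rdiff_scale[OF rdiff_times_id[OF Suc.IH[OF rdiff_SucD[OF Suc.prems], of "a - 1"]], of "2 * of_real a"]]
    by (simp add: mult.assoc)
  moreover have "rapid (\<lambda>x. japanese a x * u x)"
    by (rule rapid_mult[OF poly_growth_japanese rdiff_rapid[OF Suc.prems]])
  ultimately show ?case by (intro rdiff_SucI)
qed

lemma one_plus_abs_power_le: "(1 + \<bar>x\<bar>) ^ N \<le> 2 ^ N * (1 + \<bar>x\<bar> ^ N)" for x :: real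
proof (cases "\<bar>x\<bar> \<le> 1")
  case True
  then have "(1 + \<bar>x\<bar>) ^ N \<le> 2 ^ N" by (intro power_mono) auto
  also have "\<dots> \<le> 2 ^ N * (1 + \<bar>x\<bar> ^ N)" by simp
  finally show ?thesis .
next
  case False
  then have "(1 + \<bar>x\<bar>) ^ N \<le> (2 * \<bar>x\<bar>) ^ N" by (intro power_mono) auto
  also have "\<dots> \<le> 2 ^ N * (1 + \<bar>x\<bar> ^ N)" by (simp add: power_mult_distrib)
  finally show ?thesis .
qed

lemma rapidI:
  assumes c: "continuous_on UNIV u" and b: "\<And>N. \<exists>C. \<forall>x. \<bar>x\<bar> ^ N * cmod (u x) \<le> C"
  shows "rapid u"
  unfolding rapid_def
proof (intro conjI allI c)
  fix N
  obtain C where C: "\<And>x. \<bar>x\<bar> ^ 0 * cmod (u x) \<le> C" using b by blast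
  obtain D where D: "\<And>x. \<bar>x\<bar> ^ N * cmod (u x) \<le> D" using b by blast
  have "(1 + \<bar>x\<bar>) ^ N * cmod (u x) \<le> 2 ^ N * (C + D)" for x
  proof -
    have "(1 + \<bar>x\<bar>) ^ N * cmod (u x) \<le> 2 ^ N * (1 + \<bar>x\<bar> ^ N) * cmod (u x)"
      by (intro mult_right_mono one_plus_abs_power_le) simp
    also have "\<dots> = 2 ^ N * (\<bar>x\<bar> ^ 0 * cmod (u x) + \<bar>x\<bar> ^ N * cmod (u x))" by (simp add: algebra_simps)
    also have "\<dots> \<le> 2 ^ N * (C + D)" by (intro mult_left_mono add_mono C D) simp
    finally show ?thesis .
  qed
  then show "\<exists>C. \<forall>x. (1 + \<bar>x\<bar>) ^ N * cmod (u x) \<le> C" by blast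
qed

section \<open>Fourier transforms of Schwartz functions\<close>

lemma schwartz_rdiff:
  assumes "f \<in> schwartz" shows "rdiff n f"
proof -
  have d: "iter_deriv n f differentiable (at x)" for n x
    using assms by (simp add: schwartz_def smooth_def)
  have d': "(iter_deriv n f has_vector_derivative iter_deriv (Suc n) f x) (at x)" for n x
    using vector_derivative_works[THEN iffD1, OF d[of n x]] by (simp add: iter_deriv_def)
  have r: "rapid (iter_deriv n f)" for n
  proof (rule rapidI)
    show "continuous_on UNIV (iter_deriv n f)"
      by (intro continuous_at_imp_continuous_on ballI differentiable_imp_continuous_within d)
    show "\<exists>C. \<forall>x. \<bar>x\<bar> ^ k * cmod (iter_deriv n f x) \<le> C" for k
      using assms by (auto simp: schwartz_def bounded_iff norm_mult norm_power)
  qed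
  have "rdiff n (iter_deriv k f)" for k
    by (induction n arbitrary: k) (simp add: r, rule rdiff_SucI[OF r d'])
  from this[of 0] show ?thesis by (simp add: iter_deriv_def)
qed

lemma Cc_infinity_schwartz:
  assumes f: "f \<in> Cc_infinity" shows "f \<in> schwartz"
proof -
  have d: "iter_deriv n f differentiable (at x)" for n x
    using assms by (simp add: Cc_infinity_def smooth_def)
  have cl: "open (- supp f)" by (simp add: supp_def open_Compl)
  have z: "x \<in> - supp f \<Longrightarrow> iter_deriv n f x = 0" for n x
  proof (induction n arbitrary: x)
    case 0
    then show ?case using closure_subset[of "{x. f x \<noteq> 0}"] by (auto simp: iter_deriv_def supp_def)
  next
    case (Suc n)
    have "(iter_deriv n f has_vector_derivative 0) (at x)"
      by (rule has_vector_derivative_transform_within_open[OF has_vector_derivative_const cl Suc.prems, of 0])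
        (simp add: Suc.IH)
    then show ?case by (simp add: iter_deriv_def vector_derivative_at)
  qed
  have "bounded (range (\<lambda>x. complex_of_real (x ^ k) * iter_deriv n f x))" for k n
  proof -
    have "continuous_on (supp f) (\<lambda>x. complex_of_real (x ^ k) * iter_deriv n f x)"
      by (intro continuous_intros continuous_at_imp_continuous_on ballI differentiable_imp_continuous_within d)
    then have "bounded ((\<lambda>x. complex_of_real (x ^ k) * iter_deriv n f x) ` supp f)"
      using f by (intro compact_imp_bounded compact_continuous_image) (auto simp: Cc_infinity_def)
    then have "bounded (insert 0 ((\<lambda>x. complex_of_real (x ^ k) * iter_deriv n f x) ` supp f))" by simp
    then show ?thesis
    proof (rule bounded_subset, intro image_subsetI)
      fix x
      show "complex_of_real (x ^ k) * iter_deriv n f x \<in> insert 0 ((\<lambda>x. complex_of_real (x ^ k) * iter_deriv n f x) ` supp f)"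
        by (cases "x \<in> supp f") (simp_all add: z)
    qed
  qed
  then show ?thesis using f by (simp add: schwartz_def Cc_infinity_def)
qed

text \<open>Differentiation under the integral, made quantitative by |exp (i a) - 1 - i a| <= a^2 /
  2: the remainder is quadratic because x^2 u is integrable.\<close>

lemma fourier_has_derivative:
  assumes u: "rapid u"
  shows "(fourier u has_vector_derivative - \<i> * fourier (\<lambda>x. of_real x * u x) \<xi>) (at \<xi>)"
proof -
  have xu: "rapid (\<lambda>x. of_real x * u x)" using rapid_mult[OF poly_growth_id[of 1] u] by simp
  have xxu: "rapid (\<lambda>x. of_real x * (of_real x * u x))" using rapid_mult[OF poly_growth_id[of 1] xu] by simp
  define K where "K = (LINT x|lborel. cmod (of_real x * (of_real x * u x)))"
  define D where "D = - \<i> * fourier (\<lambda>x. of_real x * u x) \<xi>"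
  note ii = integrable_mult_exp(1)[OF rapid_integrable]
  have est: "cmod (fourier u y - fourier u \<xi> - (y - \<xi>) *\<^sub>R D) \<le> (y - \<xi>)\<^sup>2 / 2 * K" for y
  proof -
    define G where "G x = u x * fker y x - u x * fker \<xi> x
        - of_real (y - \<xi>) * (- \<i> * (of_real x * u x * fker \<xi> x))" for x
    have i1: "integrable lborel (\<lambda>x. of_real (y - \<xi>) * (- \<i> * (of_real x * u x * fker \<xi> x)))"
      by (intro integrable_mult_right ii xu)
    have iG: "integrable lborel G" unfolding G_def
      by (intro Bochner_Integration.integrable_diff ii u i1)
    have "fourier u y - fourier u \<xi> - (y - \<xi>) *\<^sub>R D = (LINT x|lborel. G x)"
    proof -
      have "(LINT x|lborel. G x) = (LINT x|lborel. u x * fker y x - u x * fker \<xi> x)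
         - (LINT x|lborel. of_real (y - \<xi>) * (- \<i> * (of_real x * u x * fker \<xi> x)))"
        unfolding G_def by (intro Bochner_Integration.integral_diff Bochner_Integration.integrable_diff ii u i1)
      also have "(LINT x|lborel. u x * fker y x - u x * fker \<xi> x) = fourier u y - fourier u \<xi>"
        unfolding fourier_def by (intro Bochner_Integration.integral_diff ii u)
      also have "(LINT x|lborel. of_real (y - \<xi>) * (- \<i> * (of_real x * u x * fker \<xi> x))) = (y - \<xi>) *\<^sub>R D"
        unfolding integral_mult_right_zero D_def fourier_def scaleR_conv_of_real ..
      finally show ?thesis by simp
    qed
    also have "cmod \<dots> \<le> (LINT x|lborel. cmod (G x))" by (rule integral_norm_bound)
    also have "\<dots> \<le> (LINT x|lborel. (y - \<xi>)\<^sup>2 / 2 * cmod (of_real x * (of_real x * u x)))"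
    proof (rule integral_mono)
      fix x :: real
      define a where "a = - ((y - \<xi>) * x)"
      have e: "fker y x = fker \<xi> x * iexp a"
        unfolding exp_add[symmetric] a_def by (simp add: algebra_simps)
      have "G x = u x * fker \<xi> x * (iexp a - 1 - \<i> * of_real a)"
        unfolding G_def e by (simp add: a_def algebra_simps)
      then have "cmod (G x) = cmod (u x) * cmod (iexp a - 1 - \<i> * of_real a)"
        by (simp add: norm_mult)
      also have "\<dots> \<le> cmod (u x) * (a\<^sup>2 / 2)"
      proof (rule mult_left_mono)
        show "cmod (iexp a - 1 - \<i> * of_real a) \<le> a\<^sup>2 / 2"
          using iexp_approx1[of a 1] by (simp add: diff_diff_eq power2_eq_square)
      qed simp
      also have "\<dots> = (y - \<xi>)\<^sup>2 / 2 * cmod (of_real x * (of_real x * u x))"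
        by (simp add: a_def norm_mult power_mult_distrib power2_eq_square abs_mult_self_eq)
      finally show "cmod (G x) \<le> (y - \<xi>)\<^sup>2 / 2 * cmod (of_real x * (of_real x * u x))" .
    qed (use iG rapid_integrable[OF xxu] in \<open>auto intro!: integrable_mult_right integrable_norm\<close>)
    also have "\<dots> = (y - \<xi>)\<^sup>2 / 2 * K" unfolding K_def by (rule integral_mult_right_zero)
    finally show ?thesis .
  qed
  have "(fourier u has_derivative (\<lambda>h. h *\<^sub>R D)) (at \<xi>)"
    unfolding has_derivative_iff_norm
  proof (intro conjI bounded_linear_scaleR_left)
    have "((\<lambda>y. \<bar>y - \<xi>\<bar> * (K / 2)) \<longlongrightarrow> \<bar>\<xi> - \<xi>\<bar> * (K / 2)) (at \<xi>)" by (intro tendsto_intros)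
    then have l: "((\<lambda>y. \<bar>y - \<xi>\<bar> * (K / 2)) \<longlongrightarrow> 0) (at \<xi>)" by simp
    show "((\<lambda>y. norm (fourier u y - fourier u \<xi> - (y - \<xi>) *\<^sub>R D) / norm (y - \<xi>)) \<longlongrightarrow> 0) (at \<xi>)"
    proof (rule Lim_null_comparison[OF _ l], rule always_eventually, rule allI)
      fix y
      have "cmod (fourier u y - fourier u \<xi> - (y - \<xi>) *\<^sub>R D) / \<bar>y - \<xi>\<bar> \<le> (y - \<xi>)\<^sup>2 / 2 * K / \<bar>y - \<xi>\<bar>"
        by (intro divide_right_mono est) simp
      also have "\<dots> = \<bar>y - \<xi>\<bar> * (K / 2)" by (cases "y = \<xi>") (simp_all add: power2_eq_square abs_if field_simps)
      finally show "norm (norm (fourier u y - fourier u \<xi> - (y - \<xi>) *\<^sub>R D) / norm (y - \<xi>)) \<le> \<bar>y - \<xi>\<bar> * (K / 2)"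
        by simp
    qed
  qed
  then show ?thesis unfolding has_vector_derivative_def D_def .
qed

lemma rdiff_fourier_bound: "rdiff n u \<Longrightarrow> \<exists>C. \<forall>\<xi>. \<bar>\<xi>\<bar> ^ n * cmod (fourier u \<xi>) \<le> C"
proof (induction n arbitrary: u)
  case 0
  then show ?case using fourier_bound[OF rapid_integrable, of u] by auto
next
  case (Suc n)
  obtain u' where u': "\<And>x. (u has_vector_derivative u' x) (at x)" "rdiff n u'" using Suc.prems by auto
  obtain C where C: "\<And>\<xi>. \<bar>\<xi>\<bar> ^ n * cmod (fourier u' \<xi>) \<le> C" using Suc.IH[OF u'(2)] by blast
  have "\<bar>\<xi>\<bar> ^ Suc n * cmod (fourier u \<xi>) \<le> C" for \<xi>
    using C[of \<xi>] unfolding fourier_deriv[OF rdiff_rapid[OF Suc.prems] rdiff_rapid[OF u'(2)] u'(1)]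
    by (simp add: norm_mult mult_ac)
  then show ?case by blast
qed

lemma rapid_fourier:
  assumes u: "\<And>n. rdiff n u" shows "rapid (fourier u)"
proof (rule rapidI)
  have "isCont (fourier u) \<xi>" for \<xi>
    by (rule has_vector_derivative_continuous[OF fourier_has_derivative[OF rdiff_rapid[OF u]]])
  then show "continuous_on UNIV (fourier u)" by (simp add: continuous_at_imp_continuous_on)
qed (rule rdiff_fourier_bound[OF u])

lemma rdiff_fourier:
  assumes u: "\<And>n. rdiff n u" shows "rdiff n (fourier u)"
  using u
proof (induction n arbitrary: u)
  case 0
  then show ?case by (simp add: rapid_fourier)
next
  case (Suc n)
  have "rdiff n (\<lambda>\<xi>. - \<i> * fourier (\<lambda>x. of_real x * u x) \<xi>)"
    by (intro rdiff_scale Suc.IH rdiff_times_id Suc.prems)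
  then show ?case
    by (rule rdiff_SucI[OF rapid_fourier[OF Suc.prems] fourier_has_derivative[OF rdiff_rapid[OF Suc.prems]]])
qed

lemma fourier_reflect: "fourier u (- \<xi>) = (LINT x|lborel. u x * iexp (\<xi> * x))"
  by (simp add: fourier_def)

text \<open>The potential is the inverse transform of the multiplied symbol, written as a reflected
  forward transform. In the pairing with a test function, Fubini moves both sides to the frequency
  variable, where the two multipliers cancel.\<close>

lemma is_bessel_potential_fourier:
  assumes F: "rapid F" and h: "\<And>n. rdiff n h" and hF: "\<And>\<xi>. h \<xi> = japanese (s / 2) \<xi> * fourier F \<xi>"
  shows "is_bessel_potential s (\<lambda>x. 1 / (2 * of_real pi) * fourier h (- x)) F"
proof -
  define g where "g x = 1 / (2 * complex_of_real pi) * fourier h (- x)" for x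
  have hr: "rapid (fourier h)" by (rule rapid_fourier[OF h])
  have g: "rapid g" unfolding g_def[abs_def] using rapid_scale[OF rapid_affine[OF hr, of "-1" 0], of "1 / (2 * complex_of_real pi)"] by simp
  have gh: "fourier g \<xi> = h \<xi>" for \<xi>
  proof -
    have "fourier g \<xi> = (LINT x|lborel. g (- x) * exp (- (\<i> * complex_of_real (\<xi> * (- x)))))"
      unfolding fourier_def using lborel_integral_real_affine[of "-1" "\<lambda>x. g x * fker \<xi> x" 0] by simp
    also have "\<dots> = (LINT x|lborel. 1 / (2 * complex_of_real pi) * (fourier h x * iexp (x * \<xi>)))"
      by (simp add: g_def mult_ac)
    also have "\<dots> = 1 / (2 * complex_of_real pi) * (2 * of_real pi * h \<xi>)"
      unfolding integral_mult_right_zero fourier_inversion[OF rdiff_rapid[OF h[of 0]] rapid_integrable[OF hr]] ..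
    finally show ?thesis by simp
  qed
  have main: "(LINT x|lborel. F x * phi x) = (LINT x|lborel. g x * bessel_schwartz s phi x)" if "phi \<in> schwartz" for phi
  proof -
    have p: "rdiff n phi" for n by (rule schwartz_rdiff[OF that])
    have pr: "rapid (fourier phi)" by (rule rapid_fourier[OF p])
    define v where "v \<xi> = japanese (- s / 2) \<xi> * fourier phi \<xi>" for \<xi>
    have v: "integrable lborel v" unfolding v_def by (intro rapid_integrable rapid_mult poly_growth_japanese pr)
    have B: "bessel_schwartz s phi x = 1 / (2 * of_real pi) * (LINT \<xi>|lborel. v \<xi> * iexp (\<xi> * x))" for x
      by (simp add: bessel_schwartz_def v_def japanese_def)
    have "(LINT x|lborel. g x * bessel_schwartz s phi x) = (LINT x|lborel. 1 / (2 * of_real pi) * (g x * (LINT \<xi>|lborel. v \<xi> * iexp (\<xi> * x))))"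
      unfolding B by (simp only: mult_ac)
    also have "\<dots> = 1 / (2 * of_real pi) * (LINT x|lborel. g x * (LINT \<xi>|lborel. v \<xi> * iexp (\<xi> * x)))"
      by (rule integral_mult_right_zero)
    also have "(LINT x|lborel. g x * (LINT \<xi>|lborel. v \<xi> * iexp (\<xi> * x)))
        = (LINT \<xi>|lborel. v \<xi> * fourier g (- \<xi>))"
      unfolding fourier_reflect by (rule Fubini_exp[OF rapid_integrable[OF g] v])
    also have "\<dots> = (LINT \<xi>|lborel. fourier phi \<xi> * fourier F (- \<xi>))"
    proof (intro Bochner_Integration.integral_cong refl)
      fix \<xi>
      \<comment> \<open>Evenness of the symbol makes the reflection of the frequency
        harmless.\<close>
      have "japanese (- s / 2) \<xi> * japanese (s / 2) (- \<xi>) = 1"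
        using one_plus_square_pos[of \<xi>] unfolding japanese_def of_real_mult[symmetric] by (simp add: powr_add[symmetric])
      then show "v \<xi> * fourier g (- \<xi>) = fourier phi \<xi> * fourier F (- \<xi>)"
        unfolding v_def gh hF by (metis (no_types, opaque_lifting) mult.assoc mult.commute mult_1)
    qed
    also have "\<dots> = (LINT x|lborel. F x * (LINT \<xi>|lborel. fourier phi \<xi> * iexp (\<xi> * x)))"
      unfolding fourier_reflect by (rule Fubini_exp[OF rapid_integrable[OF F] rapid_integrable[OF pr], symmetric])
    also have "\<dots> = (LINT x|lborel. 2 * of_real pi * (F x * phi x))"
      unfolding fourier_inversion[OF rdiff_rapid[OF p[of 0]] rapid_integrable[OF pr]] by (simp only: mult_ac)
    also have "\<dots> = 2 * of_real pi * (LINT x|lborel. F x * phi x)" by (rule integral_mult_right_zero)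
    finally show ?thesis by simp
  qed
  have FG: "poly_growth F"
  proof -
    obtain C where C: "\<And>x. (1 + \<bar>x\<bar>) ^ 0 * cmod (F x) \<le> C" by (rule rapidE[OF F], rule that)
    then show ?thesis using poly_growthI[OF rapid_continuous[OF F], of C 0] by simp
  qed
  show ?thesis
    unfolding is_bessel_potential_def g_def[symmetric]
    using main rapid_measurable[OF F] rapid_integrable[OF rapid_mult[OF FG rdiff_rapid[OF schwartz_rdiff]]] by simp
qed

lemma Linf_sobolev_modulation_bound:
  assumes chi: "chi \<in> Cc_infinity" and s: "s \<ge> 0"
  obtains C where "C > 0" "\<And>t. (\<lambda>x. iexp (t * x) * chi x) \<in> Linf_sobolev s \<and>
     Linf_sobolev_norm s (\<lambda>x. iexp (t * x) * chi x) \<le> ennreal (C * (1 + \<bar>t\<bar>) powr s)"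
proof -
  have c: "rdiff n chi" for n by (rule schwartz_rdiff[OF Cc_infinity_schwartz[OF chi]])
  have cf: "rapid (fourier chi)" by (rule rapid_fourier[OF c])
  define W where "W \<eta> = complex_of_real ((1 + \<bar>\<eta>\<bar>) powr s) * fourier chi \<eta>" for \<eta>
  have "1 + \<bar>x\<bar> \<noteq> 0" for x :: real by linarith
  then have "poly_growth (\<lambda>\<eta>. complex_of_real ((1 + \<bar>\<eta>\<bar>) powr s))"
    by (intro poly_growthI[of _ 1 "nat \<lceil>\<bar>s\<bar>\<rceil>"]) (auto intro!: continuous_intros powr_le_power)
  then have W: "integrable lborel W" unfolding W_def by (intro rapid_integrable rapid_mult cf)
  define K where "K = (LINT \<eta>|lborel. cmod (W \<eta>))"
  have K: "K \<ge> 0" by (simp add: K_def)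
  \<comment> \<open>1 / (2 pi) is the inversion constant; the added 1 ensures positivity.\<close>
  define C where "C = K / (2 * pi) + 1"
  show thesis
  proof (rule that[of C])
    show "C > 0" using K by (simp add: C_def add_nonneg_pos)
    fix t :: real
    define F where "F x = iexp (t * x) * chi x" for x
    have F: "rapid F"
      unfolding F_def by (intro rapid_mult rdiff_rapid[OF c[of 0]] poly_growthI[of _ 1 0]) (auto intro!: continuous_intros)
    have Fh: "fourier F \<xi> = fourier chi (- t + \<xi>)" for \<xi>
      unfolding fourier_def
    proof (intro Bochner_Integration.integral_cong refl)
      fix x
      have "iexp (t * x) * fker \<xi> x = exp (- (\<i> * complex_of_real ((- t + \<xi>) * x)))"
        unfolding exp_add[symmetric] by (simp add: algebra_simps)
      then show "F x * fker \<xi> x = chi x * exp (- (\<i> * complex_of_real ((- t + \<xi>) * x)))"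
        unfolding F_def by (metis mult.assoc mult.commute)
    qed
    define h where "h \<xi> = japanese (s / 2) \<xi> * fourier chi (- t + \<xi>)" for \<xi>
    have h: "rdiff n h" for n
      unfolding h_def by (intro rdiff_japanese rdiff_shift rdiff_fourier c)
    have hr: "rapid (fourier h)" by (rule rapid_fourier[OF h])
    define g where "g x = 1 / (2 * complex_of_real pi) * fourier h (- x)" for x
    have pot: "is_bessel_potential s g F"
      unfolding g_def[abs_def] by (rule is_bessel_potential_fourier[OF F h]) (simp add: h_def Fh)
    have "rapid g" unfolding g_def[abs_def] using rapid_scale[OF rapid_affine[OF hr, of "-1" 0], of "1 / (2 * complex_of_real pi)"] by simp
    then have [measurable]: "g \<in> borel_measurable borel" by (rule rapid_measurable)
    have hb: "(LINT \<xi>|lborel. cmod (h \<xi>)) \<le> (1 + \<bar>t\<bar>) powr s * K"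
    proof -
      \<comment> \<open>After this translation the decay of the transform of \<open>chi\<close> is
        centred at 0 and only the multiplier depends on t.\<close>
      have "(LINT \<xi>|lborel. cmod (h \<xi>)) = (LINT \<eta>|lborel. cmod (h (t + \<eta>)))"
        using lborel_integral_real_affine[of 1 "\<lambda>\<xi>. cmod (h \<xi>)" t] by simp
      also have "\<dots> \<le> (LINT \<eta>|lborel. (1 + \<bar>t\<bar>) powr s * cmod (W \<eta>))"
      proof (rule integral_mono)
        show "integrable lborel (\<lambda>\<eta>. cmod (h (t + \<eta>)))"
          using lborel_integrable_real_affine[OF rapid_integrable[OF rdiff_rapid[OF h[of 0]]], of 1 t]
          by (auto intro!: integrable_norm)
        show "integrable lborel (\<lambda>\<eta>. (1 + \<bar>t\<bar>) powr s * cmod (W \<eta>))"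
          using W by (intro integrable_mult_right integrable_norm)
        fix \<eta> :: real
        have "cmod (japanese (s / 2) (t + \<eta>)) \<le> (1 + \<bar>t + \<eta>\<bar>) powr s"
          unfolding norm_japanese by (rule one_plus_square_powr_le[OF s])
        also have "\<dots> \<le> ((1 + \<bar>t\<bar>) * (1 + \<bar>\<eta>\<bar>)) powr s"
          using one_plus_abs_shift_le[of \<eta> t] s by (intro powr_mono2) (auto simp: add.commute)
        also have "\<dots> = (1 + \<bar>t\<bar>) powr s * (1 + \<bar>\<eta>\<bar>) powr s" by (rule powr_mult)
        finally have "cmod (japanese (s / 2) (t + \<eta>)) * cmod (fourier chi \<eta>) \<le> (1 + \<bar>t\<bar>) powr s * (1 + \<bar>\<eta>\<bar>) powr s * cmod (fourier chi \<eta>)"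
          by (rule mult_right_mono) simp
        then show "cmod (h (t + \<eta>)) \<le> (1 + \<bar>t\<bar>) powr s * cmod (W \<eta>)"
          by (simp add: h_def W_def norm_mult mult.assoc)
      qed
      also have "\<dots> = (1 + \<bar>t\<bar>) powr s * K" unfolding K_def by (rule integral_mult_right_zero)
      finally show ?thesis .
    qed
    have gb: "cmod (g x) \<le> C * (1 + \<bar>t\<bar>) powr s" for x
    proof -
      have "cmod (g x) = 1 / (2 * pi) * cmod (fourier h (- x))" by (simp add: g_def norm_mult norm_divide)
      also have "\<dots> \<le> 1 / (2 * pi) * ((1 + \<bar>t\<bar>) powr s * K)"
        by (intro mult_left_mono order_trans[OF fourier_bound[OF rapid_integrable[OF rdiff_rapid[OF h[of 0]]]] hb]) simp
      also have "\<dots> = K / (2 * pi) * (1 + \<bar>t\<bar>) powr s" by simp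
      also have "\<dots> \<le> C * (1 + \<bar>t\<bar>) powr s" unfolding C_def by (intro mult_right_mono) auto
      finally show ?thesis .
    qed
    have gn: "Linf_norm g \<le> ennreal (C * (1 + \<bar>t\<bar>) powr s)"
      unfolding Linf_norm_def using gb by (intro esssup_I) (auto intro!: ennreal_leI)
    then have "g \<in> Linf"
      unfolding Linf_def using ennreal_less_top[of "C * (1 + \<bar>t\<bar>) powr s"] by (auto simp: top_unique less_top[symmetric])
    then have "F \<in> Linf_sobolev s \<and> Linf_sobolev_norm s F \<le> ennreal (C * (1 + \<bar>t\<bar>) powr s)"
      using pot gn unfolding Linf_sobolev_def Linf_sobolev_norm_def by (auto intro: order_trans[OF INF_lower])
    then show "(\<lambda>x. iexp (t * x) * chi x) \<in> Linf_sobolev s \<and>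
     Linf_sobolev_norm s (\<lambda>x. iexp (t * x) * chi x) \<le> ennreal (C * (1 + \<bar>t\<bar>) powr s)"
      unfolding F_def .
  qed
qed

theorem proposition6p13:
  fixes chi0 :: "real \<Rightarrow> complex" and F :: "real \<Rightarrow> real \<Rightarrow> complex"
  assumes "chi0 \<in> Cc_infinity"
    and "supp chi0 \<subseteq> {-1/2<..<1/2}"
    and "\<forall>x\<in>{-1/4..1/4}. chi0 x = 1"
    and "\<forall>t x. F t x = exp (\<i> * complex_of_real (t * x)) * chi0 x"
  shows "(\<forall>s\<ge>0. \<exists>C>0. \<forall>t.
            F t \<in> Linf_sobolev s \<and>
            Linf_sobolev_norm s (F t) \<le> ennreal (C * (1 + \<bar>t\<bar>) powr s))
       \<and> (\<exists>t0>0. \<forall>q\<ge>2. \<exists>c>0.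
            \<forall>(adj :: 'v \<Rightarrow> 'v \<Rightarrow> bool) \<omega> lev.
              homogeneous_tree q adj \<and> \<omega> \<in> ends adj \<and> level_function adj \<omega> lev \<longrightarrow>
              (\<forall>t\<ge>t0.
                H1_L1_opnorm q adj \<omega> lev
                  (functional_calculus (flow_measure q lev) (flow_laplacian q adj \<omega> lev) (F t))
                \<ge> ennreal (c * t powr (3/2))))"
proof -
  have F: "F t = (\<lambda>x. exp (\<i> * complex_of_real (t * x)) * chi0 x)" for t
    using assms(4) by blast
  have "\<exists>C>0. \<forall>t. F t \<in> Linf_sobolev s \<and> Linf_sobolev_norm s (F t) \<le> ennreal (C * (1 + \<bar>t\<bar>) powr s)"
    if s: "s \<ge> 0" for s
  proof -
    obtain C where "C > 0" "\<And>t. (\<lambda>x. exp (\<i> * complex_of_real (t * x)) * chi0 x) \<in> Linf_sobolev s \<and>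
        Linf_sobolev_norm s (\<lambda>x. exp (\<i> * complex_of_real (t * x)) * chi0 x) \<le> ennreal (C * (1 + \<bar>t\<bar>) powr s)"
      by (rule Linf_sobolev_modulation_bound[OF assms(1) s], rule that)
    then show ?thesis unfolding F by (intro exI[of _ C] conjI allI) auto
  qed
  moreover
  \<comment> \<open>Both constants come from sine coefficients alone, so they are fixed before
    q.\<close>
  obtain t0 c where t0: "t0 > 0" and c: "c > 0"
    and osc: "\<And>t. t \<ge> t0 \<Longrightarrow> \<exists>N. (\<Sum>i=1..N. \<Sum>j=1..N.
       cmod (sin_coef (\<lambda>x. of_real x * (exp (\<i> * of_real (t * x)) * chi0 x)) (i + j))) \<ge> c * t powr (3/2)"
    by (rule oscillatory_sin_coef_weighted_sum[OF assms(1-3)], rule that)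
  have contF: "continuous_on UNIV (F t)" for t
  proof -
    have "rapid chi0" by (rule rdiff_rapid[OF schwartz_rdiff[OF Cc_infinity_schwartz[OF assms(1)]]])
    then show ?thesis unfolding F by (intro continuous_intros rapid_continuous)
  qed
  have "\<exists>c>0. \<forall>(adj :: 'v \<Rightarrow> 'v \<Rightarrow> bool) \<omega> lev.
      homogeneous_tree q adj \<and> \<omega> \<in> ends adj \<and> level_function adj \<omega> lev \<longrightarrow>
      (\<forall>t\<ge>t0. H1_L1_opnorm q adj \<omega> lev
          (functional_calculus (flow_measure q lev) (flow_laplacian q adj \<omega> lev) (F t))
        \<ge> ennreal (c * t powr (3/2)))"
    if q: "q \<ge> 2" for q
  proof -
    \<comment> \<open>The only place where q enters: normalisation of the atom times the mass factor
      1 - 1/q of the sets \<open>meet\<close>.\<close>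
    define K where "K = (1 - 1 / real q) / (12 * (real q)\<^sup>2)"
    have K: "K > 0" using q by (simp add: K_def)
    show ?thesis
    proof (intro exI[of _ "K * c"] conjI allI impI)
      show "K * c > 0" using K c by simp
      fix adj :: "'v \<Rightarrow> 'v \<Rightarrow> bool" and \<omega> lev and t
      assume tree: "homogeneous_tree q adj \<and> \<omega> \<in> ends adj \<and> level_function adj \<omega> lev" and t: "t0 \<le> t"
      obtain N where N: "c * t powr (3/2) \<le> (\<Sum>i=1..N. \<Sum>j=1..N. cmod (sin_coef (\<lambda>x. of_real x * F t x) (i + j)))"
        using osc[OF t] unfolding F by blast
      have "ennreal (K * c * t powr (3/2)) \<le> ennreal (K * (\<Sum>i=1..N. \<Sum>j=1..N. cmod (sin_coef (\<lambda>x. of_real x * F t x) (i + j))))"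
        unfolding mult.assoc using K N by (intro ennreal_leI mult_left_mono) auto
      also have "\<dots> \<le> H1_L1_opnorm q adj \<omega> lev
          (functional_calculus (flow_measure q lev) (flow_laplacian q adj \<omega> lev) (F t))"
        unfolding K_def using tree by (intro H1_L1_opnorm_ge contF q) auto
      finally show "ennreal (K * c * t powr (3/2)) \<le> H1_L1_opnorm q adj \<omega> lev
          (functional_calculus (flow_measure q lev) (flow_laplacian q adj \<omega> lev) (F t))" .
    qed
  qed
  ultimately show ?thesis using t0 by blast
qed

end
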